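(* Let $n\ge 3$, let $\alpha_3,\alpha_4,\ldots,\alpha_n$ be arbitrary nonpositive real numbers, and set $$\beta_3=-\alpha_3^2+\tfrac14,\qquad \beta_m=-\alpha_m^2+\left(\alpha_{m-1}-\tfrac12\right)^2,\quad m=4,\ldots,n.$$ Let $\frac{2(n-1)}{n-2}<Q\le\frac{2n}{n-2}$, and consider the inequality $$( * )\qquad \int_{\mathbb{R}^n}|\nabla u|^2\,dx\ \ge\ \int_{\mathbb{R}^n}\left(\frac{\beta_3}{|\mathbf{X_3}|^2}+\ldots+\frac{\beta_n}{|\mathbf{X_n}|^2}\right)u^2\,dx+C\left(\int_{\mathbb{R}^n}|x_1|^{\frac{Q-2}{2}n-Q}|u|^{Q}\,dx\right)^{\frac{2}{Q}}.$$ If $\alpha_n<0$, then there exists a constant $C>0$ such that $( * )$ holds for every $u\in C_0^\infty(\mathbb{R}^n)$. If $\alpha_n=0$, then there is no constant $C>0$ such that $( * )$ holds for every $u\in C_0^\infty(\mathbb{R}^n)$.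
   Context: For $x=(x_1,\ldots,x_n)\in\mathbb{R}^n$ and $1\le k\le n$, $\mathbf{X_k}:=(x_1,\ldots,x_k,0,\ldots,0)$, so $|\mathbf{X_k}|=(x_1^2+\ldots+x_k^2)^{1/2}$; in particular $|\mathbf{X_n}|=|x|$. Functions are real valued. When $n=3$ only $\alpha_3$ and $\beta_3$ occur. *)

theory Defs
  imports "HOL-Analysis.Analysis"
begin

text \<open>
  The coordinates of \<open>real ^ 'n\<close> are unordered. An ordering \<open>x\<^sub>1, \<dots>, x\<^sub>n\<close> is given by a
  bijection \<open>e\<close> from \<open>{1..n}\<close> onto the index type, the \<open>k\<close>-th coordinate of \<open>x\<close> being \<open>x $ e k\<close>.
\<close>

definition first_coords :: "(nat \<Rightarrow> 'n) \<Rightarrow> nat \<Rightarrow> real ^ 'n \<Rightarrow> real ^ 'n" where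
  "first_coords e k x = (\<chi> i. if i \<in> e ` {1..k} then x $ i else 0)"

fun Ck_fun :: "nat \<Rightarrow> (real ^ 'n \<Rightarrow> real) \<Rightarrow> bool" where
  "Ck_fun 0 u \<longleftrightarrow> continuous_on UNIV u"
| "Ck_fun (Suc k) u \<longleftrightarrow> u differentiable_on UNIV \<and>
     (\<forall>v. Ck_fun k (\<lambda>x. frechet_derivative u (at x) v))"

definition test_function :: "(real ^ 'n \<Rightarrow> real) \<Rightarrow> bool" where
  "test_function u \<longleftrightarrow> (\<forall>k. Ck_fun k u) \<and> compact (closure {x. u x \<noteq> 0})"

definition grad :: "(real ^ 'n \<Rightarrow> real) \<Rightarrow> real ^ 'n \<Rightarrow> real ^ 'n" where
  "grad u x = (\<chi> i. frechet_derivative u (at x) (axis i 1))"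

text \<open>
  For \<open>k \<ge> 3\<close> the function \<open>1 / |X\<^sub>k|\<^sup>2\<close> is locally integrable, and so is \<open>|x\<^sub>1| powr s\<close> for
  \<open>s > -1\<close>, where \<open>s = (Q - 2) / 2 * n - Q > -1\<close> is equivalent to \<open>Q > 2 * (n - 1) / (n - 2)\<close>
  (for \<open>n \<ge> 3\<close>).
  Hence all three integrals below are finite for test functions and such \<open>Q\<close>. The values of
  the integrands where \<open>X\<^sub>k = 0\<close> or \<open>x\<^sub>1 = 0\<close> (division by zero, \<open>0 powr s = 0\<close>) only concern
  null sets.
\<close>

definition hardy_sobolev_ineq ::
    "(nat \<Rightarrow> 'n::finite) \<Rightarrow> nat \<Rightarrow> (nat \<Rightarrow> real) \<Rightarrow> real \<Rightarrow> real \<Rightarrow> (real ^ 'n \<Rightarrow> real) \<Rightarrow> bool" where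
  "hardy_sobolev_ineq e n \<beta> Q C u \<longleftrightarrow>
     (LINT x|lborel. (norm (grad u x))\<^sup>2)
       \<ge> (LINT x|lborel. (\<Sum>m=3..n. \<beta> m / (norm (first_coords e m x))\<^sup>2) * (u x)\<^sup>2)
         + C * (LINT x|lborel. \<bar>x $ e 1\<bar> powr ((Q - 2) / 2 * real n - Q) * \<bar>u x\<bar> powr Q) powr (2 / Q)"

end

theory Submission
  imports Defs
begin

text \<open>
  Put \<open>A\<^sub>m = -\<alpha>\<^sub>m\<close>, \<open>A\<^sub>2 = 0\<close> and \<open>a\<^sub>m = A\<^sub>m - A\<^sub>m\<^sub>-\<^sub>1 - 1/2\<close>. The function
  \<open>\<phi> = |X\<^sub>3| powr a\<^sub>3 \<cdots> |X\<^sub>n| powr a\<^sub>n\<close> is a ground state: \<open>-\<Delta>\<phi>/\<phi>\<close> is the potential, so with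
  \<open>T = \<nabla>\<phi>/\<phi>\<close> the deficit of the Hardy inequality is the integral of \<open>|\<nabla>u - u T|\<^sup>2\<close>. All computations
  are made with \<open>|X\<^sub>m|\<^sup>2\<close> replaced by \<open>|X\<^sub>m|\<^sup>2 + c\<^sub>m\<close>, which makes \<open>T\<close> smooth, and \<open>c\<^sub>m \<rightarrow> 0\<close> at the end.

  If \<open>A\<^sub>n > 0\<close>, take \<open>p = 2(n-1)/(n-2)\<close> and \<open>f = |u| powr p\<close>. A bounded vector field with
  \<open>div F + p F \<bullet> T \<ge> const / |X\<^sub>3|\<close> shows that the \<open>L\<^sup>1\<close> norm of \<open>\<nabla>f\<close> is controlled by that of
  \<open>\<nabla>f - p f T\<close>, hence, by Cauchy-Schwarz, by the deficit and the critical Lebesgue norm of \<open>u\<close>. The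
  Gagliardo inequality for \<open>f\<close> and its version with the weight \<open>|x\<^sub>1| powr -\<tau>\<close> then give the theorem.

  If \<open>A\<^sub>n = 0\<close>, the function \<open>\<phi>\<^sup>2\<close> is homogeneous of degree \<open>2 - n\<close>, so multiplying \<open>\<phi>\<close> by a
  logarithmic cutoff at scale \<open>exp N\<close> makes the deficit of order \<open>1/N\<close>, while the right-hand side
  stays bounded below.
\<close>

subsection \<open>The Gagliardo inequality with a weight\<close>


text \<open>The sign of \<open>\<alpha> n\<close> enters through partial sums:
  \<open>a_3 + ... + a_m = A_m - (m - 2) / 2\<close>, so the quantity that must be positive at level
  m for the field F to exist is
  \<open>m - 1 + p (a_3 + ... + a_m) = (n - m) / (n - 2) + p A_m\<close>. For m < n it is positive
  for every \<open>A_m >= 0\<close>; for m = n it is \<open>p A_n\<close>. The obstacle is that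
  \<open>\<phi>\<^sup>2\<close> is a weight degenerating along the nested subspaces X_m = 0. At the
  level of L1 the term f T has size f / |X_3|, which a divergence absorbs, and then the Gagliardo
  inequality for Lebesgue measure applies. The range of Q is that of the weighted Gagliardo
  inequality with exponent Q / p: the lower bound says Q / p > 1, that is, the weight |x_1|^s is
  locally integrable, and the upper bound says s <= 0. The constants must not depend on the
  regularization, since the scales tend to 0 in the final inequality. In the critical case the
  cutoff gradient contributes N^(-2), while about N dyadic shells contribute equally to the
  integral, hence the order 1/N.\<close>

lemma powr_interpolation_le_add:
  fixes a b \<theta> :: real
  assumes "0 \<le> a" "0 \<le> b" "0 \<le> \<theta>" "\<theta> \<le> 1"
  shows "a powr \<theta> * b powr (1 - \<theta>) \<le> a + b"
proof (cases "a = 0 \<or> b = 0")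
  case False
  then have "a powr \<theta> * b powr (1 - \<theta>) \<le> \<theta> * a + (1 - \<theta>) * b"
    using assms by (intro Youngs_inequality_0) auto
  also have "\<dots> \<le> 1 * a + 1 * b"
    using assms by (intro add_mono mult_right_mono) auto
  finally show ?thesis by simp
qed (use assms in auto)

text \<open>Young's inequality for f / a and g / b bounds the product pointwise by a linear
  combination of f and g whose integral is the claimed value. Normalizing requires a, b > 0; if one
  of them is 0, the corresponding function vanishes almost everywhere. Real majorants a and b stand
  in place of norms so that estimates can be inserted directly.\<close>

lemma nn_integral_Holder:
  fixes f g :: "'a \<Rightarrow> real"
  assumes [measurable]: "f \<in> borel_measurable M" "g \<in> borel_measurable M"
    and f0: "\<And>x. 0 \<le> f x" and g0: "\<And>x. 0 \<le> g x"
    and \<theta>: "0 < \<theta>" "\<theta> < 1"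
    and a: "(\<integral>\<^sup>+x. f x \<partial>M) \<le> ennreal a" "0 \<le> a"
    and b: "(\<integral>\<^sup>+x. g x \<partial>M) \<le> ennreal b" "0 \<le> b"
  shows "(\<integral>\<^sup>+x. ennreal (f x powr \<theta> * g x powr (1 - \<theta>)) \<partial>M) \<le> ennreal (a powr \<theta> * b powr (1 - \<theta>))"
proof -
  consider "a = 0" | "b = 0" | "a > 0" "b > 0" using a b by linarith
  then show ?thesis
  proof cases
    case 1
    then have "AE x in M. ennreal (f x) = 0"
      using a by (subst nn_integral_0_iff_AE[symmetric]) auto
    then have "AE x in M. ennreal (f x powr \<theta> * g x powr (1 - \<theta>)) = 0"
    proof eventually_elim
      case (elim x)
      then have "f x = 0" using f0[of x] by (simp add: ennreal_eq_0_iff)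
      then show ?case by simp
    qed
    then have "(\<integral>\<^sup>+x. ennreal (f x powr \<theta> * g x powr (1 - \<theta>)) \<partial>M) = 0"
      by (subst nn_integral_0_iff_AE) auto
    then show ?thesis by simp
  next
    case 2
    then have "AE x in M. ennreal (g x) = 0"
      using b by (subst nn_integral_0_iff_AE[symmetric]) auto
    then have "AE x in M. ennreal (f x powr \<theta> * g x powr (1 - \<theta>)) = 0"
    proof eventually_elim
      case (elim x)
      then have "g x = 0" using g0[of x] by (simp add: ennreal_eq_0_iff)
      then show ?case by simp
    qed
    then have "(\<integral>\<^sup>+x. ennreal (f x powr \<theta> * g x powr (1 - \<theta>)) \<partial>M) = 0"
      by (subst nn_integral_0_iff_AE) auto
    then show ?thesis by simp
  next
    case 3
    define c where "c = a powr \<theta> * b powr (1 - \<theta>)"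
    have c: "c > 0" using 3 by (simp add: c_def)
    have pt: "f x powr \<theta> * g x powr (1 - \<theta>) \<le> (c * \<theta> / a) * f x + (c * (1 - \<theta>) / b) * g x" for x
    proof (cases "f x = 0 \<or> g x = 0")
      case True
      then show ?thesis using c 3 \<theta> f0[of x] g0[of x] by auto
    next
      case False
      then have fg: "f x > 0" "g x > 0" using f0[of x] g0[of x] by linarith+
      have "(f x / a) powr \<theta> * (g x / b) powr (1 - \<theta>) \<le> \<theta> * (f x / a) + (1 - \<theta>) * (g x / b)"
        using fg 3 \<theta> by (intro Youngs_inequality_0) auto
      then have "c * ((f x / a) powr \<theta> * (g x / b) powr (1 - \<theta>)) \<le> c * (\<theta> * (f x / a) + (1 - \<theta>) * (g x / b))"
        using c by (intro mult_left_mono) auto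
      moreover have "c * ((f x / a) powr \<theta> * (g x / b) powr (1 - \<theta>)) = f x powr \<theta> * g x powr (1 - \<theta>)"
        using fg 3 by (simp add: c_def powr_divide)
      ultimately show ?thesis by (simp add: algebra_simps)
    qed
    have k: "0 \<le> c * \<theta> / a" "0 \<le> c * (1 - \<theta>) / b" using c 3 \<theta> by auto
    have "(\<integral>\<^sup>+x. ennreal (f x powr \<theta> * g x powr (1 - \<theta>)) \<partial>M)
        \<le> (\<integral>\<^sup>+x. ennreal (c * \<theta> / a) * ennreal (f x) + ennreal (c * (1 - \<theta>) / b) * ennreal (g x) \<partial>M)"
    proof (intro nn_integral_mono)
      fix x
      show "ennreal (f x powr \<theta> * g x powr (1 - \<theta>))
          \<le> ennreal (c * \<theta> / a) * ennreal (f x) + ennreal (c * (1 - \<theta>) / b) * ennreal (g x)"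
        using ennreal_leI[OF pt[of x]] k f0[of x] g0[of x]
        by (simp only: ennreal_mult ennreal_plus mult_nonneg_nonneg)
    qed
    also have "\<dots> = ennreal (c * \<theta> / a) * (\<integral>\<^sup>+x. f x \<partial>M) + ennreal (c * (1 - \<theta>) / b) * (\<integral>\<^sup>+x. g x \<partial>M)"
      by (simp add: nn_integral_add nn_integral_cmult)
    also have "\<dots> \<le> ennreal (c * \<theta> / a) * ennreal a + ennreal (c * (1 - \<theta>) / b) * ennreal b"
      using a b by (intro add_mono mult_left_mono) auto
    also have "\<dots> = ennreal ((c * \<theta> / a) * a + (c * (1 - \<theta>) / b) * b)"
      using k 3 by (simp only: ennreal_mult ennreal_plus mult_nonneg_nonneg less_imp_le)
    also have "(c * \<theta> / a) * a + (c * (1 - \<theta>) / b) * b = c"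
      using 3 by (simp add: field_simps)
    finally show ?thesis by (simp add: c_def)
  qed
qed

text \<open>
  Induction on the dimension: on the slice where coordinate \<open>b\<close> equals \<open>t\<close>, \<open>f\<close> is interpolated between
  \<open>L\<^sup>1\<close>, bounded uniformly in \<open>t\<close> by the line estimate, and the exponent of the induction hypothesis.
  In dimension one the exponent \<open>1 + 1 / 0\<close> stands for \<open>L\<^sup>\<infinity>\<close>.
\<close>
lemma gagliardo_PiM:
  fixes f G :: "('i \<Rightarrow> real) \<Rightarrow> real"
  assumes "finite I" "card I = Suc k"
    and "f \<in> borel_measurable (Pi\<^sub>M I (\<lambda>_. lborel))" "G \<in> borel_measurable (Pi\<^sub>M I (\<lambda>_. lborel))"
    and "\<And>x. 0 \<le> f x" "\<And>x. 0 \<le> G x"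
    and "\<And>b x. b \<in> I \<Longrightarrow> x \<in> space (Pi\<^sub>M I (\<lambda>_. lborel)) \<Longrightarrow> ennreal (f x) \<le> (\<integral>\<^sup>+t. G (x(b := t)) \<partial>lborel)"
    and "(\<integral>\<^sup>+x. G x \<partial>Pi\<^sub>M I (\<lambda>_. lborel)) \<le> ennreal a" "a > 0"
  shows "if k = 0 then \<forall>x\<in>space (Pi\<^sub>M I (\<lambda>_. lborel)). ennreal (f x) \<le> ennreal a
    else (\<integral>\<^sup>+x. ennreal (f x powr (1 + 1 / real k)) \<partial>Pi\<^sub>M I (\<lambda>_. lborel)) \<le> ennreal (a powr (1 + 1 / real k))"
  using assms
proof (induction I arbitrary: k f G a rule: finite_induct)
  case empty
  then show ?case by simp
next
  case (insert b I)
  interpret P: product_sigma_finite "\<lambda>_::'i. lborel :: real measure" by standard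
  let ?P = "\<lambda>I. Pi\<^sub>M I (\<lambda>_. lborel :: real measure)"
  note [measurable] = insert.prems(2,3)
  have cI: "card I = k" using insert by simp
  note f0 = insert.prems(4) and G0 = insert.prems(5)
  have line: "ennreal (f x) \<le> (\<integral>\<^sup>+t. G (x(c := t)) \<partial>lborel)"
    if "c \<in> insert b I" "x \<in> space (?P (insert b I))" for c x
    using insert.prems(6)[OF that] by (simp add: fun_upd_def)
  show ?case
  proof (cases "k = 0")
    case True
    then have I: "I = {}" using cI insert by simp
    have "ennreal (f x) \<le> ennreal a" if x: "x \<in> space (?P (insert b I))" for x
    proof -
      have "ennreal (f x) \<le> (\<integral>\<^sup>+t. G (x(b := t)) \<partial>lborel)" using line[of b x] x by simp
      also have "\<dots> = (\<integral>\<^sup>+t. G ((\<lambda>_. undefined)(b := t)) \<partial>lborel)"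
        using x I by (intro nn_integral_cong arg_cong[where f=ennreal] arg_cong[where f=G])
          (auto simp: fun_eq_iff space_PiM PiE_def extensional_def)
      also have "\<dots> = (\<integral>\<^sup>+t. (\<integral>\<^sup>+x. ennreal (G (x(b := t))) \<partial>?P I) \<partial>lborel)"
        unfolding I by (intro nn_integral_cong) (simp add: PiM_empty nn_integral_count_space_finite fun_upd_def)
      also have "\<dots> = (\<integral>\<^sup>+x. G x \<partial>?P (insert b I))"
        using insert by (subst P.product_nn_integral_insert_rev) auto
      finally show ?thesis using insert.prems(7) by order
    qed
    then show ?thesis using True by simp
  next
    case False
    then obtain j where k: "k = Suc j" by (cases k) auto
    have upd: "(\<lambda>x. x(b := t)) \<in> measurable (?P I) (?P (insert b I))" for t
      by measurable
    have [measurable]: "(\<lambda>x. f (x(b := t))) \<in> borel_measurable (?P I)"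
        "(\<lambda>x. G (x(b := t))) \<in> borel_measurable (?P I)" for t
      using measurable_compose[OF upd insert.prems(2)] measurable_compose[OF upd insert.prems(3)] by auto
    define B where "B t = (\<integral>\<^sup>+x. ennreal (G (x(b := t))) \<partial>?P I)" for t
    have updin: "x(b := t) \<in> space (?P (insert b I))" if "x \<in> space (?P I)" for x t
      using measurable_space[OF upd that] .
    have FG: "(\<integral>\<^sup>+x. ennreal (f (x(b := t))) \<partial>?P I) \<le> ennreal a" for t
    proof -
      have "(\<integral>\<^sup>+x. ennreal (f (x(b := t))) \<partial>?P I) \<le> (\<integral>\<^sup>+x. (\<integral>\<^sup>+s. G (x(b := s)) \<partial>lborel) \<partial>?P I)"
      proof (intro nn_integral_mono)
        fix x assume "x \<in> space (?P I)"
        from line[OF _ updin[OF this], of b t] show "ennreal (f (x(b := t))) \<le> (\<integral>\<^sup>+s. G (x(b := s)) \<partial>lborel)"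
          by (simp add: fun_upd_def if_distrib cong: if_cong)
      qed
      also have "\<dots> = (\<integral>\<^sup>+x. G x \<partial>?P (insert b I))"
        using insert by (subst P.product_nn_integral_insert) auto
      finally show ?thesis using insert.prems(7) by order
    qed
    have slice: "(\<integral>\<^sup>+x. ennreal (f (x(b := t)) powr (1 + 1 / real k)) \<partial>?P I) \<le> B t * ennreal (a powr (1 / real k))" for t
    proof (cases "B t")
      case top
      then show ?thesis using insert.prems(8) by (simp add: ennreal_top_mult ennreal_eq_0_iff)
    next
      case (real \<beta>)
      \<comment> \<open>The induction hypothesis asks for a positive mass, whereas
        \<open>\<beta>\<close> may be 0. It is used for every \<open>\<gamma> > \<beta>\<close>, and
        \<open>\<gamma>\<close> tends to \<open>\<beta>\<close> afterwards.\<close>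
      have IH: "if j = 0 then \<forall>x\<in>space (?P I). ennreal (f (x(b := t))) \<le> ennreal \<gamma>
        else (\<integral>\<^sup>+x. ennreal (f (x(b := t)) powr (1 + 1 / real j)) \<partial>?P I) \<le> ennreal (\<gamma> powr (1 + 1 / real j))"
        if \<gamma>: "\<gamma> > \<beta>" for \<gamma>
      proof (rule insert.IH[of j "\<lambda>x. f (x(b := t))" "\<lambda>x. G (x(b := t))" \<gamma>])
        show "card I = Suc j" using cI k by simp
        show "(\<integral>\<^sup>+x. ennreal (G (x(b := t))) \<partial>?P I) \<le> ennreal \<gamma>"
          using real \<gamma> by (simp add: B_def[symmetric] ennreal_leI)
        show "\<gamma> > 0" using real \<gamma> by simp
        fix c x assume c: "c \<in> I" and x: "x \<in> space (?P I)"
        have "c \<noteq> b" using c insert by auto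
        then show "ennreal (f (x(b := t))) \<le> (\<integral>\<^sup>+s. G (x(c := s, b := t)) \<partial>lborel)"
          using line[OF _ updin[OF x], of c t] c by (simp only: fun_upd_twist insert_iff simp_thms)
      qed (use f0 G0 in auto)
      have "(\<integral>\<^sup>+x. ennreal (f (x(b := t)) powr (1 + 1 / real k)) \<partial>?P I) \<le> ennreal (\<gamma> * a powr (1 / real k))"
        if \<gamma>: "\<gamma> > \<beta>" for \<gamma>
      proof (cases "j = 0")
        case True
        have "\<gamma> > 0" using real \<gamma> by simp
        have "(\<integral>\<^sup>+x. ennreal (f (x(b := t)) powr (1 + 1 / real k)) \<partial>?P I)
          \<le> (\<integral>\<^sup>+x. ennreal \<gamma> * ennreal (f (x(b := t))) \<partial>?P I)"
        proof (intro nn_integral_mono)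
          fix x assume "x \<in> space (?P I)"
          then have "f (x(b := t)) \<le> \<gamma>" using IH[OF \<gamma>] True \<open>\<gamma> > 0\<close> by auto
          then have "f (x(b := t)) * f (x(b := t)) \<le> \<gamma> * f (x(b := t))"
            using f0 by (intro mult_right_mono) auto
          then show "ennreal (f (x(b := t)) powr (1 + 1 / real k)) \<le> ennreal \<gamma> * ennreal (f (x(b := t)))"
            using True f0 \<open>\<gamma> > 0\<close> k by (simp add: ennreal_mult[symmetric] power2_eq_square ennreal_leI)
        qed
        also have "\<dots> \<le> ennreal \<gamma> * ennreal a"
          using FG[of t] by (subst nn_integral_cmult) (auto intro!: mult_left_mono)
        also have "\<dots> = ennreal (\<gamma> * a powr (1 / real k))"
          using True k insert.prems(8) \<open>\<gamma> > 0\<close> by (simp add: ennreal_mult[symmetric])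
        finally show ?thesis .
      next
        case False
        \<comment> \<open>With this choice 1 + 1/k = (1 + 1/j) \<theta> + (1 - \<theta>), which
          interpolates between the exponent 1 + 1/j of the slice and L1.\<close>
        define \<theta> where "\<theta> = real j / real k"
        have \<theta>: "0 < \<theta>" "\<theta> < 1" using False k by (auto simp: \<theta>_def)
        have e1: "(1 + 1 / real j) * \<theta> = 1" "1 - \<theta> = 1 / real k"
          using False k by (auto simp: \<theta>_def divide_simps add_pos_nonneg)
        have e2: "(f y powr (1 + 1 / real j)) powr \<theta> = f y" for y
          unfolding powr_powr e1(1) using f0[of y] by simp
        have "\<gamma> > 0" using real \<gamma> by simp
        have "(\<integral>\<^sup>+x. ennreal (f (x(b := t)) powr (1 + 1 / real k)) \<partial>?P I)
          = (\<integral>\<^sup>+x. ennreal ((f (x(b := t)) powr (1 + 1 / real j)) powr \<theta> * f (x(b := t)) powr (1 - \<theta>)) \<partial>?P I)"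
          unfolding e2 by (intro nn_integral_cong) (simp add: powr_add e1 f0)
        also have "\<dots> \<le> ennreal ((\<gamma> powr (1 + 1 / real j)) powr \<theta> * a powr (1 - \<theta>))"
          using IH[OF \<gamma>] False f0 FG[of t] insert.prems(8) \<theta>
          by (intro nn_integral_Holder) auto
        also have "\<dots> = ennreal (\<gamma> * a powr (1 / real k))"
          using \<open>\<gamma> > 0\<close> by (simp add: powr_powr e1)
        finally show ?thesis .
      qed
      then have *: "(\<integral>\<^sup>+x. ennreal (f (x(b := t)) powr (1 + 1 / real k)) \<partial>?P I) \<le> ennreal ((\<beta> + e) * a powr (1 / real k))"
        if "e > 0" for e using that by simp
      have "((\<lambda>e. ennreal ((\<beta> + e) * a powr (1 / real k))) \<longlongrightarrow> ennreal ((\<beta> + 0) * a powr (1 / real k))) (at_right 0)"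
        by (intro tendsto_intros)
      then have "(\<integral>\<^sup>+x. ennreal (f (x(b := t)) powr (1 + 1 / real k)) \<partial>?P I) \<le> ennreal ((\<beta> + 0) * a powr (1 / real k))"
        by (rule tendsto_lowerbound) (auto simp: eventually_at_right_field intro!: exI[of _ 1] *)
      then show ?thesis using real by (simp add: ennreal_mult)
    qed
    have "(\<integral>\<^sup>+x. ennreal (f x powr (1 + 1 / real k)) \<partial>?P (insert b I))
      = (\<integral>\<^sup>+t. (\<integral>\<^sup>+x. ennreal (f (x(b := t)) powr (1 + 1 / real k)) \<partial>?P I) \<partial>lborel)"
      using insert by (subst P.product_nn_integral_insert_rev) auto
    also have "\<dots> \<le> (\<integral>\<^sup>+t. B t * ennreal (a powr (1 / real k)) \<partial>lborel)"
      by (intro nn_integral_mono slice)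
    also have "\<dots> = (\<integral>\<^sup>+t. B t \<partial>lborel) * ennreal (a powr (1 / real k))"
    proof (rule nn_integral_multc)
      interpret sigma_finite_measure "?P I" using P.sigma_finite insert by auto
      show "B \<in> borel_measurable lborel" unfolding B_def by measurable
    qed
    also have "(\<integral>\<^sup>+t. B t \<partial>lborel) = (\<integral>\<^sup>+x. G x \<partial>?P (insert b I))"
      unfolding B_def using insert by (subst P.product_nn_integral_insert_rev) auto
    also have "\<dots> * ennreal (a powr (1 / real k)) \<le> ennreal a * ennreal (a powr (1 / real k))"
      using insert.prems(7) by (intro mult_right_mono) auto
    also have "\<dots> = ennreal (a powr (1 + 1 / real k))"
      using insert.prems(8) by (simp add: ennreal_mult[symmetric] powr_add)
    finally show ?thesis using False by simp
  qed
qed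


section \<open>Lebesgue measure on \<open>real ^ 'n\<close> as a product measure\<close>

lemma measurable_vec_lambda_PiM:
  "(\<lambda>y. (\<chi> i. y i) :: real ^ 'n) \<in> borel_measurable (Pi\<^sub>M UNIV (\<lambda>_. lborel))"
  by (subst borel_measurable_euclidean_space) (auto simp: Basis_vec_def inner_axis)

text \<open>Both measures give each box the product of its side lengths. The inductions over
  coordinates live in the product measure, whose index set can shrink by one element at a
  time.\<close>

lemma lborel_vec_eq_distr:
  "(lborel :: (real ^ 'n) measure) = distr (Pi\<^sub>M UNIV (\<lambda>_. lborel)) borel (\<lambda>y. \<chi> i. y i)"
proof (rule lborel_eqI)
  interpret P: product_sigma_finite "\<lambda>_::'n. lborel :: real measure" by standard
  note [measurable] = measurable_vec_lambda_PiM
  fix l u :: "real ^ 'n" assume le: "\<And>b. b \<in> Basis \<Longrightarrow> l \<bullet> b \<le> u \<bullet> b"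
  have Basis: "Basis = range (\<lambda>i::'n. axis i (1::real))" by (auto simp: Basis_vec_def)
  have le': "l $ i \<le> u $ i" for i using le[of "axis i 1"] by (simp add: Basis inner_axis)
  have "(\<lambda>y. (\<chi> i. y i) :: real ^ 'n) -` box l u \<inter> space (Pi\<^sub>M UNIV (\<lambda>_. lborel))
      = (\<Pi>\<^sub>E i\<in>UNIV. {l $ i <..< u $ i})"
    by (auto simp: mem_box_cart space_PiM PiE_UNIV_domain Pi_iff)
  then have "emeasure (distr (Pi\<^sub>M UNIV (\<lambda>_. lborel)) borel (\<lambda>y. \<chi> i. y i)) (box l u)
      = (\<Prod>i\<in>UNIV. emeasure lborel {l $ i <..< u $ i})"
    by (simp add: emeasure_distr P.emeasure_PiM)
  also have "\<dots> = (\<Prod>i\<in>UNIV. ennreal (u $ i - l $ i))"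
    using le' by (intro prod.cong) auto
  also have "\<dots> = ennreal (\<Prod>i\<in>UNIV. u $ i - l $ i)"
    using le' by (intro prod_ennreal) auto
  also have "(\<Prod>i\<in>UNIV. u $ i - l $ i) = (\<Prod>b\<in>Basis. (u - l) \<bullet> b)"
    unfolding Basis by (subst prod.reindex) (auto simp: inj_on_def axis_eq_axis inner_axis inner_diff_left)
  finally show "emeasure (distr (Pi\<^sub>M UNIV (\<lambda>_. lborel)) borel (\<lambda>y. \<chi> i. y i)) (box l u)
      = (\<Prod>b\<in>Basis. (u - l) \<bullet> b)" .
qed simp

lemma nn_integral_lborel_vec:
  fixes f :: "real ^ 'n \<Rightarrow> ennreal"
  assumes "f \<in> borel_measurable borel"
  shows "(\<integral>\<^sup>+x. f x \<partial>lborel) = (\<integral>\<^sup>+y. f (\<chi> i. y i) \<partial>Pi\<^sub>M UNIV (\<lambda>_. lborel))"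
  by (subst lborel_vec_eq_distr) (rule nn_integral_distr[OF measurable_vec_lambda_PiM], use assms in simp)

text \<open>The hypothesis \<open>line\<close> carries all the information about f and G. It holds
  when G is the norm of the gradient of f, and the conclusion is then the Sobolev inequality for the
  L1 norm of the gradient, with constant 1.\<close>

lemma gagliardo:
  fixes f G :: "real ^ 'n \<Rightarrow> real"
  assumes card: "CARD('n) = Suc k" "k \<ge> 1"
    and m: "f \<in> borel_measurable borel" "G \<in> borel_measurable borel"
    and nn: "\<And>x. 0 \<le> f x" "\<And>x. 0 \<le> G x"
    and line: "\<And>i x. ennreal (f x) \<le> (\<integral>\<^sup>+t. G (\<chi> j. if j = i then t else x $ j) \<partial>lborel)"
    and a: "(\<integral>\<^sup>+x. G x \<partial>lborel) \<le> ennreal a" "a > 0"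
  shows "(\<integral>\<^sup>+x. ennreal (f x powr (1 + 1 / real k)) \<partial>lborel) \<le> ennreal (a powr (1 + 1 / real k))"
proof -
  have *: "(\<lambda>y. f (\<chi> i. y i)) \<in> borel_measurable (Pi\<^sub>M UNIV (\<lambda>_. lborel))"
    "(\<lambda>y. G (\<chi> i. y i)) \<in> borel_measurable (Pi\<^sub>M UNIV (\<lambda>_. lborel))"
    using measurable_compose[OF measurable_vec_lambda_PiM m(1)] measurable_compose[OF measurable_vec_lambda_PiM m(2)]
    by auto
  have "if k = 0 then \<forall>x\<in>space (Pi\<^sub>M (UNIV::'n set) (\<lambda>_. lborel)). ennreal (f (\<chi> i. x i)) \<le> ennreal a
    else (\<integral>\<^sup>+x. ennreal (f (\<chi> i. x i) powr (1 + 1 / real k)) \<partial>Pi\<^sub>M UNIV (\<lambda>_. lborel)) \<le> ennreal (a powr (1 + 1 / real k))"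
  proof (rule gagliardo_PiM[where G = "\<lambda>y. G (\<chi> i. y i)"])
    show "ennreal (f (vec_lambda x)) \<le> \<integral>\<^sup>+ t. ennreal (G (vec_lambda (x(b := t)))) \<partial>lborel" for b and x :: "'n \<Rightarrow> real"
      using line[of "\<chi> i. x i" b] by (simp add: fun_upd_def cong: if_cong)
    show "(\<integral>\<^sup>+ x. ennreal (G (vec_lambda x)) \<partial>Pi\<^sub>M UNIV (\<lambda>_. lborel)) \<le> ennreal a"
      using a m by (subst nn_integral_lborel_vec[symmetric]) auto
  qed (use card nn a * in auto)
  then show ?thesis using card m by (subst nn_integral_lborel_vec) auto
qed

section \<open>The weight in a single coordinate\<close>

lemma nn_integral_even:
  fixes k :: "real \<Rightarrow> real"
  assumes [measurable]: "k \<in> borel_measurable borel" and k: "\<And>t. 0 \<le> k t"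
    and I: "(k has_integral I) S" and S: "\<And>t. t \<in> S \<Longrightarrow> 0 \<le> t" and [measurable]: "S \<in> sets borel"
  shows "(\<integral>\<^sup>+t. ennreal (k \<bar>t\<bar>) * indicator S \<bar>t\<bar> \<partial>lborel) \<le> ennreal (2 * I)"
proof -
  have I0: "0 \<le> I" using has_integral_nonneg[OF I] k by auto
  have 1: "(\<integral>\<^sup>+t. ennreal (k t) * indicator S t \<partial>lborel) = ennreal I"
    by (rule nn_integral_has_integral_lebesgue'[OF k I])
  have 2: "(\<integral>\<^sup>+t. ennreal (k (-t)) * indicator S (-t) \<partial>lborel) = ennreal I"
    unfolding 1[symmetric]
    by (subst nn_integral_real_affine[where c="-1" and t=0 and f="\<lambda>t. ennreal (k t) * indicator S t"]) auto
  have "(\<integral>\<^sup>+t. ennreal (k \<bar>t\<bar>) * indicator S \<bar>t\<bar> \<partial>lborel)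
      \<le> (\<integral>\<^sup>+t. ennreal (k t) * indicator S t + ennreal (k (-t)) * indicator S (-t) \<partial>lborel)"
    by (intro nn_integral_mono) (auto simp: abs_if)
  also have "\<dots> = ennreal I + ennreal I"
    by (subst nn_integral_add) (auto simp: 1 2)
  finally show ?thesis using I0 by (simp add: ennreal_plus[symmetric] del: ennreal_plus)
qed

text \<open>
  For \<open>|t| \<le> T\<close> one uses \<open>h \<le> g\<close>, for \<open>|t| \<ge> T\<close> Young's inequality with \<open>|t| powr -N\<close>; the two parts
  balance at \<open>T = H / g powr (N / (N - 1))\<close>. A pointwise bound by \<open>g\<close> is essential: interpolating only
  integral norms on hyperplanes loses a logarithm.
\<close>
lemma weighted_line_bound:
  fixes h :: "real \<Rightarrow> real" and N q \<tau> g H :: real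
  assumes N: "2 \<le> N" and q: "1 < q" "q \<le> N / (N - 1)" and \<tau>: "\<tau> = N - (N - 1) * q"
    and [measurable]: "h \<in> borel_measurable borel"
    and h0: "\<And>t. 0 \<le> h t" and hg: "\<And>t. h t \<le> g" and g: "0 < g"
    and H: "(\<integral>\<^sup>+t. h t powr (N / (N - 1)) \<partial>lborel) \<le> ennreal H" "0 < H"
  shows "(\<integral>\<^sup>+t. ennreal (\<bar>t\<bar> powr (- \<tau>) * h t powr q) \<partial>lborel)
    \<le> ennreal ((2 / (1 - \<tau>) + 3) * (H powr (1 - \<tau>) * g powr \<tau>))"
proof -
  define r where "r = N / (N - 1)"
  define T where "T = H / g powr r"
  have T: "T > 0" using H g by (simp add: T_def)
  have \<tau>': "1 - \<tau> = (N - 1) * (q - 1)" by (simp add: \<tau> algebra_simps)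
  have "0 < (N - 1) * (q - 1)" using N q by (intro mult_pos_pos) auto
  then have \<tau>1: "\<tau> < 1" using \<tau>' by linarith
  have \<tau>0: "0 \<le> \<tau>" using N q by (simp add: \<tau> field_simps)
  have r: "r > 0" using N by (simp add: r_def)
  have e: "1 - \<tau> / N = q / r" using N by (simp add: \<tau> r_def field_simps)
  have hr: "h t powr r = g powr r * (h t / g) powr r" for t
    using g h0[of t] by (simp add: powr_divide)
  have pt: "\<bar>t\<bar> powr (- \<tau>) * h t powr q \<le>
      g powr q * (\<bar>t\<bar> powr (-\<tau>) * indicator {0..T} \<bar>t\<bar>)
      + (g powr q * T powr (N - \<tau>)) * (\<bar>t\<bar> powr (- N) * indicator {T..} \<bar>t\<bar>)
      + (g powr q * T powr (-\<tau>) / g powr r) * h t powr r" for t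
  proof (cases "\<bar>t\<bar> \<le> T")
    case True
    have "h t powr q \<le> g powr q" using hg h0 q by (intro powr_mono2) auto
    then have "\<bar>t\<bar> powr (- \<tau>) * h t powr q \<le> \<bar>t\<bar> powr (- \<tau>) * g powr q" by (intro mult_left_mono) auto
    then show ?thesis using True T by (auto simp: mult.commute intro!: add_increasing2)
  next
    case False
    then have t: "\<bar>t\<bar> > T" by simp
    \<comment> \<open>The exponents \<tau>/N and 1 - \<tau>/N = q/r reproduce the integrand: X to
      the first is (|t|/T)^(-\<tau>), Y to the second is (h/g)^q. Separately, X is integrable for
      |t| >= T and Y is controlled by H.\<close>
    define X where "X = (\<bar>t\<bar> / T) powr (- N)"
    define Y where "Y = (h t / g) powr r"
    have XY: "X powr (\<tau> / N) * Y powr (1 - \<tau> / N) \<le> X + Y"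
      using N \<tau>0 \<tau>1 by (intro powr_interpolation_le_add) (auto simp: X_def Y_def)
    have "X powr (\<tau> / N) = (\<bar>t\<bar> / T) powr (-\<tau>)" using N by (simp add: X_def powr_powr)
    moreover have "Y powr (1 - \<tau> / N) = (h t / g) powr q" using r by (simp add: Y_def powr_powr e)
    ultimately have "(\<bar>t\<bar> / T) powr (-\<tau>) * (h t / g) powr q \<le> X + Y" using XY by simp
    then have "(g powr q * T powr (-\<tau>)) * ((\<bar>t\<bar> / T) powr (-\<tau>) * (h t / g) powr q) \<le> (g powr q * T powr (-\<tau>)) * (X + Y)"
      by (intro mult_left_mono) auto
    also have "\<dots> = (g powr q * T powr (-\<tau>)) * X + (g powr q * T powr (-\<tau>)) * Y" by (rule distrib_left)
    finally have "(g powr q * T powr (-\<tau>)) * ((\<bar>t\<bar> / T) powr (-\<tau>) * (h t / g) powr q)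
        \<le> (g powr q * T powr (-\<tau>)) * X + (g powr q * T powr (-\<tau>)) * Y" .
    moreover have "(g powr q * T powr (-\<tau>)) * ((\<bar>t\<bar> / T) powr (-\<tau>) * (h t / g) powr q) = \<bar>t\<bar> powr (-\<tau>) * h t powr q"
      using g T h0[of t] by (simp add: powr_divide)
    moreover have "(g powr q * T powr (-\<tau>)) * X = (g powr q * T powr (N - \<tau>)) * \<bar>t\<bar> powr (- N)"
      using T by (simp add: X_def powr_divide powr_minus powr_diff field_simps)
    moreover have "(g powr q * T powr (-\<tau>)) * Y = (g powr q * T powr (-\<tau>) / g powr r) * h t powr r"
      using g by (simp add: Y_def hr)
    ultimately show ?thesis using t T by simp
  qed
  have eN: "- y / (- N + 1) = y / (N - 1)" for y
    using minus_divide_divide[of y "N - 1"] by simp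
  let ?c1 = "g powr q" and ?c2 = "g powr q * T powr (N - \<tau>)" and ?c3 = "g powr q * T powr (-\<tau>) / g powr r"
  have "(\<integral>\<^sup>+t. ennreal (\<bar>t\<bar> powr (- \<tau>) * h t powr q) \<partial>lborel)
    \<le> (\<integral>\<^sup>+t. ennreal ?c1 * (ennreal (\<bar>t\<bar> powr (-\<tau>)) * indicator {0..T} \<bar>t\<bar>)
      + ennreal ?c2 * (ennreal (\<bar>t\<bar> powr (- N)) * indicator {T..} \<bar>t\<bar>)
      + ennreal ?c3 * ennreal (h t powr r) \<partial>lborel)"
  proof (intro nn_integral_mono)
    fix t
    show "ennreal (\<bar>t\<bar> powr (- \<tau>) * h t powr q) \<le> ennreal ?c1 * (ennreal (\<bar>t\<bar> powr (-\<tau>)) * indicator {0..T} \<bar>t\<bar>)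
      + ennreal ?c2 * (ennreal (\<bar>t\<bar> powr (- N)) * indicator {T..} \<bar>t\<bar>)
      + ennreal ?c3 * ennreal (h t powr r)"
    proof -
      have ind: "(indicator S x :: ennreal) = ennreal (indicator S x)" for S and x :: real
        by (simp add: indicator_def)
      show ?thesis unfolding ind
        using ennreal_leI[OF pt[of t]]
        by (simp only: ennreal_mult ennreal_plus mult_nonneg_nonneg powr_ge_zero divide_nonneg_nonneg indicator_pos_le add_nonneg_nonneg)
    qed
  qed
  also have "\<dots> = ennreal ?c1 * (\<integral>\<^sup>+t. ennreal (\<bar>t\<bar> powr (-\<tau>)) * indicator {0..T} \<bar>t\<bar> \<partial>lborel)
      + ennreal ?c2 * (\<integral>\<^sup>+t. ennreal (\<bar>t\<bar> powr (- N)) * indicator {T..} \<bar>t\<bar> \<partial>lborel)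
      + ennreal ?c3 * (\<integral>\<^sup>+t. h t powr r \<partial>lborel)"
    by (simp add: nn_integral_add nn_integral_cmult)
  also have "\<dots> \<le> ennreal ?c1 * ennreal (2 * (T powr (-\<tau> + 1) / (-\<tau> + 1)))
      + ennreal ?c2 * ennreal (2 * (-(T powr (-N + 1)) / (-N + 1)))
      + ennreal ?c3 * ennreal H"
    using T \<tau>1 N H
    by (intro add_mono mult_left_mono nn_integral_even[where k="\<lambda>t. t powr (-\<tau>)"]
        nn_integral_even[where k="\<lambda>t. t powr (-N)"]
        has_integral_powr_from_0 has_integral_powr_to_inf) (auto simp: r_def)
  also have "\<dots> = ennreal (?c1 * (2 * (T powr (-\<tau> + 1) / (-\<tau> + 1)))
      + ?c2 * (2 * (-(T powr (-N + 1)) / (-N + 1))) + ?c3 * H)"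
  proof -
    have "0 \<le> 2 * (T powr (-\<tau> + 1) / (-\<tau> + 1))" using \<tau>1 by simp
    moreover have "0 \<le> 2 * (-(T powr (-N + 1)) / (-N + 1))" unfolding eN using N by simp
    ultimately show ?thesis using H
      by (simp only: ennreal_mult ennreal_plus mult_nonneg_nonneg powr_ge_zero divide_nonneg_nonneg add_nonneg_nonneg less_imp_le)
  qed
  also have "\<dots> \<le> ennreal ((2 / (1 - \<tau>) + 3) * (H powr (1 - \<tau>) * g powr \<tau>))"
  proof (rule ennreal_leI)
    \<comment> \<open>The choice of T makes each of the three contributions a multiple of g^q T^(1 -
      \<tau>), and this quantity is H^(1 - \<tau>) g^\<tau>.\<close>
    have k: "H powr (1 - \<tau>) * g powr \<tau> = g powr q * T powr (1 - \<tau>)"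
    proof -
      have "q - r * (1 - \<tau>) = \<tau>" using N by (simp add: r_def \<tau> field_simps)
      moreover have "T powr (1 - \<tau>) = H powr (1 - \<tau>) / g powr (r * (1 - \<tau>))"
        using g H by (simp add: T_def powr_divide powr_powr)
      then have "g powr q * T powr (1 - \<tau>) = H powr (1 - \<tau>) * g powr (q - r * (1 - \<tau>))"
        by (simp add: powr_diff)
      ultimately show ?thesis by simp
    qed
    have c3: "?c3 * H = g powr q * T powr (1 - \<tau>)"
    proof -
      have "?c3 * H = g powr q * T powr (-\<tau>) * T" by (simp add: T_def)
      also have "\<dots> = g powr q * T powr (1 - \<tau>)" using T by (simp add: powr_diff powr_minus field_simps)
      finally show ?thesis .
    qed
    have c2: "?c2 * (2 * (-(T powr (-N + 1)) / (-N + 1))) = (2 / (N - 1)) * (g powr q * T powr (1 - \<tau>))"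
    proof -
      have "-(T powr (-N + 1)) / (-N + 1) = T powr (1 - N) / (N - 1)" unfolding eN by simp
      moreover have "T powr (N - \<tau>) * T powr (1 - N) = T powr (1 - \<tau>)" by (simp add: powr_add[symmetric])
      ultimately show ?thesis by (simp add: mult.assoc[symmetric])
    qed
    have "(2 / (N - 1)) * (g powr q * T powr (1 - \<tau>)) \<le> 2 * (g powr q * T powr (1 - \<tau>))"
      using N by (intro mult_right_mono) (auto simp: field_simps)
    then show "?c1 * (2 * (T powr (-\<tau> + 1) / (-\<tau> + 1)))
      + ?c2 * (2 * (-(T powr (-N + 1)) / (-N + 1))) + ?c3 * H
      \<le> (2 / (1 - \<tau>) + 3) * (H powr (1 - \<tau>) * g powr \<tau>)"
      unfolding c2 c3 k by (simp add: algebra_simps)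
  qed
  finally show ?thesis .
qed

text \<open>On a line in direction i, the integral g of G bounds f pointwise and H is the integral
  of f^r with r = 1 + 1/k. The line estimate gives H^(1 - \<tau>) g^\<tau>, and Hoelder in the other
  variables uses that the integral of g is at most a and, by the Gagliardo inequality, that of H at
  most a^r; finally r (1 - \<tau>) + \<tau> = q. For \<tau> = 0 Hoelder degenerates and the claim is
  the Gagliardo inequality itself.\<close>

lemma weighted_gagliardo:
  fixes f G :: "real ^ 'n \<Rightarrow> real" and q \<tau> a :: real
  assumes card: "CARD('n) = Suc k" "k \<ge> 1"
    and q: "1 < q" "q \<le> 1 + 1 / real k" and \<tau>: "\<tau> = real CARD('n) - real k * q"
    and m: "f \<in> borel_measurable borel" "G \<in> borel_measurable borel"
    and nn: "\<And>x. 0 \<le> f x" "\<And>x. 0 \<le> G x"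
    and line: "\<And>i x. ennreal (f x) \<le> (\<integral>\<^sup>+t. G (\<chi> j. if j = i then t else x $ j) \<partial>lborel)"
    and a: "(\<integral>\<^sup>+x. G x \<partial>lborel) \<le> ennreal a" "a > 0"
  shows "(\<integral>\<^sup>+x. ennreal (\<bar>x $ i\<bar> powr (- \<tau>) * f x powr q) \<partial>lborel) \<le> ennreal ((2 / (1 - \<tau>) + 3) * a powr q)"
proof -
  interpret P: product_sigma_finite "\<lambda>_::'n. lborel :: real measure" by standard
  define N where "N = real CARD('n)"
  have N: "2 \<le> N" "N - 1 = real k" "N = real k + 1" using card by (auto simp: N_def)
  define r where "r = 1 + 1 / real k"
  have r: "r = N / (N - 1)" using N by (simp add: r_def field_simps)
  have \<tau>N: "\<tau> = N - (N - 1) * q" using \<tau> N by (simp add: N_def)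
  have \<tau>': "1 - \<tau> = (N - 1) * (q - 1)" by (simp add: \<tau>N algebra_simps)
  have "0 < (N - 1) * (q - 1)" using N q by (intro mult_pos_pos) auto
  then have \<tau>1: "\<tau> < 1" using \<tau>' by linarith
  have \<tau>0: "0 \<le> \<tau>" using N q r by (simp add: \<tau>N r_def[symmetric] field_simps)
  note [measurable] = m
  have gag: "(\<integral>\<^sup>+x. ennreal (f x powr r) \<partial>lborel) \<le> ennreal (a powr r)"
    unfolding r_def using card m nn line a by (intro gagliardo) auto
  show ?thesis
  proof (cases "\<tau> = 0")
    case True
    have "q * (N - 1) = N" using True \<tau>N by (simp add: mult.commute)
    then have qr: "q = r" using N(1) by (simp add: r eq_divide_eq)
    have "(\<integral>\<^sup>+x. ennreal (\<bar>x $ i\<bar> powr (- \<tau>) * f x powr q) \<partial>lborel) \<le> (\<integral>\<^sup>+x. ennreal (f x powr r) \<partial>lborel)"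
      unfolding qr True by (intro nn_integral_mono ennreal_leI) simp
    also have "\<dots> \<le> ennreal (a powr r)" by (rule gag)
    also have "\<dots> \<le> ennreal ((2 / (1 - \<tau>) + 3) * a powr q)"
      unfolding qr True by (intro ennreal_leI) simp
    finally show ?thesis .
  next
    case False
    let ?I = "UNIV - {i}"
    let ?P = "\<lambda>I. Pi\<^sub>M I (\<lambda>_. lborel :: real measure)"
    have U: "insert i ?I = UNIV" by auto
    define F where "F y = f (\<chi> j. y j)" for y
    define K where "K y = G (\<chi> j. y j)" for y
    have F0: "0 \<le> F y" for y by (simp add: F_def nn)
    have [measurable]: "F \<in> borel_measurable (?P UNIV)" "K \<in> borel_measurable (?P UNIV)"
      unfolding F_def K_def
      using measurable_compose[OF measurable_vec_lambda_PiM m(1)] measurable_compose[OF measurable_vec_lambda_PiM m(2)]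
      by auto
    have split: "(\<integral>\<^sup>+y. u y \<partial>?P UNIV) = (\<integral>\<^sup>+x. (\<integral>\<^sup>+t. u (x(i := t)) \<partial>lborel) \<partial>?P ?I)"
      if "u \<in> borel_measurable (?P UNIV)" for u :: "('n \<Rightarrow> real) \<Rightarrow> ennreal"
      using that P.product_nn_integral_insert[of ?I i u] by (simp add: U)
    interpret sf: sigma_finite_measure "?P ?I" by (rule P.sigma_finite) auto
    have upd2[measurable]: "(\<lambda>(x, t). x(i := t)) \<in> measurable (?P ?I \<Otimes>\<^sub>M lborel) (?P UNIV)"
      using measurable_add_dim[of i ?I "\<lambda>_. lborel :: real measure"] unfolding U .
    define g where "g x = (\<integral>\<^sup>+t. ennreal (K (x(i := t))) \<partial>lborel)" for x
    define H where "H x = (\<integral>\<^sup>+t. ennreal (F (x(i := t)) powr r) \<partial>lborel)" for x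
    have K2[measurable]: "(\<lambda>(x, t). K (x(i := t))) \<in> borel_measurable (?P ?I \<Otimes>\<^sub>M lborel)"
      using measurable_compose[OF upd2, of K borel] by (simp add: split_beta')
    have F2[measurable]: "(\<lambda>(x, t). F (x(i := t))) \<in> borel_measurable (?P ?I \<Otimes>\<^sub>M lborel)"
      using measurable_compose[OF upd2, of F borel] by (simp add: split_beta')
    have [measurable]: "g \<in> borel_measurable (?P ?I)" unfolding g_def by measurable
    have [measurable]: "H \<in> borel_measurable (?P ?I)" unfolding H_def by measurable
    have gI: "(\<integral>\<^sup>+x. g x \<partial>?P ?I) \<le> ennreal a"
    proof -
      have "(\<integral>\<^sup>+x. g x \<partial>?P ?I) = (\<integral>\<^sup>+y. ennreal (K y) \<partial>?P UNIV)"
        unfolding g_def by (subst split) auto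
      also have "\<dots> = (\<integral>\<^sup>+x. G x \<partial>lborel)" by (subst nn_integral_lborel_vec) (auto simp: K_def)
      finally show ?thesis using a by simp
    qed
    have HI: "(\<integral>\<^sup>+x. H x \<partial>?P ?I) \<le> ennreal (a powr r)"
    proof -
      have "(\<integral>\<^sup>+x. H x \<partial>?P ?I) = (\<integral>\<^sup>+y. ennreal (F y powr r) \<partial>?P UNIV)"
        unfolding H_def by (subst split) auto
      also have "\<dots> = (\<integral>\<^sup>+x. f x powr r \<partial>lborel)" by (subst nn_integral_lborel_vec) (auto simp: F_def)
      finally show ?thesis using gag by simp
    qed
    have gfin: "AE x in ?P ?I. g x \<noteq> \<infinity>"
      using gI by (intro nn_integral_PInf_AE) (auto simp: top_unique)
    have Hfin: "AE x in ?P ?I. H x \<noteq> \<infinity>"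
      using HI by (intro nn_integral_PInf_AE) (auto simp: top_unique)
    define C where "C = 2 / (1 - \<tau>) + 3"
    have C: "C > 0" using \<tau>1 by (simp add: C_def add_pos_pos)
    have "(\<integral>\<^sup>+x. ennreal (\<bar>x $ i\<bar> powr (- \<tau>) * f x powr q) \<partial>lborel)
      = (\<integral>\<^sup>+y. ennreal (\<bar>y i\<bar> powr (- \<tau>) * F y powr q) \<partial>?P UNIV)"
      by (subst nn_integral_lborel_vec) (auto simp: F_def)
    also have "\<dots> = (\<integral>\<^sup>+x. (\<integral>\<^sup>+t. ennreal (\<bar>t\<bar> powr (- \<tau>) * F (x(i := t)) powr q) \<partial>lborel) \<partial>?P ?I)"
      by (subst split) auto
    also have "\<dots> \<le> (\<integral>\<^sup>+x. ennreal C * ennreal (enn2real (H x) powr (1 - \<tau>) * enn2real (g x) powr (1 - (1 - \<tau>))) \<partial>?P ?I)"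
    proof (rule nn_integral_mono_AE)
      show "AE x in ?P ?I. (\<integral>\<^sup>+t. ennreal (\<bar>t\<bar> powr (- \<tau>) * F (x(i := t)) powr q) \<partial>lborel)
        \<le> ennreal C * ennreal (enn2real (H x) powr (1 - \<tau>) * enn2real (g x) powr (1 - (1 - \<tau>)))"
        using gfin Hfin AE_space
      proof eventually_elim
        case (elim x)
        have [measurable]: "(\<lambda>t. F (x(i := t))) \<in> borel_measurable borel"
          using measurable_compose[OF measurable_Pair1'[OF elim(3)] F2] by simp
        have hg: "F (x(i := t)) \<le> enn2real (g x)" for t
        proof -
          have "ennreal (F (x(i := t))) \<le> g x"
            unfolding g_def F_def K_def using line[of "\<chi> j. (x(i := t)) j" i]
            by (simp add: fun_upd_def cong: if_cong)
          also have "g x = ennreal (enn2real (g x))" using elim by (simp add: less_top)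
          finally show ?thesis by (simp only: ennreal_le_iff[OF enn2real_nonneg])
        qed
        \<comment> \<open>The line estimate divides by g and presupposes positive g and H. If one of
          them is 0, then F vanishes almost everywhere on the line.\<close>
        show ?case
        proof (cases "enn2real (g x) = 0 \<or> enn2real (H x) = 0")
          case True
          have "AE t in lborel. F (x(i := t)) = 0"
          proof (cases "enn2real (g x) = 0")
            case True
            then show ?thesis using hg nn by (auto simp: F_def intro: order.antisym)
          next
            case False
            then have "H x = 0" using True elim by (auto simp: enn2real_eq_0_iff)
            then have "AE t in lborel. ennreal (F (x(i := t)) powr r) = 0"
              unfolding H_def by (subst (asm) nn_integral_0_iff_AE) auto
            then show ?thesis by eventually_elim auto
          qed
          then have "AE t in lborel. ennreal (\<bar>t\<bar> powr (- \<tau>) * F (x(i := t)) powr q) = 0"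
            by eventually_elim simp
          then have "(\<integral>\<^sup>+t. ennreal (\<bar>t\<bar> powr (- \<tau>) * F (x(i := t)) powr q) \<partial>lborel) = 0"
            by (subst nn_integral_0_iff_AE) auto
          then show ?thesis by simp
        next
          case False
          then have pos: "0 < enn2real (g x)" "0 < enn2real (H x)"
            using enn2real_nonneg[of "g x"] enn2real_nonneg[of "H x"] by linarith+
          have "(\<integral>\<^sup>+t. ennreal (\<bar>t\<bar> powr (- \<tau>) * F (x(i := t)) powr q) \<partial>lborel)
            \<le> ennreal ((2 / (1 - \<tau>) + 3) * (enn2real (H x) powr (1 - \<tau>) * enn2real (g x) powr \<tau>))"
          proof (rule weighted_line_bound[OF N(1) q(1) _ \<tau>N])
            show "q \<le> N / (N - 1)" using q r r_def by simp
            show "(\<integral>\<^sup>+t. ennreal (F (x(i := t)) powr (N / (N - 1))) \<partial>lborel) \<le> ennreal (enn2real (H x))"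
              using elim by (simp add: H_def r less_top)
          qed (use hg pos F0 in auto)
          then show ?thesis using C by (simp add: C_def[symmetric] ennreal_mult)
        qed
      qed
    qed
    also have "\<dots> = ennreal C * (\<integral>\<^sup>+x. ennreal (enn2real (H x) powr (1 - \<tau>) * enn2real (g x) powr (1 - (1 - \<tau>))) \<partial>?P ?I)"
      by (rule nn_integral_cmult) measurable
    also have "\<dots> \<le> ennreal C * ennreal ((a powr r) powr (1 - \<tau>) * a powr (1 - (1 - \<tau>)))"
    proof (intro mult_left_mono nn_integral_Holder)
      have "(\<integral>\<^sup>+x. ennreal (enn2real (H x)) \<partial>?P ?I) = (\<integral>\<^sup>+x. H x \<partial>?P ?I)"
        using Hfin by (intro nn_integral_cong_AE) (auto simp: less_top)
      then show "(\<integral>\<^sup>+x. ennreal (enn2real (H x)) \<partial>?P ?I) \<le> ennreal (a powr r)" using HI by simp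
      have "(\<integral>\<^sup>+x. ennreal (enn2real (g x)) \<partial>?P ?I) = (\<integral>\<^sup>+x. g x \<partial>?P ?I)"
        using gfin by (intro nn_integral_cong_AE) (auto simp: less_top)
      then show "(\<integral>\<^sup>+x. ennreal (enn2real (g x)) \<partial>?P ?I) \<le> ennreal a" using gI by simp
    qed (use \<tau>0 \<tau>1 a False in auto)
    also have "\<dots> = ennreal (C * a powr q)"
    proof -
      have "r * (1 - \<tau>) + \<tau> = q" using N by (simp add: r \<tau>N field_simps)
      then have "(a powr r) powr (1 - \<tau>) * a powr (1 - (1 - \<tau>)) = a powr q"
        using a by (simp add: powr_powr powr_add[symmetric])
      then show ?thesis using C by (simp add: ennreal_mult)
    qed
    finally show ?thesis by (simp add: C_def)
  qed
qed


subsection \<open>Compactly supported functions of class C1\<close>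

text \<open>The gradient is a parameter because the functions formed later come with an explicit
  formula for it. This class is stable under u -> |u|^p for p > 1, which need not preserve
  smoothness.\<close>

definition C1_compact :: "(real ^ 'n \<Rightarrow> real) \<Rightarrow> (real ^ 'n \<Rightarrow> real ^ 'n) \<Rightarrow> bool" where
  "C1_compact u Du \<longleftrightarrow> (\<forall>x. (u has_derivative (\<lambda>v. Du x \<bullet> v)) (at x)) \<and> continuous_on UNIV Du
     \<and> (\<exists>R. \<forall>x. R < norm x \<longrightarrow> u x = 0)"

lemma C1_compactD:
  assumes "C1_compact u Du"
  shows "(u has_derivative (\<lambda>v. Du x \<bullet> v)) (at x)" "continuous_on UNIV Du" "continuous_on UNIV u"
    and "u \<in> borel_measurable borel" "Du \<in> borel_measurable borel"
proof -
  show d: "(u has_derivative (\<lambda>v. Du x \<bullet> v)) (at x)" for x using assms by (simp add: C1_compact_def)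
  show c: "continuous_on UNIV Du" using assms by (simp add: C1_compact_def)
  have "isCont u x" for x using d[of x] has_derivative_continuous by blast
  then show c': "continuous_on UNIV u" by (simp add: continuous_on_eq_continuous_within)
  show "u \<in> borel_measurable borel" "Du \<in> borel_measurable borel"
    using c c' by (auto intro: borel_measurable_continuous_onI)
qed

lemma C1_compact_bound:
  assumes "C1_compact u Du"
  obtains R where "R > 0" "\<And>x. R < norm x \<Longrightarrow> u x = 0" "\<And>x. R < norm x \<Longrightarrow> Du x = 0"
proof -
  obtain R0 where R0: "\<And>x. R0 < norm x \<Longrightarrow> u x = 0" using assms by (auto simp: C1_compact_def)
  define R where "R = max R0 1"
  have u: "u x = 0" if "R < norm x" for x using R0 that by (simp add: R_def)
  have "Du x = 0" if x: "R < norm x" for x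
  proof -
    have "open {y. R < norm (y :: real ^ 'a)}" by (intro open_Collect_less continuous_intros)
    moreover have "(u has_derivative (\<lambda>v. Du x \<bullet> v)) (at x)" using assms by (rule C1_compactD)
    ultimately have "((\<lambda>_. 0) has_derivative (\<lambda>v. Du x \<bullet> v)) (at x)"
      using has_derivative_transform_within_open[of u _ x UNIV "{y. R < norm y}" "\<lambda>_. 0"] x u by auto
    then have "(\<lambda>v. Du x \<bullet> v) = (\<lambda>_. 0)"
      by (rule has_derivative_unique) simp
    then have "Du x \<bullet> Du x = 0" by metis
    then show ?thesis by simp
  qed
  then show ?thesis using that[of R] u by (simp add: R_def)
qed

lemma integrable_continuous_compact_support:
  fixes h :: "'a::euclidean_space \<Rightarrow> real"
  assumes "continuous_on UNIV h" and "\<And>x. R < norm x \<Longrightarrow> h x = 0"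
  shows "integrable lborel h"
proof -
  have "integrable lborel (\<lambda>x. indicator (cball 0 R) x *\<^sub>R h x)"
    using assms(1) by (intro borel_integrable_compact) (auto intro: continuous_on_subset)
  also have "(\<lambda>x. indicator (cball 0 R) x *\<^sub>R h x) = h"
    using assms(2) by (auto simp: fun_eq_iff indicator_def not_le)
  finally show ?thesis .
qed

lemma bounded_continuous_compact_support:
  fixes h :: "'a::euclidean_space \<Rightarrow> 'b::real_normed_vector"
  assumes "continuous_on UNIV h" and "\<And>x. R < norm x \<Longrightarrow> h x = 0"
  obtains M where "M > 0" "\<And>x. norm (h x) \<le> M"
proof -
  have "compact (h ` cball 0 R)"
    using assms(1) by (intro compact_continuous_image) (auto intro: continuous_on_subset)
  then obtain M where M: "M > 0" "\<And>y. y \<in> h ` cball 0 R \<Longrightarrow> norm y \<le> M"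
    using compact_imp_bounded bounded_pos by metis
  have "norm (h x) \<le> M" for x
    using M(2)[of "h x"] assms(2)[of x] M(1) by (cases "norm x \<le> R") auto
  then show ?thesis using that M by blast
qed

text \<open>The partial derivative is integrated along the line, starting outside the support. This
  supplies the hypothesis \<open>line\<close> of the Gagliardo inequalities with G the norm of the
  gradient.\<close>

lemma C1_compact_le_line_integral:
  fixes f :: "real ^ 'n \<Rightarrow> real"
  assumes f: "C1_compact f Df"
  shows "ennreal (f x) \<le> (\<integral>\<^sup>+t. norm (Df (\<chi> j. if j = i then t else x $ j)) \<partial>lborel)"
proof -
  obtain R where R: "R > 0" "\<And>x. R < norm x \<Longrightarrow> f x = 0" "\<And>x. R < norm x \<Longrightarrow> Df x = 0"
    using C1_compact_bound[OF f] by metis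
  define \<gamma> where "\<gamma> t = x + (t - x $ i) *\<^sub>R axis i 1" for t
  have \<gamma>: "\<gamma> t = (\<chi> j. if j = i then t else x $ j)" for t
    by (simp add: \<gamma>_def vec_eq_iff axis_def)
  \<comment> \<open>This point lies to the left of x_i, and its coordinate i alone already exceeds R
    in absolute value, so f vanishes there.\<close>
  define a where "a = - (R + \<bar>x $ i\<bar> + 1)"
  have a: "a \<le> x $ i" by (simp add: a_def) (use R in linarith)
  have "R < \<bar>a\<bar>" using R by (simp add: a_def)
  also have "\<bar>a\<bar> \<le> norm (\<gamma> a)" using component_le_norm_cart[of "\<gamma> a" i] by (simp add: \<gamma>)
  finally have fa: "f (\<gamma> a) = 0" by (rule R(2))
  have d\<gamma>: "(\<gamma> has_derivative (\<lambda>s. s *\<^sub>R axis i 1)) (at t)" for t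
    unfolding \<gamma>_def by (auto intro!: derivative_eq_intros)
  have "((\<lambda>t. f (\<gamma> t)) has_vector_derivative (Df (\<gamma> t) \<bullet> axis i 1)) (at t within S)" for t S
    unfolding has_vector_derivative_def
    using diff_chain_at[OF d\<gamma>[of t] C1_compactD(1)[OF f, of "\<gamma> t"]]
    by (auto simp: o_def mult.commute intro: has_derivative_at_withinI)
  then have "((\<lambda>t. Df (\<gamma> t) \<bullet> axis i 1) has_integral f (\<gamma> (x $ i)) - f (\<gamma> a)) {a..x $ i}"
    by (intro fundamental_theorem_of_calculus a) auto
  moreover have "f (\<gamma> (x $ i)) = f x" by (simp add: \<gamma>_def)
  ultimately have I: "((\<lambda>t. Df (\<gamma> t) \<bullet> axis i 1) has_integral f x) {a..x $ i}" using fa by simp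
  have cD: "continuous_on S (\<lambda>t. Df (\<gamma> t))" for S
    unfolding \<gamma>_def
    by (rule continuous_on_compose2[OF C1_compactD(2)[OF f]]) (auto intro!: continuous_intros)
  obtain J where J: "((\<lambda>t. norm (Df (\<gamma> t))) has_integral J) {a..x $ i}"
    using integrable_continuous_interval[OF continuous_on_norm[OF cD], of a "x $ i"]
    by (auto simp: integrable_on_def)
  have "Df (\<gamma> t) \<bullet> axis i 1 \<le> norm (Df (\<gamma> t))" for t
    using norm_cauchy_schwarz[of "Df (\<gamma> t)" "axis i 1"] by simp
  then have "f x \<le> J" by (intro has_integral_le[OF I J])
  then have "ennreal (f x) \<le> ennreal J" by (rule ennreal_leI)
  also have "\<dots> = (\<integral>\<^sup>+t. ennreal (norm (Df (\<gamma> t))) * indicator {a..x $ i} t \<partial>lborel)"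
    by (rule nn_integral_has_integral_lebesgue'[OF _ J, symmetric]) auto
  also have "\<dots> \<le> (\<integral>\<^sup>+t. norm (Df (\<gamma> t)) \<partial>lborel)"
    by (intro nn_integral_mono) (auto simp: indicator_def)
  finally show ?thesis by (simp only: \<gamma>)
qed

text \<open>By translation invariance the difference quotients \<open>s k\<close> have integral 0.
  They converge to the partial derivative and are dominated by the Lipschitz constant of
  \<open>\<psi>\<close> times the indicator of a ball; the steps have length at most 1, hence the
  radius R + 1.\<close>

lemma integral_partial_derivative_eq_0:
  fixes \<psi> :: "real ^ 'n \<Rightarrow> real"
  assumes \<psi>: "C1_compact \<psi> D\<psi>"
  shows "integrable lborel (\<lambda>x. D\<psi> x $ i)" "(LINT x|lborel. D\<psi> x $ i) = 0"
proof -
  obtain R where R: "R > 0" "\<And>x. R < norm x \<Longrightarrow> \<psi> x = 0" "\<And>x. R < norm x \<Longrightarrow> D\<psi> x = 0"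
    using C1_compact_bound[OF \<psi>] by metis
  obtain M where M: "M > 0" "\<And>x. norm (D\<psi> x) \<le> M"
    using bounded_continuous_compact_support[OF C1_compactD(2)[OF \<psi>] R(3)] by metis
  have int\<psi>: "integrable lborel \<psi>"
    by (rule integrable_continuous_compact_support[OF C1_compactD(3)[OF \<psi>] R(2)])
  show "integrable lborel (\<lambda>x. D\<psi> x $ i)"
    using R C1_compactD(2)[OF \<psi>]
    by (intro integrable_continuous_compact_support[where R=R]) (auto intro!: continuous_intros)
  define s where "s k x = real (Suc k) * (\<psi> (x + (1 / real (Suc k)) *\<^sub>R axis i 1) - \<psi> x)" for k x
  have [measurable]: "\<psi> \<in> borel_measurable borel" "D\<psi> \<in> borel_measurable borel" using C1_compactD[OF \<psi>] by auto
  have shift: "has_bochner_integral lborel (\<lambda>x. \<psi> (x + v)) (integral\<^sup>L lborel \<psi>)" for v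
  proof -
    have eq: "(lborel :: (real ^ 'n) measure) = distr lborel borel ((+) v)" by (rule lborel_distr_plus[symmetric])
    have "integrable (distr lborel borel ((+) v)) \<psi>" using int\<psi> by (simp add: lborel_distr_plus)
    then have "integrable lborel (\<lambda>x. \<psi> (v + x))" by (subst (asm) integrable_distr_eq) auto
    moreover have "integral\<^sup>L lborel \<psi> = (LINT x|lborel. \<psi> (v + x))"
      by (subst eq, subst integral_distr) auto
    ultimately show ?thesis by (simp add: has_bochner_integral_iff add.commute)
  qed
  have s0: "(LINT x|lborel. s k x) = 0" for k
    using shift[of "(1 / real (Suc k)) *\<^sub>R axis i 1"] int\<psi>
    by (simp add: s_def has_bochner_integral_iff del: of_nat_Suc)
  have lim: "(\<lambda>k. s k x) \<longlonglongrightarrow> D\<psi> x $ i" for x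
  proof -
    have "(\<psi> has_derivative (\<lambda>v. D\<psi> x \<bullet> v)) (at (x + 0 *\<^sub>R axis i 1))" using C1_compactD(1)[OF \<psi>, of x] by simp
    moreover have "((\<lambda>t. x + t *\<^sub>R axis i 1) has_derivative (\<lambda>t. t *\<^sub>R axis i 1)) (at 0)"
      by (auto intro!: derivative_eq_intros)
    ultimately have "((\<lambda>t. \<psi> (x + t *\<^sub>R axis i 1)) has_derivative (\<lambda>t. D\<psi> x \<bullet> (t *\<^sub>R axis i 1))) (at 0)"
      using has_derivative_compose[where g = \<psi> and f = "\<lambda>t. x + t *\<^sub>R axis i 1"
        and f' = "\<lambda>t. t *\<^sub>R axis i 1" and x = 0 and s = UNIV] by blast
    then have "((\<lambda>t. \<psi> (x + t *\<^sub>R axis i 1)) has_real_derivative (D\<psi> x $ i)) (at 0)"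
      by (simp add: has_field_derivative_def inner_axis mult.commute[of _ "D\<psi> x $ i"])
    then have *: "((\<lambda>h. (\<psi> (x + h *\<^sub>R axis i 1) - \<psi> x) / h) \<longlongrightarrow> D\<psi> x $ i) (at 0)"
      by (simp add: DERIV_def)
    have "filterlim (\<lambda>k. 1 / real (Suc k)) (at 0) sequentially"
      using LIMSEQ_inverse_real_of_nat by (auto simp: filterlim_at inverse_eq_divide)
    from filterlim_compose[OF * this] show ?thesis
      by (simp add: s_def field_simps)
  qed
  have bnd: "norm (s k x) \<le> M * indicator (cball 0 (R + 1)) x" for k x
  proof -
    define v where "v = (1 / real (Suc k)) *\<^sub>R (axis i 1 :: real ^ 'n)"
    have nv: "norm v = 1 / real (Suc k)" by (simp add: v_def)
    have "norm (\<psi> (x + v) - \<psi> x) \<le> M * norm ((x + v) - x)"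
    proof (rule differentiable_bound[OF convex_UNIV])
      show "(\<psi> has_derivative (\<lambda>v. D\<psi> y \<bullet> v)) (at y within UNIV)" for y using C1_compactD(1)[OF \<psi>] by simp
      show "onorm (\<lambda>v. D\<psi> y \<bullet> v) \<le> M" for y
        using M(2)[of y] by (simp add: onorm_inner_right[OF bounded_linear_ident, simplified] onorm_id order.trans[OF onorm_inner_right])
    qed auto
    then have "real (Suc k) * norm (\<psi> (x + v) - \<psi> x) \<le> real (Suc k) * (M * (1 / real (Suc k)))"
      by (intro mult_left_mono) (auto simp: nv)
    then have "norm (s k x) \<le> M"
      unfolding s_def v_def[symmetric] by (simp add: abs_mult del: of_nat_Suc)
    moreover have "s k x = 0" if "x \<notin> cball 0 (R + 1)"
    proof -
      have "norm x \<le> norm (x + v) + norm v" by (metis add_diff_cancel_right' norm_triangle_ineq4)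
      moreover have "norm v \<le> 1" by (simp add: nv)
      ultimately show ?thesis
        unfolding s_def v_def[symmetric] using that R(2)[of x] R(2)[of "x + v"] by simp
    qed
    ultimately show ?thesis by (auto simp: indicator_def)
  qed
  have "(\<lambda>k. LINT x|lborel. s k x) \<longlonglongrightarrow> (LINT x|lborel. D\<psi> x $ i)"
  proof (rule integral_dominated_convergence[where w = "\<lambda>x. M * indicator (cball 0 (R + 1)) x"])
    show "(\<lambda>x. D\<psi> x $ i) \<in> borel_measurable lborel"
      using C1_compactD(2)[OF \<psi>] by (auto intro!: borel_measurable_continuous_onI continuous_intros)
    show "s k \<in> borel_measurable lborel" for k unfolding s_def by measurable
    show "integrable lborel (\<lambda>x. M * indicator (cball 0 (R + 1)) x)"
      by (intro integrable_mult_right integrable_real_indicator) (auto simp: emeasure_bounded_finite[simplified])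
  qed (use lim bnd in auto)
  then show "(LINT x|lborel. D\<psi> x $ i) = 0" by (simp add: s0 LIMSEQ_const_iff)
qed

text \<open>The divergence theorem for the field whose components are
  \<open>\<psi> x * x $ i\<close> for i in S and 0 otherwise; \<open>card S\<close> is the
  divergence of the projected identity.\<close>

lemma integral_radial_by_parts:
  fixes \<psi> :: "real ^ 'n \<Rightarrow> real"
  assumes \<psi>: "C1_compact \<psi> D\<psi>"
  shows "integrable lborel (\<lambda>x. (\<Sum>i\<in>S. D\<psi> x $ i * x $ i) + real (card S) * \<psi> x)" (is ?A)
    and "(LINT x|lborel. (\<Sum>i\<in>S. D\<psi> x $ i * x $ i) + real (card S) * \<psi> x) = 0" (is ?B)
proof -
  have c: "C1_compact (\<lambda>x. \<psi> x * x $ i) (\<lambda>x. (x $ i) *\<^sub>R D\<psi> x + \<psi> x *\<^sub>R axis i 1)" for i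
    unfolding C1_compact_def
  proof (intro conjI allI)
    show "((\<lambda>x. \<psi> x * x $ i) has_derivative (\<lambda>v. ((x $ i) *\<^sub>R D\<psi> x + \<psi> x *\<^sub>R axis i 1) \<bullet> v)) (at x)" for x
      using C1_compactD(1)[OF \<psi>, of x]
      by (auto intro!: bounded_linear_imp_has_derivative[OF bounded_linear_vec_nth] derivative_eq_intros simp: inner_add_left inner_axis inner_commute algebra_simps inner_axis')
    show "\<exists>R. \<forall>x. R < norm x \<longrightarrow> \<psi> x * x $ i = 0" using \<psi> by (auto simp: C1_compact_def)
  qed (use C1_compactD[OF \<psi>] in \<open>auto intro!: continuous_intros\<close>)
  have "integrable lborel (\<lambda>x. D\<psi> x $ i * x $ i + \<psi> x)" "(LINT x|lborel. D\<psi> x $ i * x $ i + \<psi> x) = 0" for i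
    using integral_partial_derivative_eq_0[OF c, of i i] by (simp_all add: mult.commute axis_def)
  then have "has_bochner_integral lborel (\<lambda>x. \<Sum>i\<in>S. D\<psi> x $ i * x $ i + \<psi> x) (\<Sum>i\<in>S. 0)"
    by (intro has_bochner_integral_sum) (auto simp: has_bochner_integral_iff)
  then have "has_bochner_integral lborel (\<lambda>x. (\<Sum>i\<in>S. D\<psi> x $ i * x $ i) + real (card S) * \<psi> x) 0"
    by (simp add: sum.distrib)
  then show ?A ?B by (auto simp: has_bochner_integral_iff)
qed

lemma test_function_C1_compact:
  assumes "test_function u"
  shows "C1_compact u (grad u)"
  unfolding C1_compact_def
proof (intro conjI allI)
  have 1: "Ck_fun 1 u" using assms by (simp add: test_function_def)
  then have d: "u differentiable (at x)" for x by (simp add: differentiable_on_def)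
  have cont: "continuous_on UNIV (\<lambda>x. frechet_derivative u (at x) v)" for v using 1 by simp
  show "(u has_derivative (\<lambda>v. grad u x \<bullet> v)) (at x)" for x
  proof -
    have D: "(u has_derivative frechet_derivative u (at x)) (at x)" using d by (simp add: frechet_derivative_works)
    then interpret bounded_linear "frechet_derivative u (at x)" by (rule has_derivative_bounded_linear)
    have "frechet_derivative u (at x) v = grad u x \<bullet> v" for v
    proof -
      have "frechet_derivative u (at x) v = frechet_derivative u (at x) (\<Sum>i\<in>UNIV. (v $ i) *\<^sub>R axis i 1)"
        using basis_expansion[of v] by (simp add: scalar_mult_eq_scaleR)
      also have "\<dots> = (\<Sum>i\<in>UNIV. v $ i * frechet_derivative u (at x) (axis i 1))"
        by (simp add: sum scaleR)
      also have "\<dots> = grad u x \<bullet> v" by (simp add: grad_def inner_vec_def mult.commute)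
      finally show ?thesis .
    qed
    then show ?thesis using D by presburger
  qed
  show "continuous_on UNIV (grad u)"
    unfolding grad_def using cont by (intro continuous_on_vec_lambda)
  have "bounded (closure {x. u x \<noteq> 0})" using assms by (simp add: test_function_def compact_imp_bounded)
  then obtain R where R: "\<And>x. x \<in> closure {x. u x \<noteq> 0} \<Longrightarrow> norm x \<le> R" by (auto simp: bounded_iff)
  show "\<exists>R. \<forall>x. R < norm x \<longrightarrow> u x = 0"
  proof (intro exI[of _ R] allI impI)
    fix x :: "real ^ 'a" assume "R < norm x"
    then have "x \<notin> {x. u x \<noteq> 0}" using R closure_subset[of "{x. u x \<noteq> 0}"] by fastforce
    then show "u x = 0" by simp
  qed
qed


subsection \<open>Hardy inequality and ground state transformation\<close>

lemma AE_coordinates_nonzero: "AE x :: real ^ 'n in lborel. \<forall>i. x $ i \<noteq> 0"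
proof -
  have "AE x :: real ^ 'n in lborel. x $ i \<noteq> 0" for i
  proof -
    have "negligible {x :: real ^ 'n. axis i 1 \<bullet> x = 0}"
      by (rule negligible_hyperplane) simp
    then have "{x :: real ^ 'n. x $ i = 0} \<in> null_sets lebesgue"
      by (simp add: negligible_iff_null_sets inner_axis')
    moreover have "closed {x :: real ^ 'n. x $ i = 0}"
      by (intro closed_Collect_eq continuous_intros)
    ultimately have "{x :: real ^ 'n. x $ i = 0} \<in> null_sets lborel"
      by (subst (asm) null_sets_completion_iff) auto
    then show ?thesis by (rule AE_I') auto
  qed
  then show ?thesis by (simp add: AE_all_countable)
qed

section \<open>Nested projections X_m, integration by parts along them, and the Hardy inequality for
  X_3\<close>

locale ordered_coords =
  fixes e :: "nat \<Rightarrow> 'n::finite" and n :: nat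
  assumes n3: "n \<ge> 3" and bij: "bij_betw e {1..n} (UNIV :: 'n set)"
begin

abbreviation P :: "nat \<Rightarrow> real ^ 'n \<Rightarrow> real ^ 'n" where "P \<equiv> first_coords e"

text \<open>The square is used because it is a polynomial, hence smooth on all of space, with
  gradient 2 X_m.\<close>

definition r :: "nat \<Rightarrow> real ^ 'n \<Rightarrow> real" where "r m x = (norm (P m x))\<^sup>2"

lemma card_n: "CARD('n) = n"
  using bij_betw_same_card[OF bij] by simp

lemma card_image_e: "m \<le> n \<Longrightarrow> card (e ` {1..m}) = m"
  using bij by (subst card_image) (auto simp: bij_betw_def intro: inj_on_subset)

lemma inner_P: "y \<bullet> P m x = (\<Sum>i\<in>e ` {1..m}. y $ i * x $ i)"
  by (simp add: inner_vec_def first_coords_def if_distrib sum.If_cases cong: if_cong)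

lemma r_eq_sum: "r m x = (\<Sum>i\<in>e ` {1..m}. (x $ i)\<^sup>2)"
  by (simp add: r_def dot_square_norm[symmetric] inner_P) (simp add: first_coords_def power2_eq_square)

lemma r_nonneg [simp]: "0 \<le> r m x"
  by (simp add: r_def)

lemma r_mono: "k \<le> m \<Longrightarrow> r k x \<le> r m x"
  unfolding r_eq_sum by (intro sum_mono2) auto

lemma inner_P_P: "P k x \<bullet> P m x = r (min k m) x"
proof (cases "k \<le> m")
  case True
  have "P k x \<bullet> P m x = (\<Sum>i\<in>e ` {1..k}. (x $ i)\<^sup>2)"
    using True by (subst inner_commute, subst inner_P, intro sum.cong) (auto simp: first_coords_def power2_eq_square)
  then show ?thesis using True by (simp add: r_eq_sum min_def)
next
  case False
  have "P k x \<bullet> P m x = (\<Sum>i\<in>e ` {1..m}. (x $ i)\<^sup>2)"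
    using False by (subst inner_P, intro sum.cong) (auto simp: first_coords_def power2_eq_square)
  then show ?thesis using False by (simp add: r_eq_sum min_def)
qed

lemma coordinate_le_r: "i \<in> {1..m} \<Longrightarrow> (x $ e i)\<^sup>2 \<le> r m x"
  unfolding r_eq_sum by (rule member_le_sum) auto

lemma r_n: "r n x = (norm x)\<^sup>2"
proof -
  have "e ` {1..n} = UNIV" using bij by (simp add: bij_betw_def)
  then show ?thesis unfolding r_eq_sum by (simp add: power2_norm_eq_inner inner_vec_def) (simp add: power2_eq_square)
qed

lemma linear_P: "bounded_linear (P m)"
proof -
  have "linear (P m)" by (rule linearI) (auto simp: first_coords_def vec_eq_iff)
  then show ?thesis by (simp add: linear_conv_bounded_linear)
qed

lemma P_continuous [continuous_intros]: "continuous_on S f \<Longrightarrow> continuous_on S (\<lambda>x. P m (f x))"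
  by (rule bounded_linear.continuous_on[OF linear_P])

lemma r_continuous [continuous_intros]: "continuous_on S f \<Longrightarrow> continuous_on S (\<lambda>x. r m (f x))"
  unfolding r_def by (intro continuous_intros)

lemma r_measurable [measurable]: "r m \<in> borel_measurable borel"
  by (intro borel_measurable_continuous_onI continuous_intros)

lemma r_has_derivative: "(r m has_derivative (\<lambda>v. (2 *\<^sub>R P m x) \<bullet> v)) (at x)"
proof -
  have "((\<lambda>x. P m x \<bullet> P m x) has_derivative (\<lambda>v. P m x \<bullet> P m v + P m v \<bullet> P m x)) (at x)"
    by (intro has_derivative_inner bounded_linear_imp_has_derivative linear_P)
  moreover have "P m x \<bullet> P m v + P m v \<bullet> P m x = (2 *\<^sub>R P m x) \<bullet> v" for v
    by (simp add: inner_P inner_commute[of _ v]) (simp add: first_coords_def sum_distrib_left[symmetric] mult.commute)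
  ultimately show ?thesis by (simp add: inner_P_P inner_commute)
qed

abbreviation potential :: "(nat \<Rightarrow> real) \<Rightarrow> real ^ 'n \<Rightarrow> real" where
  "potential b x \<equiv> \<Sum>m=3..n. b m / r m x"

abbreviation weighted_power :: "real \<Rightarrow> real \<Rightarrow> (real ^ 'n \<Rightarrow> real) \<Rightarrow> real" where
  "weighted_power s Q u \<equiv> LINT x|lborel. \<bar>x $ e 1\<bar> powr s * \<bar>u x\<bar> powr Q"

lemma hardy_sobolev_ineq_iff: "hardy_sobolev_ineq e n b Q C u \<longleftrightarrow>
    (LINT x|lborel. potential b x * (u x)\<^sup>2) + C * weighted_power ((Q - 2) / 2 * real n - Q) Q u powr (2 / Q)
      \<le> (LINT x|lborel. (norm (grad u x))\<^sup>2)"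
  by (simp add: hardy_sobolev_ineq_def r_def)

lemma AE_r_pos: "AE x in lborel. 0 < r 3 x"
  using AE_coordinates_nonzero
proof eventually_elim
  case (elim x)
  have "0 < (x $ e 1)\<^sup>2" using elim by simp
  also have "\<dots> \<le> r 3 x" by (rule coordinate_le_r) simp
  finally show ?case .
qed

text \<open>Integrates the divergence of g h(|X_m|^2) X_m: the gradient 2 X_m of |X_m|^2 produces 2
  h' |X_m|^2, and div X_m = m produces m h. The Hardy inequality and the energy identity take h(t) =
  1 / (t + c), the L1 estimate takes h(t) = 1 / sqrt (t + c).\<close>

lemma integral_field_by_parts:
  fixes h h' :: "real \<Rightarrow> real"
  assumes g: "C1_compact g Dg" and m: "m \<le> n"
    and h: "\<And>t. 0 \<le> t \<Longrightarrow> (h has_real_derivative h' t) (at t)" "continuous_on {0..} h'"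
  shows "has_bochner_integral lborel
    (\<lambda>x. h (r m x) * (Dg x \<bullet> P m x) + g x * (2 * h' (r m x) * r m x + real m * h (r m x))) 0"
proof -
  have ch: "continuous_on {0..} h"
    using h(1) by (intro continuous_at_imp_continuous_on) (auto intro: DERIV_isCont)
  have *: "C1_compact (\<lambda>x. h (r m x) * g x) (\<lambda>x. h (r m x) *\<^sub>R Dg x + (2 * h' (r m x) * g x) *\<^sub>R P m x)"
    unfolding C1_compact_def
  proof (intro conjI allI)
    fix x
    have "((\<lambda>x. h (r m x)) has_derivative (\<lambda>v. (2 *\<^sub>R P m x) \<bullet> v * h' (r m x))) (at x)"
      by (rule has_derivative_compose[OF r_has_derivative])
        (use h(1)[of "r m x"] in \<open>simp add: has_field_derivative_def mult_commute_abs\<close>)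
    then show "((\<lambda>x. h (r m x) * g x) has_derivative
        (\<lambda>v. (h (r m x) *\<^sub>R Dg x + (2 * h' (r m x) * g x) *\<^sub>R P m x) \<bullet> v)) (at x)"
      by (rule has_derivative_eq_rhs[OF has_derivative_mult[OF _ C1_compactD(1)[OF g, of x]]])
        (auto simp: inner_add_left algebra_simps)
  next
    show "continuous_on UNIV (\<lambda>x. h (r m x) *\<^sub>R Dg x + (2 * h' (r m x) * g x) *\<^sub>R P m x)"
      using C1_compactD[OF g]
      by (intro continuous_intros continuous_on_compose2[OF ch, of _ "r m"] continuous_on_compose2[OF h(2), of _ "r m"]) auto
    show "\<exists>R. \<forall>x. R < norm x \<longrightarrow> h (r m x) * g x = 0" using g by (auto simp: C1_compact_def)
  qed
  have "(\<Sum>i\<in>e ` {1..m}. (h (r m x) *\<^sub>R Dg x + (2 * h' (r m x) * g x) *\<^sub>R P m x) $ i * x $ i) + real (card (e ` {1..m})) * (h (r m x) * g x)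
      = h (r m x) * (Dg x \<bullet> P m x) + g x * (2 * h' (r m x) * r m x + real m * h (r m x))" for x
    unfolding inner_P[symmetric] card_image_e[OF m] using inner_P_P[of m x m]
    by (simp add: inner_add_left algebra_simps)
  then show ?thesis
    using integral_radial_by_parts[OF *, of "e ` {1..m}"] by (simp add: has_bochner_integral_iff)
qed

lemma C1_compact_power2:
  assumes "C1_compact u Du"
  shows "C1_compact (\<lambda>x. (u x)\<^sup>2) (\<lambda>x. (2 * u x) *\<^sub>R Du x)"
  unfolding C1_compact_def
proof (intro conjI allI)
  show "((\<lambda>x. (u x)\<^sup>2) has_derivative (\<lambda>v. ((2 * u x) *\<^sub>R Du x) \<bullet> v)) (at x)" for x
    using C1_compactD(1)[OF assms, of x] by (auto intro!: derivative_eq_intros)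
qed (use assms C1_compactD[OF assms] in \<open>auto simp: C1_compact_def intro!: continuous_intros\<close>)

text \<open>The field X_3 / (|X_3|^2 + c) has divergence 3/q - 2 |X_3|^2 / q^2 >= 1/q, where q =
  |X_3|^2 + c. Integrating u^2 against it, Cauchy-Schwarz leaves half of the left-hand side to be
  absorbed, which gives the constant 4.\<close>

lemma hardy_regularized:
  assumes u: "C1_compact u Du" and c: "c > 0"
  shows "(LINT x|lborel. (u x)\<^sup>2 / (r 3 x + c)) \<le> 4 * (LINT x|lborel. (norm (Du x))\<^sup>2)"
    and "integrable lborel (\<lambda>x. (u x)\<^sup>2 / (r 3 x + c))" "integrable lborel (\<lambda>x. (norm (Du x))\<^sup>2)"
proof -
  obtain R where R: "R > 0" "\<And>x. R < norm x \<Longrightarrow> u x = 0" "\<And>x. R < norm x \<Longrightarrow> Du x = 0"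
    using C1_compact_bound[OF u] by metis
  have pos: "r 3 x + c > 0" for x using c r_nonneg[of 3 x] by linarith
  then have ne: "r 3 x + c \<noteq> 0" for x by (metis less_irrefl)
  show iD: "integrable lborel (\<lambda>x. (norm (Du x))\<^sup>2)"
    using R C1_compactD[OF u] by (intro integrable_continuous_compact_support[where R=R] continuous_intros) auto
  show iu: "integrable lborel (\<lambda>x. (u x)\<^sup>2 / (r 3 x + c))"
    using R C1_compactD[OF u] ne by (intro integrable_continuous_compact_support[where R=R] continuous_intros) auto
  define K where "K x = (1 / (r 3 x + c)) * (((2 * u x) *\<^sub>R Du x) \<bullet> P 3 x)
    + (u x)\<^sup>2 * (2 * (- 1 / (r 3 x + c)\<^sup>2) * r 3 x + real 3 * (1 / (r 3 x + c)))" for x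
  have K: "has_bochner_integral lborel K 0"
    unfolding K_def
  proof (rule integral_field_by_parts[OF C1_compact_power2[OF u], where h = "\<lambda>t. 1 / (t + c)" and h' = "\<lambda>t. - 1 / (t + c)\<^sup>2"])
    show "3 \<le> n" by (rule n3)
    show "((\<lambda>t. 1 / (t + c)) has_real_derivative - 1 / (t + c)\<^sup>2) (at t)" if "0 \<le> t" for t
      using that c by (auto intro!: derivative_eq_intros simp: power2_eq_square)
    show "continuous_on {0..} (\<lambda>t. - 1 / (t + c)\<^sup>2)" using c by (intro continuous_intros) auto
  qed
  have le: "(u x)\<^sup>2 / (r 3 x + c) \<le> K x + (u x)\<^sup>2 / (r 3 x + c) / 2 + 2 * (norm (Du x))\<^sup>2" for x
  proof -
    define q where "q = r 3 x + c"
    have q: "q > 0" using pos by (simp add: q_def)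
    have rq: "r 3 x \<le> q" using c by (simp add: q_def)
    have "norm (P 3 x) \<le> sqrt q" using rq by (simp add: r_def real_le_rsqrt)
    moreover have "\<bar>Du x \<bullet> P 3 x\<bar> \<le> norm (Du x) * norm (P 3 x)" by (rule Cauchy_Schwarz_ineq2)
    ultimately have "\<bar>Du x \<bullet> P 3 x\<bar> \<le> norm (Du x) * sqrt q"
      by (meson mult_left_mono norm_ge_zero order_trans)
    then have "\<bar>u x * (Du x \<bullet> P 3 x)\<bar> \<le> \<bar>u x\<bar> * (norm (Du x) * sqrt q)"
      by (simp add: abs_mult mult_left_mono)
    also have "2 * \<dots> \<le> (u x)\<^sup>2 / 2 + 2 * ((norm (Du x))\<^sup>2 * q)"
    proof -
      have "0 \<le> (\<bar>u x\<bar> / 2 - norm (Du x) * sqrt q)\<^sup>2" by simp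
      also have "\<dots> = (u x)\<^sup>2 / 4 - \<bar>u x\<bar> * (norm (Du x) * sqrt q) + (norm (Du x))\<^sup>2 * q"
        using q by (simp add: power2_diff power_mult_distrib power_divide)
      finally show ?thesis by simp
    qed
    finally have "\<bar>2 * (u x * (Du x \<bullet> P 3 x))\<bar> \<le> (u x)\<^sup>2 / 2 + 2 * ((norm (Du x))\<^sup>2 * q)" by (simp add: abs_mult)
    then have "- (2 * (u x * (Du x \<bullet> P 3 x))) / q \<le> ((u x)\<^sup>2 / 2 + 2 * ((norm (Du x))\<^sup>2 * q)) / q"
      using q by (intro divide_right_mono) auto
    then have A: "- (1 / q * (2 * (u x * (Du x \<bullet> P 3 x)))) \<le> (u x)\<^sup>2 / q / 2 + 2 * (norm (Du x))\<^sup>2"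
      using q by (simp add: field_simps)
    have "1 / q \<le> 3 / q - 2 * r 3 x / q\<^sup>2"
      using q rq by (simp add: field_simps power2_eq_square)
    then have "(u x)\<^sup>2 * (1 / q) \<le> (u x)\<^sup>2 * (3 / q - 2 * r 3 x / q\<^sup>2)" by (intro mult_left_mono) auto
    then show ?thesis using A unfolding K_def q_def[symmetric] by (simp add: algebra_simps)
  qed
  define U where "U x = (u x)\<^sup>2 / (r 3 x + c)" for x
  have iU: "integrable lborel U" using iu by (simp add: U_def[abs_def])
  have "(LINT x|lborel. U x) \<le> (LINT x|lborel. K x + U x / 2 + 2 * (norm (Du x))\<^sup>2)"
    using iU iD K le by (intro integral_mono) (auto simp: has_bochner_integral_iff U_def[symmetric])
  also have "\<dots> = 0 + (LINT x|lborel. U x) / 2 + 2 * (LINT x|lborel. (norm (Du x))\<^sup>2)"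
    using iU iD K by (simp add: has_bochner_integral_iff)
  finally have "(LINT x|lborel. U x) \<le> 4 * (LINT x|lborel. (norm (Du x))\<^sup>2)" by simp
  then show "(LINT x|lborel. (u x)\<^sup>2 / (r 3 x + c)) \<le> 4 * (LINT x|lborel. (norm (Du x))\<^sup>2)" by (simp add: U_def)
qed

text \<open>Fatou's lemma as c tends to 0, with the bound uniform in c; on X_3 = 0 the quotient is 0
  by convention. This function is the integrable majorant for letting the regularization tend to 0
  when u is fixed.\<close>

lemma hardy_integrable:
  assumes u: "C1_compact u Du"
  shows "integrable lborel (\<lambda>x. (u x)\<^sup>2 / r 3 x)"
proof (rule integrableI_nonneg)
  have [measurable]: "u \<in> borel_measurable borel" using C1_compactD[OF u] by simp
  show "(\<lambda>x. (u x)\<^sup>2 / r 3 x) \<in> borel_measurable lborel" by measurable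
  define f where "f k x = ennreal ((u x)\<^sup>2 / (r 3 x + 1 / real (Suc k)))" for k x
  have pt: "ennreal ((u x)\<^sup>2 / r 3 x) \<le> liminf (\<lambda>k. f k x)" for x
  proof (cases "r 3 x = 0")
    case False
    have "(\<lambda>k. (u x)\<^sup>2 / (r 3 x + 1 / real (Suc k))) \<longlonglongrightarrow> (u x)\<^sup>2 / (r 3 x + 0)"
      using False LIMSEQ_inverse_real_of_nat by (intro tendsto_intros) (auto simp: inverse_eq_divide)
    then have "(\<lambda>k. f k x) \<longlonglongrightarrow> ennreal ((u x)\<^sup>2 / r 3 x)"
      unfolding f_def by (intro tendsto_ennrealI) simp
    then show ?thesis using lim_imp_Liminf[of sequentially "\<lambda>k. f k x"] by simp
  qed simp
  have fk: "(\<integral>\<^sup>+x. f k x \<partial>lborel) \<le> ennreal (4 * (LINT x|lborel. (norm (Du x))\<^sup>2))" for k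
  proof -
    have c: "1 / real (Suc k) > 0" by simp
    have "(\<integral>\<^sup>+x. f k x \<partial>lborel) = ennreal (LINT x|lborel. (u x)\<^sup>2 / (r 3 x + 1 / real (Suc k)))"
      unfolding f_def using hardy_regularized(2)[OF u c] by (intro nn_integral_eq_integral) auto
    then show ?thesis using hardy_regularized(1)[OF u c] by (simp add: ennreal_leI)
  qed
  have "(\<integral>\<^sup>+x. ennreal ((u x)\<^sup>2 / r 3 x) \<partial>lborel) \<le> (\<integral>\<^sup>+x. liminf (\<lambda>k. f k x) \<partial>lborel)"
    by (intro nn_integral_mono pt)
  also have "\<dots> \<le> liminf (\<lambda>k. \<integral>\<^sup>+x. f k x \<partial>lborel)"
    by (rule nn_integral_liminf) (simp add: f_def)
  also have "\<dots> \<le> ennreal (4 * (LINT x|lborel. (norm (Du x))\<^sup>2))"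
    by (rule Liminf_le) (auto simp: fk)
  finally show "(\<integral>\<^sup>+x. ennreal ((u x)\<^sup>2 / r 3 x) \<partial>lborel) < \<infinity>" by (simp add: le_less_trans)
qed auto

end


section \<open>The regularized logarithmic gradient of the ground state and its potential\<close>

context ordered_coords
begin

definition q :: "(nat \<Rightarrow> real) \<Rightarrow> nat \<Rightarrow> real ^ 'n \<Rightarrow> real" where
  "q c m x = r m x + c m"

definition T :: "(nat \<Rightarrow> real) \<Rightarrow> (nat \<Rightarrow> real) \<Rightarrow> real ^ 'n \<Rightarrow> real ^ 'n" where
  "T a c x = (\<Sum>m=3..n. (a m / q c m x) *\<^sub>R P m x)"

text \<open>The first sum is div T and the double sum is |T|^2, because X_k and X_m have inner
  product |X_min(k,m)|^2.\<close>

definition Z :: "(nat \<Rightarrow> real) \<Rightarrow> (nat \<Rightarrow> real) \<Rightarrow> real ^ 'n \<Rightarrow> real" where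
  "Z a c x = (\<Sum>m=3..n. a m * (real m / q c m x - 2 * r m x / (q c m x)\<^sup>2))
     + (\<Sum>k=3..n. \<Sum>m=3..n. a k * a m * (r (min k m) x / (q c k x * q c m x)))"

lemma q_pos: "c m > 0 \<Longrightarrow> q c m x > 0"
  unfolding q_def using r_nonneg[of m x] by linarith

lemma q_continuous [continuous_intros]: "continuous_on S f \<Longrightarrow> continuous_on S (\<lambda>x. q c m (f x))"
  unfolding q_def by (intro continuous_intros)

lemma T_continuous:
  assumes "\<And>m. m \<in> {3..n} \<Longrightarrow> c m > 0"
  shows "continuous_on UNIV (T a c)"
proof -
  have "q c m x \<noteq> 0" if "m \<in> {3..n}" for m x using q_pos[of c m x] assms[OF that] by simp
  then show ?thesis unfolding T_def by (intro continuous_intros) auto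
qed

lemma Z_continuous:
  assumes "\<And>m. m \<in> {3..n} \<Longrightarrow> c m > 0"
  shows "continuous_on UNIV (Z a c)"
proof -
  have "q c m x \<noteq> 0" if "m \<in> {3..n}" for m x using q_pos[of c m x] assms[OF that] by simp
  then show ?thesis unfolding Z_def by (intro continuous_intros) auto
qed

lemma inner_T: "y \<bullet> T a c x = (\<Sum>m=3..n. a m / q c m x * (y \<bullet> P m x))"
  by (simp add: T_def inner_sum_right)

lemma norm_T_power2: "(norm (T a c x))\<^sup>2 = (\<Sum>k=3..n. \<Sum>m=3..n. a k * a m * (r (min k m) x / (q c k x * q c m x)))"
proof -
  have "(norm (T a c x))\<^sup>2 = T a c x \<bullet> T a c x" by (rule power2_norm_eq_inner)
  also have "\<dots> = (\<Sum>m=3..n. a m / q c m x * (\<Sum>k=3..n. a k / q c k x * r (min m k) x))"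
    by (subst inner_T, intro sum.cong) (auto simp: inner_commute[of "T a c x"] inner_T inner_P_P)
  also have "\<dots> = (\<Sum>k=3..n. \<Sum>m=3..n. a k * a m * (r (min k m) x / (q c k x * q c m x)))"
    by (simp add: sum_distrib_left mult_ac)
  finally show ?thesis .
qed

text \<open>
  \<open>T\<close> is the logarithmic gradient of \<open>\<phi> = \<Prod> (|X\<^sub>m|\<^sup>2 + c\<^sub>m) powr (a\<^sub>m / 2)\<close> and \<open>Z\<close> is
  \<open>\<Delta>\<phi> / \<phi>\<close>, so this is the ground state transformation with \<open>\<phi> \<nabla>(u / \<phi>) = \<nabla>u - u T\<close>.
\<close>
lemma energy_identity:
  assumes u: "C1_compact u Du" and c: "\<And>m. m \<in> {3..n} \<Longrightarrow> c m > 0"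
  shows "integrable lborel (\<lambda>x. (norm (Du x - u x *\<^sub>R T a c x))\<^sup>2)" (is ?A)
    and "integrable lborel (\<lambda>x. (u x)\<^sup>2 * Z a c x)" (is ?B)
    and "(LINT x|lborel. (norm (Du x - u x *\<^sub>R T a c x))\<^sup>2)
      = (LINT x|lborel. (norm (Du x))\<^sup>2) + (LINT x|lborel. (u x)\<^sup>2 * Z a c x)" (is ?C)
proof -
  obtain R where R: "R > 0" "\<And>x. R < norm x \<Longrightarrow> u x = 0" "\<And>x. R < norm x \<Longrightarrow> Du x = 0"
    using C1_compact_bound[OF u] by metis
  have iD: "integrable lborel (\<lambda>x. (norm (Du x))\<^sup>2)"
    using R C1_compactD[OF u] by (intro integrable_continuous_compact_support[where R=R] continuous_intros) auto
  show iZ: ?B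
    using R C1_compactD[OF u] c
    by (intro integrable_continuous_compact_support[where R=R] continuous_intros Z_continuous) auto
  show iT: ?A
    using R C1_compactD[OF u] c
    by (intro integrable_continuous_compact_support[where R=R] continuous_intros T_continuous) auto
  \<comment> \<open>\<open>K m\<close> is the divergence of u^2 X_m / q_m and integrates to 0. The
    combination with coefficients \<open>a m\<close> is div (u^2 T), which is precisely what
    separates |Du - u T|^2 from |Du|^2 + u^2 Z.\<close>
  define K where "K m x = (1 / q c m x) * (((2 * u x) *\<^sub>R Du x) \<bullet> P m x)
    + (u x)\<^sup>2 * (2 * (- 1 / (q c m x)\<^sup>2) * r m x + real m * (1 / q c m x))" for m x
  have K: "has_bochner_integral lborel (K m) 0" if m: "m \<in> {3..n}" for m
    unfolding K_def q_def
  proof (rule integral_field_by_parts[OF C1_compact_power2[OF u], where h = "\<lambda>t. 1 / (t + c m)" and h' = "\<lambda>t. - 1 / (t + c m)\<^sup>2"])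
    show "m \<le> n" using m by simp
    show "((\<lambda>t. 1 / (t + c m)) has_real_derivative - 1 / (t + c m)\<^sup>2) (at t)" if "0 \<le> t" for t
      using that c[OF m] by (auto intro!: derivative_eq_intros simp: power2_eq_square)
    show "continuous_on {0..} (\<lambda>t. - 1 / (t + c m)\<^sup>2)" using c[OF m] by (intro continuous_intros) auto
  qed
  have "has_bochner_integral lborel (\<lambda>x. \<Sum>m=3..n. a m * K m x) (\<Sum>m=3..n. a m * 0)"
    by (intro has_bochner_integral_sum has_bochner_integral_mult_right K) auto
  then have K0: "has_bochner_integral lborel (\<lambda>x. \<Sum>m=3..n. a m * K m x) 0" by simp
  have pt: "(norm (Du x - u x *\<^sub>R T a c x))\<^sup>2 = (norm (Du x))\<^sup>2 + (u x)\<^sup>2 * Z a c x - (\<Sum>m=3..n. a m * K m x)" for x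
  proof -
    have "(\<Sum>m=3..n. a m * K m x) = (\<Sum>m=3..n. 2 * u x * (a m / q c m x * (Du x \<bullet> P m x)))
      + (\<Sum>m=3..n. (u x)\<^sup>2 * (a m * (real m / q c m x - 2 * r m x / (q c m x)\<^sup>2)))"
      unfolding sum.distrib[symmetric] by (intro sum.cong) (auto simp: K_def algebra_simps)
    also have "\<dots> = 2 * u x * (Du x \<bullet> T a c x) + (u x)\<^sup>2 * (Z a c x - (norm (T a c x))\<^sup>2)"
      by (simp add: inner_T Z_def norm_T_power2 sum_distrib_left)
    finally have "(\<Sum>m=3..n. a m * K m x) = 2 * u x * (Du x \<bullet> T a c x) + (u x)\<^sup>2 * (Z a c x - (norm (T a c x))\<^sup>2)" .
    moreover have "(norm (Du x - u x *\<^sub>R T a c x))\<^sup>2 = (norm (Du x))\<^sup>2 - 2 * u x * (Du x \<bullet> T a c x) + (u x)\<^sup>2 * (norm (T a c x))\<^sup>2"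
      unfolding power2_norm_eq_inner
      by (simp add: inner_diff_left inner_diff_right inner_commute[of "T a c x" "Du x"] power2_eq_square algebra_simps)
    ultimately show ?thesis by (simp add: algebra_simps)
  qed
  show ?C unfolding pt using iD iZ K0 by (simp add: has_bochner_integral_iff)
qed

text \<open>Every term has one net factor 1 / q_m, since |X_m|^2 / q_m <= 1, and q_m >= |X_m|^2 >=
  |X_3|^2. The bound is uniform in c, so together with the Hardy inequality it gives dominated
  convergence.\<close>

lemma Z_bound:
  assumes x: "r 3 x > 0" and c: "\<And>m. m \<in> {3..n} \<Longrightarrow> c m \<ge> 0"
  shows "\<bar>Z a c x\<bar> \<le> ((\<Sum>m=3..n. \<bar>a m\<bar> * (real n + 2)) + (\<Sum>m=3..n. \<bar>a m\<bar>)\<^sup>2) / r 3 x"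
proof -
  have r3: "r 3 x \<le> r m x" if "m \<in> {3..n}" for m using that by (intro r_mono) auto
  have rq: "r m x \<le> q c m x" if "m \<in> {3..n}" for m using c[OF that] by (simp add: q_def)
  have 1: "\<bar>a m * (real m / q c m x - 2 * r m x / (q c m x)\<^sup>2)\<bar> \<le> \<bar>a m\<bar> * (real n + 2) / r 3 x" if m: "m \<in> {3..n}" for m
  proof -
    have q: "q c m x \<ge> r 3 x" "q c m x > 0" using r3[OF m] rq[OF m] x by linarith+
    have "\<bar>real m / q c m x - 2 * r m x / (q c m x)\<^sup>2\<bar> \<le> real m / q c m x + 2 * r m x / (q c m x)\<^sup>2"
      using q by (intro order.trans[OF abs_triangle_ineq4]) auto
    also have "2 * r m x / (q c m x)\<^sup>2 \<le> 2 / q c m x"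
      using q rq[OF m] by (simp add: field_simps power2_eq_square)
    also have "real m / q c m x + 2 / q c m x \<le> (real n + 2) / r 3 x"
      using q x m by (subst add_divide_distrib[symmetric], intro frac_le) auto
    finally show ?thesis by (simp add: abs_mult mult_left_mono flip: times_divide_eq_right)
  qed
  have 2: "\<bar>a k * a m * (r (min k m) x / (q c k x * q c m x))\<bar> \<le> \<bar>a k\<bar> * \<bar>a m\<bar> / r 3 x"
    if k: "k \<in> {3..n}" and m: "m \<in> {3..n}" for k m
  proof -
    have q: "q c m x \<ge> r 3 x" "q c k x \<ge> r 3 x" using r3[OF m] rq[OF m] r3[OF k] rq[OF k] x by linarith+
    have qp: "q c m x > 0" "q c k x > 0" using q x by linarith+
    have "r (min k m) x / (q c k x * q c m x) \<le> 1 / r 3 x"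
    proof (cases "k \<le> m")
      case True
      have "r k x / (q c k x * q c m x) \<le> q c k x / (q c k x * q c m x)"
        using rq[OF k] qp by (intro divide_right_mono) auto
      also have "\<dots> = 1 / q c m x" using qp by simp
      also have "\<dots> \<le> 1 / r 3 x" using q x by (intro frac_le) auto
      finally show ?thesis using True by (simp add: min_def)
    next
      case False
      have "r m x / (q c k x * q c m x) \<le> q c m x / (q c k x * q c m x)"
        using rq[OF m] qp by (intro divide_right_mono) auto
      also have "\<dots> = 1 / q c k x" using qp by simp
      also have "\<dots> \<le> 1 / r 3 x" using q x by (intro frac_le) auto
      finally show ?thesis using False by (simp add: min_def)
    qed
    then have "\<bar>a k\<bar> * \<bar>a m\<bar> * (r (min k m) x / (q c k x * q c m x)) \<le> \<bar>a k\<bar> * \<bar>a m\<bar> * (1 / r 3 x)"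
      by (intro mult_left_mono) auto
    then show ?thesis using qp by (simp add: abs_mult)
  qed
  have "\<bar>Z a c x\<bar> \<le> (\<Sum>m=3..n. \<bar>a m * (real m / q c m x - 2 * r m x / (q c m x)\<^sup>2)\<bar>)
     + (\<Sum>k=3..n. \<Sum>m=3..n. \<bar>a k * a m * (r (min k m) x / (q c k x * q c m x))\<bar>)"
    unfolding Z_def by (intro order.trans[OF abs_triangle_ineq] add_mono sum_abs order.trans[OF sum_abs] sum_mono)
  also have "\<dots> \<le> (\<Sum>m=3..n. \<bar>a m\<bar> * (real n + 2) / r 3 x) + (\<Sum>k=3..n. \<Sum>m=3..n. \<bar>a k\<bar> * \<bar>a m\<bar> / r 3 x)"
    by (intro add_mono sum_mono 1 2) auto
  also have "\<dots> = ((\<Sum>m=3..n. \<bar>a m\<bar> * (real n + 2)) + (\<Sum>m=3..n. \<bar>a m\<bar>)\<^sup>2) / r 3 x"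
    by (simp add: power2_eq_square sum_product sum_divide_distrib add_divide_distrib)
  finally show ?thesis .
qed

text \<open>This is where the choice of \<open>a\<close> comes from. Passing to a new level N adds
  a_N y_N (N - 2 + a_N + 2 (a_3 + ... + a_(N-1))). By the partial sum formula the bracket is A_N +
  A_(N-1) + 1/2, while a_N = A_N - (A_(N-1) + 1/2), so the product is a difference of
  squares.\<close>

lemma potential_algebra:
  fixes A a y :: "nat \<Rightarrow> real"
  assumes A2: "A 2 = 0" and a: "\<And>m. a m = A m - A (m - 1) - 1 / 2"
  shows "(\<Sum>m=3..2+j. a m) = A (2 + j) - real j / 2"
    and "(\<Sum>m=3..2+j. a m * (real m - 2) * y m) + (\<Sum>k=3..2+j. \<Sum>m=3..2+j. a k * a m * y (max k m))
      = (\<Sum>m=3..2+j. ((A m)\<^sup>2 - (A (m - 1) + 1 / 2)\<^sup>2) * y m)"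
proof (induction j)
  case 0
  show "(\<Sum>m=3..2+0. a m) = A (2 + 0) - real 0 / 2" using A2 by simp
  show "(\<Sum>m=3..2+0. a m * (real m - 2) * y m) + (\<Sum>k=3..2+0. \<Sum>m=3..2+0. a k * a m * y (max k m))
      = (\<Sum>m=3..2+0. ((A m)\<^sup>2 - (A (m - 1) + 1 / 2)\<^sup>2) * y m)" by simp
next
  case (Suc j)
  let ?N = "3 + j"
  have set: "{3..2 + Suc j} = insert ?N {3..2 + j}" by auto
  have fin: "finite {3..2 + j}" "?N \<notin> {3..2 + j}" by auto
  show "(\<Sum>m=3..2+Suc j. a m) = A (2 + Suc j) - real (Suc j) / 2"
    unfolding set sum.insert[OF fin] Suc(1) by (simp add: a add.commute numeral_eq_Suc field_simps)
  have max: "max ?N m = ?N" "max m ?N = ?N" if "m \<in> {3..2 + j}" for m using that by auto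
  have S: "(\<Sum>m=3..2+j. a ?N * a m * y (max ?N m)) = a ?N * y ?N * (A (2 + j) - real j / 2)"
    unfolding Suc(1)[symmetric] sum_distrib_left using max by (intro sum.cong) auto
  have S': "(\<Sum>m=3..2+j. a m * a ?N * y (max m ?N)) = a ?N * y ?N * (A (2 + j) - real j / 2)"
    unfolding Suc(1)[symmetric] sum_distrib_left using max by (intro sum.cong) auto
  have aN: "a ?N = A ?N - A (2 + j) - 1 / 2" by (simp add: a numeral_eq_Suc)
  have "(\<Sum>k=3..2+Suc j. \<Sum>m=3..2+Suc j. a k * a m * y (max k m))
    = a ?N * a ?N * y ?N + a ?N * y ?N * (A (2 + j) - real j / 2) + (a ?N * y ?N * (A (2 + j) - real j / 2)
      + (\<Sum>k=3..2+j. \<Sum>m=3..2+j. a k * a m * y (max k m)))"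
    unfolding set sum.insert[OF fin] sum.distrib S S' by simp
  then have "(\<Sum>m=3..2+Suc j. a m * (real m - 2) * y m) + (\<Sum>k=3..2+Suc j. \<Sum>m=3..2+Suc j. a k * a m * y (max k m))
    = a ?N * (real ?N - 2) * y ?N + a ?N * a ?N * y ?N + 2 * a ?N * y ?N * (A (2 + j) - real j / 2)
      + (\<Sum>m=3..2+j. ((A m)\<^sup>2 - (A (m - 1) + 1 / 2)\<^sup>2) * y m)"
    unfolding Suc(2)[symmetric] unfolding set sum.insert[OF fin] by (simp add: algebra_simps)
  also have "a ?N * (real ?N - 2) * y ?N + a ?N * a ?N * y ?N + 2 * a ?N * y ?N * (A (2 + j) - real j / 2)
    = a ?N * (A ?N + A (2 + j) + 1 / 2) * y ?N"
  proof -
    have "t * (real ?N - 2) * Y + t * t * Y + 2 * t * Y * (w - real j / 2) = t * (s + w + 1 / 2) * Y"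
      if "t = s - w - 1 / 2" for t s w Y :: real
      unfolding that by (simp add: field_simps)
    from this[OF aN] show ?thesis .
  qed
  also have "a ?N * (A ?N + A (2 + j) + 1 / 2) = (A ?N)\<^sup>2 - (A (?N - 1) + 1 / 2)\<^sup>2"
  proof -
    have "t * (s + w + 1 / 2) = s\<^sup>2 - (w + 1 / 2)\<^sup>2" if "t = s - w - 1 / 2" for t s w :: real
      unfolding that by (simp add: field_simps power2_eq_square)
    moreover have "?N - 1 = 2 + j" by simp
    ultimately show ?thesis using aN by metis
  qed
  finally show "(\<Sum>m=3..2+Suc j. a m * (real m - 2) * y m) + (\<Sum>k=3..2+Suc j. \<Sum>m=3..2+Suc j. a k * a m * y (max k m))
      = (\<Sum>m=3..2+Suc j. ((A m)\<^sup>2 - (A (m - 1) + 1 / 2)\<^sup>2) * y m)"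
    unfolding set sum.insert[OF fin] .
qed

text \<open>Without regularization |X_min(k,m)|^2 / (|X_k|^2 |X_m|^2) is 1 / |X_max(k,m)|^2 and the
  divergence part of level m becomes (m - 2) / |X_m|^2, which is the shape treated by
  \<open>potential_algebra\<close>. The limit is minus the potential.\<close>

lemma Z_limit:
  fixes A a :: "nat \<Rightarrow> real" and c :: "nat \<Rightarrow> nat \<Rightarrow> real"
  assumes A2: "A 2 = 0" and a: "\<And>m. a m = A m - A (m - 1) - 1 / 2"
    and c: "\<And>m. m \<in> {3..n} \<Longrightarrow> (\<lambda>j. c j m) \<longlonglongrightarrow> 0" and x: "r 3 x > 0"
  shows "(\<lambda>j. Z a (c j) x) \<longlonglongrightarrow> (\<Sum>m=3..n. ((A m)\<^sup>2 - (A (m - 1) + 1 / 2)\<^sup>2) / r m x)"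
proof -
  have r0: "r m x > 0" if "m \<in> {3..n}" for m using r_mono[of 3 m x] that x by simp
  have ql: "(\<lambda>j. q (c j) m x) \<longlonglongrightarrow> r m x" if "m \<in> {3..n}" for m
    unfolding q_def using tendsto_add[OF tendsto_const c[OF that], of "r m x"] by simp
  have rne: "r m x \<noteq> 0" if "m \<in> {3..n}" for m using r0[OF that] by simp
  have "(\<lambda>j. Z a (c j) x) \<longlonglongrightarrow> (\<Sum>m=3..n. a m * (real m / r m x - 2 * r m x / (r m x)\<^sup>2))
     + (\<Sum>k=3..n. \<Sum>m=3..n. a k * a m * (r (min k m) x / (r k x * r m x)))"
    unfolding Z_def by (intro tendsto_intros ql) (auto simp: rne)
  also have "(\<Sum>m=3..n. a m * (real m / r m x - 2 * r m x / (r m x)\<^sup>2)) = (\<Sum>m=3..n. a m * (real m - 2) * (1 / r m x))"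
    using rne by (intro sum.cong refl) (simp add: power2_eq_square diff_divide_distrib algebra_simps)
  also have "(\<Sum>k=3..n. \<Sum>m=3..n. a k * a m * (r (min k m) x / (r k x * r m x)))
      = (\<Sum>k=3..n. \<Sum>m=3..n. a k * a m * (1 / r (max k m) x))"
    using rne by (intro sum.cong refl) (auto simp: min_def max_def)
  also have "(\<Sum>m=3..n. a m * (real m - 2) * (1 / r m x)) + (\<Sum>k=3..n. \<Sum>m=3..n. a k * a m * (1 / r (max k m) x))
      = (\<Sum>m=3..n. ((A m)\<^sup>2 - (A (m - 1) + 1 / 2)\<^sup>2) * (1 / r m x))"
  proof -
    have n2: "2 + (n - 2) = n" using n3 by simp
    show ?thesis
      by (rule potential_algebra(2)[OF A2 a, where j = "n - 2" and y = "\<lambda>m. 1 / r m x", unfolded n2])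
  qed
  finally show ?thesis by simp
qed

end


subsection \<open>The weighted L1 estimate\<close>

lemma sum_powers_le:
  fixes x :: real
  assumes "0 \<le> x" "x < 1" "finite J" "0 \<notin> J"
  shows "(\<Sum>j\<in>J. x ^ j) \<le> x / (1 - x)"
proof -
  have "(\<Sum>j\<in>insert 0 J. x ^ j) \<le> (\<Sum>j. x ^ j)"
    using assms by (intro sum_le_suminf summable_geometric) auto
  also have "\<dots> = 1 / (1 - x)" using assms by (intro suminf_geometric) simp
  finally have "1 + (\<Sum>j\<in>J. x ^ j) \<le> 1 / (1 - x)" using assms by simp
  then show ?thesis using assms by (simp add: field_simps)
qed

text \<open>On either side of k the distances are distinct positive integers, so each side is part
  of a geometric series with sum 1 / (L - 1).\<close>

lemma sum_abs_diff_powers_le: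
  fixes L :: real
  assumes L: "L \<ge> 2"
  shows "(\<Sum>m\<in>{a..b}-{k}. (1 / L) ^ (if k < m then m - k else k - m)) \<le> 2 / (L - 1)"
proof -
  define U where "U = {m \<in> {a..b}. k < m}"
  define V where "V = {m \<in> {a..b}. m < k}"
  define f where "f m = (1 / L) ^ (if k < m then m - k else k - m)" for m
  have e: "1 / L / (1 - 1 / L) = 1 / (L - 1)" using L by (simp add: divide_simps)
  have UV: "{a..b} - {k} = U \<union> V" by (auto simp: U_def V_def)
  have "sum f U = (\<Sum>j\<in>(\<lambda>m. m - k) ` U. (1 / L) ^ j)"
    by (subst sum.reindex) (auto simp: inj_on_def U_def f_def)
  also have "\<dots> \<le> 1 / L / (1 - 1 / L)"
    using L by (intro sum_powers_le) (auto simp: U_def)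
  finally have 1: "sum f U \<le> 1 / (L - 1)" by (simp only: e)
  have "sum f V = (\<Sum>j\<in>(\<lambda>m. k - m) ` V. (1 / L) ^ j)"
    by (subst sum.reindex) (auto simp: inj_on_def V_def f_def)
  also have "\<dots> \<le> 1 / L / (1 - 1 / L)"
    using L by (intro sum_powers_le) (auto simp: V_def)
  finally have 2: "sum f V \<le> 1 / (L - 1)" by (simp only: e)
  have "sum f ({a..b} - {k}) = sum f U + sum f V"
    unfolding UV by (intro sum.union_disjoint) (auto simp: U_def V_def)
  also have "\<dots> \<le> 1 / (L - 1) + 1 / (L - 1)" using 1 2 by (rule add_mono)
  also have "\<dots> = 2 / (L - 1)" by (simp only: add_divide_distrib[symmetric] one_add_one)
  finally show ?thesis by (simp only: f_def[abs_def])
qed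

section \<open>The bounded vector field built from the X_m / sqrt q_m\<close>

context ordered_coords
begin

text \<open>The left-hand side is the inner product of T and X_m. A level k < m contributes
  \<sigma>_k up to the error c_k / q_k, and a level k > m contributes only the error |X_m|^2 / q_k.
  These two kinds of error are the cross terms to be controlled.\<close>

lemma min_div_q_eq:
  assumes m: "m \<in> {3..n}" and q: "\<And>m. m \<in> {3..n} \<Longrightarrow> q c m x > 0"
  shows "(\<Sum>k=3..n. \<sigma> k * (r (min k m) x / q c k x))
    = (\<Sum>k=3..<m. \<sigma> k) + \<sigma> m * (1 - c m / q c m x)
      - (\<Sum>k=3..<m. \<sigma> k * (c k / q c k x)) + (\<Sum>k\<in>{m<..n}. \<sigma> k * (r m x / q c k x))"
proof -
  have rk: "r k x / q c k x = 1 - c k / q c k x" if "k \<in> {3..n}" for k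
    using q[OF that] by (simp add: field_simps) (simp add: q_def)
  have set: "{3..n} = insert m ({3..<m} \<union> {m<..n})" using m by auto
  have "(\<Sum>k=3..n. \<sigma> k * (r (min k m) x / q c k x)) = \<sigma> m * (r m x / q c m x)
    + ((\<Sum>k=3..<m. \<sigma> k * (r (min k m) x / q c k x)) + (\<Sum>k\<in>{m<..n}. \<sigma> k * (r (min k m) x / q c k x)))"
    unfolding set by (subst sum.insert, simp, simp, subst sum.union_disjoint) auto
  also have "(\<Sum>k=3..<m. \<sigma> k * (r (min k m) x / q c k x)) = (\<Sum>k=3..<m. \<sigma> k * (1 - c k / q c k x))"
    using m rk by (intro sum.cong refl) (auto simp: min_def)
  also have "(\<Sum>k\<in>{m<..n}. \<sigma> k * (r (min k m) x / q c k x)) = (\<Sum>k\<in>{m<..n}. \<sigma> k * (r m x / q c k x))"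
    by (intro sum.cong) (auto simp: min_def)
  finally show ?thesis using rk[OF m] by (simp add: sum_subtractf algebra_simps)
qed

text \<open>
  The scales \<open>\<surd>c\<^sub>m = \<epsilon> L\<^bsup>2m\<^esup>\<close> and the weights \<open>L\<^bsup>m\<^esup>\<close> are spread out so far that every cross term
  between levels \<open>k \<noteq> m\<close> carries a factor \<open>L\<^bsup>-|m-k|\<^esup>\<close> relative to the diagonal term of level \<open>k\<close>.
\<close>
lemma divergence_lower_bound:
  fixes \<sigma> :: "nat \<Rightarrow> real" and B d L \<epsilon> :: real
  defines "c \<equiv> \<lambda>m. (\<epsilon> * L ^ (2 * m))\<^sup>2"
  assumes \<sigma>: "\<And>m. m \<in> {3..n} \<Longrightarrow> \<bar>\<sigma> m\<bar> \<le> B"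
    and d: "d > 0" "\<And>m. m \<in> {3..n} \<Longrightarrow> d \<le> real m - 1 + (\<Sum>k=3..m. \<sigma> k)"
      "\<And>m. m \<in> {3..n} \<Longrightarrow> d \<le> real m + (\<Sum>k=3..<m. \<sigma> k)"
    and L: "L \<ge> 2" "L \<ge> 1 + 4 * B / d" and \<epsilon>: "\<epsilon> > 0"
  shows "d / 2 / sqrt (q c 3 x) \<le>
    (\<Sum>m=3..n. L ^ m * ((real m - r m x / q c m x + (\<Sum>k=3..n. \<sigma> k * (r (min k m) x / q c k x))) / sqrt (q c m x)))"
proof -
  have c: "c m > 0" for m using L \<epsilon> by (simp add: c_def)
  have q: "q c m x > 0" for m using q_pos[of c m x] c by simp
  define \<rho> where "\<rho> m = sqrt (q c m x)" for m
  have \<rho>: "\<rho> m > 0" for m using q by (simp add: \<rho>_def)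
  have \<rho>2: "q c m x = \<rho> m * \<rho> m" for m using q[of m] by (simp add: \<rho>_def)
  have B: "B \<ge> 0" using \<sigma>[of 3] n3 by auto
  define \<theta> where "\<theta> m = c m / q c m x" for m
  have \<theta>: "0 \<le> \<theta> m" "\<theta> m \<le> 1" for m
    using c[of m] q[of m] by (simp_all add: \<theta>_def divide_le_eq_1_pos less_imp_le) (simp add: q_def)
  \<comment> \<open>The size, up to the factor \<sigma>_k, of the error that level k causes in the
    summand of level m.\<close>
  define w where "w m k = (if k < m then \<theta> k else r m x / q c k x) / \<rho> m" for m k
  have w: "w m k \<ge> 0" for m k using \<theta> \<rho>[of m] q[of k] by (auto simp: w_def less_imp_le)
  have diag: "L ^ m * ((real m - r m x / q c m x + (\<Sum>k=3..n. \<sigma> k * (r (min k m) x / q c k x))) / \<rho> m)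
    \<ge> L ^ m * d / \<rho> m - B * (\<Sum>k\<in>{3..n}-{m}. L ^ m * w m k)" if m: "m \<in> {3..n}" for m
  proof -
    have rm: "r m x / q c m x = 1 - \<theta> m"
      using q[of m] by (simp add: \<theta>_def field_simps) (simp add: q_def)
    have S: "(\<Sum>k=3..m. \<sigma> k) = (\<Sum>k=3..<m. \<sigma> k) + \<sigma> m"
      using m by (subst sum.last_plus) auto
    \<comment> \<open>The two lower bounds on partial sums belong to the regimes |X_m|^2 much larger
      than c_m (\<theta>_m near 0, level m fully active) and much smaller than c_m (\<theta>_m near
      1, level m switched off). The actual value is their convex combination.\<close>
    have "d = (1 - \<theta> m) * d + \<theta> m * d" by (simp add: algebra_simps)
    also have "\<dots> \<le> (1 - \<theta> m) * (real m - 1 + (\<Sum>k=3..m. \<sigma> k)) + \<theta> m * (real m + (\<Sum>k=3..<m. \<sigma> k))"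
      using d m \<theta>[of m] by (intro add_mono mult_left_mono) auto
    also have "\<dots> = real m - (1 - \<theta> m) + (\<Sum>k=3..<m. \<sigma> k) + \<sigma> m * (1 - \<theta> m)"
      unfolding S by (simp add: algebra_simps)
    finally have A: "d \<le> real m - (1 - \<theta> m) + (\<Sum>k=3..<m. \<sigma> k) + \<sigma> m * (1 - \<theta> m)" .
    have E1: "(\<Sum>k=3..<m. \<sigma> k * \<theta> k) \<le> (\<Sum>k=3..<m. B * (w m k * \<rho> m))"
    proof (intro sum_mono)
      fix k assume k: "k \<in> {3..<m}"
      then have "\<sigma> k * \<theta> k \<le> B * \<theta> k" using \<sigma>[of k] \<theta>[of k] m by (intro mult_right_mono) auto
      then show "\<sigma> k * \<theta> k \<le> B * (w m k * \<rho> m)" using k \<rho>[of m] by (simp add: w_def)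
    qed
    have E2: "- (\<Sum>k\<in>{m<..n}. \<sigma> k * (r m x / q c k x)) \<le> (\<Sum>k\<in>{m<..n}. B * (w m k * \<rho> m))"
      unfolding sum_negf[symmetric]
    proof (intro sum_mono)
      fix k assume k: "k \<in> {m<..n}"
      then have "- \<sigma> k * (r m x / q c k x) \<le> B * (r m x / q c k x)" using \<sigma>[of k] q[of k] m by (intro mult_right_mono) auto
      then show "- (\<sigma> k * (r m x / q c k x)) \<le> B * (w m k * \<rho> m)" using k \<rho>[of m] by (simp add: w_def)
    qed
    have set: "{3..n} - {m} = {3..<m} \<union> {m<..n}" using m by auto
    have E: "(\<Sum>k\<in>{3..n}-{m}. B * (w m k * \<rho> m)) = (\<Sum>k=3..<m. B * (w m k * \<rho> m)) + (\<Sum>k\<in>{m<..n}. B * (w m k * \<rho> m))"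
      unfolding set by (intro sum.union_disjoint) auto
    have "real m - r m x / q c m x + (\<Sum>k=3..n. \<sigma> k * (r (min k m) x / q c k x))
      \<ge> d - (\<Sum>k\<in>{3..n}-{m}. B * (w m k * \<rho> m))"
      unfolding min_div_q_eq[OF m q] rm E using A E1 E2 by (simp add: \<theta>_def[symmetric])
    then have "L ^ m * ((real m - r m x / q c m x + (\<Sum>k=3..n. \<sigma> k * (r (min k m) x / q c k x))) / \<rho> m)
      \<ge> L ^ m * ((d - (\<Sum>k\<in>{3..n}-{m}. B * (w m k * \<rho> m))) / \<rho> m)"
      using \<rho>[of m] L by (intro mult_left_mono divide_right_mono) auto
    also have "L ^ m * ((d - (\<Sum>k\<in>{3..n}-{m}. B * (w m k * \<rho> m))) / \<rho> m) = L ^ m * d / \<rho> m - B * (\<Sum>k\<in>{3..n}-{m}. L ^ m * w m k)"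
      using \<rho>[of m] by (simp add: diff_divide_distrib sum_divide_distrib right_diff_distrib sum_distrib_left mult_ac)
    finally show ?thesis .
  qed
  \<comment> \<open>For k < m, \<theta>_k <= sqrt c_k / \<rho>_k and \<rho>_m >= sqrt c_m, so the
    quotient L^(2k) / L^(2m) of the scales outweighs L^m. For k > m, |X_m|^2 <= \<rho>_m \<rho>_k
    leaves L^m / \<rho>_k, and the gain comes from the weights. In both cases the error is charged
    to the diagonal term of level k.\<close>
  have cross: "L ^ m * w m k \<le> L ^ k / \<rho> k * (1 / L) ^ (if k < m then m - k else k - m)" if mk: "m \<noteq> k" for m k
  proof (cases "k < m")
    case True
    have "\<epsilon> * L ^ (2 * k) \<le> \<rho> k" unfolding \<rho>_def using \<epsilon> L by (intro real_le_rsqrt) (simp add: q_def c_def)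
    moreover have "\<epsilon> * L ^ (2 * m) \<le> \<rho> m" unfolding \<rho>_def using \<epsilon> L by (intro real_le_rsqrt) (simp add: q_def c_def)
    moreover have "\<theta> k = ((\<epsilon> * L ^ (2 * k)) / \<rho> k) * ((\<epsilon> * L ^ (2 * k)) / \<rho> k)"
    proof -
      have t: "\<theta> k = c k / (\<rho> k * \<rho> k)" by (simp add: \<theta>_def \<rho>2)
      show ?thesis unfolding t by (simp add: c_def power2_eq_square)
    qed
    moreover have "((\<epsilon> * L ^ (2 * k)) / \<rho> k) * ((\<epsilon> * L ^ (2 * k)) / \<rho> k) \<le> 1 * ((\<epsilon> * L ^ (2 * k)) / \<rho> k)"
      using calculation(1) \<rho>[of k] \<epsilon> L by (intro mult_right_mono) auto
    ultimately have "w m k \<le> ((\<epsilon> * L ^ (2 * k)) / \<rho> k) / (\<epsilon> * L ^ (2 * m))"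
      unfolding w_def using True \<rho>[of m] \<rho>[of k] \<epsilon> L \<theta>[of k] by (simp only: if_True) (intro frac_le, auto)
    also have "\<dots> = L ^ (2 * k) / L ^ (2 * m) / \<rho> k" using \<epsilon> by simp
    finally have "L ^ m * w m k \<le> L ^ m * (L ^ (2 * k) / L ^ (2 * m) / \<rho> k)" using L by (intro mult_left_mono) auto
    also have "\<dots> = L ^ k / \<rho> k * (1 / L) ^ (m - k)"
    proof -
      have "m = k + (m - k)" using True by simp
      then obtain j where m: "m = k + j" by blast
      have eq: "L ^ m * (L ^ (2 * k) / L ^ (2 * m)) = L ^ k * (1 / L) ^ j"
        using L by (simp add: m power_add mult_2 mult_2_right power_divide distrib_left)
      have "L ^ m * (L ^ (2 * k) / L ^ (2 * m) / \<rho> k) = L ^ m * (L ^ (2 * k) / L ^ (2 * m)) / \<rho> k"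
        by (simp only: times_divide_eq_right)
      also have "\<dots> = L ^ k * (1 / L) ^ j / \<rho> k" by (simp only: eq)
      finally show ?thesis by (simp add: m)
    qed
    finally show ?thesis using True by simp
  next
    case False
    then have km: "m < k" using mk by simp
    have cm: "c m \<le> c k" unfolding c_def using \<epsilon> L km by (intro power_mono mult_left_mono power_increasing) auto
    have "r m x \<le> \<rho> m * \<rho> m" using c[of m] by (simp add: \<rho>2[symmetric] q_def)
    moreover have "\<rho> m \<le> \<rho> k" unfolding \<rho>_def q_def using km cm by (intro real_sqrt_le_mono add_mono r_mono) auto
    ultimately have "r m x \<le> \<rho> m * \<rho> k" using \<rho>[of m] by (meson mult_left_mono less_imp_le order_trans)
    then have "w m k \<le> (\<rho> m * \<rho> k) / q c k x / \<rho> m"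
      unfolding w_def using False \<rho>[of m] q[of k]
      by (simp only: if_False) (intro divide_right_mono, auto simp: less_imp_le)
    also have "\<dots> = 1 / \<rho> k" using \<rho>[of m] \<rho>[of k] by (simp add: \<rho>2)
    finally have "L ^ m * w m k \<le> L ^ m * (1 / \<rho> k)" using L by (intro mult_left_mono) auto
    also have "\<dots> = L ^ k / \<rho> k * (1 / L) ^ (k - m)"
    proof -
      have "k = m + (k - m)" using km by simp
      then obtain j where k: "k = m + j" by blast
      have "L ^ k * (1 / L) ^ j = L ^ m" using L by (simp add: k power_add power_divide)
      then show ?thesis by (simp add: k field_simps)
    qed
    finally show ?thesis using False by simp
  qed
  have "(\<Sum>m=3..n. \<Sum>k\<in>{3..n}-{m}. L ^ m * w m k)
    \<le> (\<Sum>m=3..n. \<Sum>k\<in>{3..n}-{m}. L ^ k / \<rho> k * (1 / L) ^ (if k < m then m - k else k - m))"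
    by (intro sum_mono cross) auto
  also have "\<dots> = (\<Sum>k=3..n. \<Sum>m\<in>{3..n}-{k}. L ^ k / \<rho> k * (1 / L) ^ (if k < m then m - k else k - m))"
  proof -
    have e: "(\<Sum>k\<in>{3..n}-{m}. f k) = (\<Sum>k=3..n. if k = m then 0 else f k)" for m and f :: "nat \<Rightarrow> real"
      by (intro sum.mono_neutral_cong_left) auto
    show ?thesis unfolding e by (subst sum.swap) (intro sum.cong refl, auto)
  qed
  also have "\<dots> \<le> (\<Sum>k=3..n. L ^ k / \<rho> k * (2 / (L - 1)))"
    unfolding sum_distrib_left[symmetric] using L \<rho>
    by (intro sum_mono mult_left_mono sum_abs_diff_powers_le) (auto simp: less_imp_le)
  finally have W: "(\<Sum>m=3..n. \<Sum>k\<in>{3..n}-{m}. L ^ m * w m k) \<le> (\<Sum>k=3..n. L ^ k / \<rho> k * (2 / (L - 1)))" .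
  \<comment> \<open>The lower bound 1 + 4 B / d on L is chosen so that the errors charged to a level
    consume at most half of its diagonal term.\<close>
  have Bd: "B * (2 / (L - 1)) \<le> d / 2"
    using L d B by (simp add: field_simps)
  have "d / 2 / \<rho> 3 \<le> L ^ 3 * (d / 2) / \<rho> 3"
    using d \<rho>[of 3] one_le_power[of L 3] L by (intro divide_right_mono) (auto simp: less_imp_le)
  also have "\<dots> \<le> (\<Sum>m=3..n. L ^ m * (d / 2) / \<rho> m)"
    using n3 d L \<rho> by (intro member_le_sum) (auto simp: less_imp_le)
  also have "\<dots> \<le> (\<Sum>m=3..n. L ^ m * d / \<rho> m - L ^ m / \<rho> m * (B * (2 / (L - 1))))"
  proof (intro sum_mono)
    fix m
    have "L ^ m / \<rho> m * (B * (2 / (L - 1))) \<le> L ^ m / \<rho> m * (d / 2)"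
      using Bd L \<rho>[of m] by (intro mult_left_mono) auto
    moreover have "L ^ m * (d / 2) / \<rho> m + L ^ m / \<rho> m * (d / 2) = L ^ m * d / \<rho> m"
      unfolding times_divide_eq_left add_divide_distrib[symmetric] by simp
    ultimately show "L ^ m * (d / 2) / \<rho> m \<le> L ^ m * d / \<rho> m - L ^ m / \<rho> m * (B * (2 / (L - 1)))"
      by (metis add_le_cancel_left le_diff_eq)
  qed
  also have "\<dots> = (\<Sum>m=3..n. L ^ m * d / \<rho> m) - B * (\<Sum>k=3..n. L ^ k / \<rho> k * (2 / (L - 1)))"
    by (simp add: sum_subtractf sum_distrib_left mult_ac)
  also have "\<dots> \<le> (\<Sum>m=3..n. L ^ m * d / \<rho> m) - B * (\<Sum>m=3..n. \<Sum>k\<in>{3..n}-{m}. L ^ m * w m k)"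
    using mult_left_mono[OF W B] by simp
  also have "\<dots> = (\<Sum>m=3..n. L ^ m * d / \<rho> m - B * (\<Sum>k\<in>{3..n}-{m}. L ^ m * w m k))"
    by (simp add: sum_subtractf sum_distrib_left)
  also have "\<dots> \<le> (\<Sum>m=3..n. L ^ m * ((real m - r m x / q c m x + (\<Sum>k=3..n. \<sigma> k * (r (min k m) x / q c k x))) / \<rho> m))"
    by (intro sum_mono diag)
  finally show ?thesis by (simp add: \<rho>_def)
qed

text \<open>Integrating div (f F) for the field F, the sum of L^m X_m / sqrt q_m, whose norm is at
  most the sum of the L^m, bounds the integral of f / sqrt q_3 by that of |Df - f T|. Since |T| <= n
  B / sqrt q_3, the term f T, and with it Df, is controlled as well. The constant is the same for
  all \<epsilon>.\<close>

lemma weighted_L1_gradient_bound: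
  fixes \<sigma> :: "nat \<Rightarrow> real" and B d L \<epsilon> :: real
  defines "c \<equiv> \<lambda>m. (\<epsilon> * L ^ (2 * m))\<^sup>2"
  assumes f: "C1_compact f Df" and f0: "\<And>x. 0 \<le> f x"
    and \<sigma>: "\<And>m. m \<in> {3..n} \<Longrightarrow> \<bar>\<sigma> m\<bar> \<le> B"
    and d: "d > 0" "\<And>m. m \<in> {3..n} \<Longrightarrow> d \<le> real m - 1 + (\<Sum>k=3..m. \<sigma> k)"
      "\<And>m. m \<in> {3..n} \<Longrightarrow> d \<le> real m + (\<Sum>k=3..<m. \<sigma> k)"
    and L: "L \<ge> 2" "L \<ge> 1 + 4 * B / d" and \<epsilon>: "\<epsilon> > 0"
  shows "(LINT x|lborel. norm (Df x))
    \<le> (1 + real n * B * (\<Sum>m=3..n. L ^ m) * (2 / d)) * (LINT x|lborel. norm (Df x - f x *\<^sub>R T \<sigma> c x))"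
proof -
  obtain R where R: "R > 0" "\<And>x. R < norm x \<Longrightarrow> f x = 0" "\<And>x. R < norm x \<Longrightarrow> Df x = 0"
    using C1_compact_bound[OF f] by metis
  have c: "c m > 0" for m using L \<epsilon> by (simp add: c_def)
  have q: "q c m x > 0" for m x using q_pos[of c m x] c by simp
  then have qne: "q c m x \<noteq> 0" for m x by (metis less_irrefl)
  have B: "B \<ge> 0" using \<sigma>[of 3] n3 by auto
  define M where "M = (\<Sum>m=3..n. L ^ m)"
  have M: "M \<ge> 0" unfolding M_def using L by (intro sum_nonneg) auto
  have iD: "integrable lborel (\<lambda>x. norm (Df x))"
    using R C1_compactD[OF f] by (intro integrable_continuous_compact_support[where R=R] continuous_intros) auto
  have iT: "integrable lborel (\<lambda>x. norm (Df x - f x *\<^sub>R T \<sigma> c x))"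
    using R C1_compactD[OF f] c by (intro integrable_continuous_compact_support[where R=R] continuous_intros T_continuous) auto
  have iF: "integrable lborel (\<lambda>x. f x / sqrt (q c 3 x))"
    using R C1_compactD[OF f] qne by (intro integrable_continuous_compact_support[where R=R] continuous_intros) auto
  have nP: "norm (P m x) \<le> sqrt (q c m x)" for m x
    using c[of m] by (intro real_le_rsqrt) (auto simp: q_def r_def)
  define K where "K m x = 1 / sqrt (q c m x) * (Df x \<bullet> P m x)
    + f x * (2 * (- 1 / (2 * (q c m x) * sqrt (q c m x))) * r m x + real m * (1 / sqrt (q c m x)))" for m x
  have K: "has_bochner_integral lborel (K m) 0" if m: "m \<in> {3..n}" for m
    unfolding K_def q_def
  proof (rule integral_field_by_parts[OF f, where h = "\<lambda>t. 1 / sqrt (t + c m)" and h' = "\<lambda>t. - 1 / (2 * (t + c m) * sqrt (t + c m))"])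
    show "m \<le> n" using m by simp
    show "((\<lambda>t. 1 / sqrt (t + c m)) has_real_derivative - 1 / (2 * (t + c m) * sqrt (t + c m))) (at t)" if "0 \<le> t" for t
      using that c[of m] by (auto intro!: derivative_eq_intros simp: field_simps)
    show "continuous_on {0..} (\<lambda>t. - 1 / (2 * (t + c m) * sqrt (t + c m)))"
      using c[of m] by (intro continuous_intros) (auto simp: add_nonneg_eq_0_iff)
  qed
  have "has_bochner_integral lborel (\<lambda>x. \<Sum>m=3..n. L ^ m * K m x) (\<Sum>m=3..n. L ^ m * 0)"
    by (intro has_bochner_integral_sum has_bochner_integral_mult_right K) auto
  then have K0: "has_bochner_integral lborel (\<lambda>x. \<Sum>m=3..n. L ^ m * K m x) 0" by simp
  have pt: "(d / 2) * (f x / sqrt (q c 3 x)) \<le> (\<Sum>m=3..n. L ^ m * K m x) + M * norm (Df x - f x *\<^sub>R T \<sigma> c x)" for x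
  proof -
    let ?D = "Df x - f x *\<^sub>R T \<sigma> c x"
    let ?br = "\<lambda>m. (real m - r m x / q c m x + (\<Sum>k=3..n. \<sigma> k * (r (min k m) x / q c k x))) / sqrt (q c m x)"
    have Km: "K m x = (?D \<bullet> P m x) / sqrt (q c m x) + f x * ?br m" for m
    proof -
      have "T \<sigma> c x \<bullet> P m x = (\<Sum>k=3..n. \<sigma> k * (r (min k m) x / q c k x))"
        by (subst inner_commute, subst inner_T, intro sum.cong) (auto simp: inner_P_P min.commute)
      then have "?D \<bullet> P m x = Df x \<bullet> P m x - f x * (\<Sum>k=3..n. \<sigma> k * (r (min k m) x / q c k x))"
        by (simp add: inner_diff_left)
      moreover have "2 * (- 1 / (2 * (q c m x) * sqrt (q c m x))) * r m x = - (r m x / q c m x / sqrt (q c m x))"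
        by simp
      ultimately show ?thesis unfolding K_def
        by (simp only: diff_divide_distrib add_divide_distrib times_divide_eq_left mult_1 ring_distribs) simp
    qed
    have low: "(?D \<bullet> P m x) / sqrt (q c m x) \<ge> - norm ?D" for m
    proof -
      have "\<bar>?D \<bullet> P m x\<bar> \<le> norm ?D * sqrt (q c m x)"
        using nP[of m x] by (intro order.trans[OF Cauchy_Schwarz_ineq2] mult_left_mono) auto
      then show ?thesis using q[of m x] by (simp add: field_simps abs_le_iff)
    qed
    have "(\<Sum>m=3..n. L ^ m * K m x) = (\<Sum>m=3..n. L ^ m * ((?D \<bullet> P m x) / sqrt (q c m x))) + f x * (\<Sum>m=3..n. L ^ m * ?br m)"
      unfolding Km by (simp add: sum.distrib sum_distrib_left distrib_left mult_ac)
    moreover have "(\<Sum>m=3..n. L ^ m * ((?D \<bullet> P m x) / sqrt (q c m x))) \<ge> (\<Sum>m=3..n. L ^ m * (- norm ?D))"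
      using L low by (intro sum_mono mult_left_mono) auto
    moreover have "(\<Sum>m=3..n. L ^ m * (- norm ?D)) = - (M * norm ?D)" by (simp add: M_def sum_distrib_right sum_negf)
    moreover have "f x * (\<Sum>m=3..n. L ^ m * ?br m) \<ge> f x * (d / 2 / sqrt (q c 3 x))"
      unfolding c_def by (intro mult_left_mono f0 divergence_lower_bound[OF \<sigma> d L \<epsilon>])
    ultimately show ?thesis by (simp add: algebra_simps)
  qed
  define G where "G x = f x / sqrt (q c 3 x)" for x
  define E where "E x = norm (Df x - f x *\<^sub>R T \<sigma> c x)" for x
  define K' where "K' x = (\<Sum>m=3..n. L ^ m * K m x)" for x
  note abb = G_def[symmetric] E_def[symmetric] K'_def[symmetric]
  note iF = iF[unfolded abb] and iT = iT[unfolded abb] and K0 = K0[unfolded abb] and pt = pt[unfolded abb]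
  have "(d / 2) * (LINT x|lborel. G x) = (LINT x|lborel. (d / 2) * G x)" by simp
  also have "\<dots> \<le> (LINT x|lborel. K' x + M * E x)"
    using iF iT K0 pt by (intro integral_mono) (auto simp: has_bochner_integral_iff)
  also have "\<dots> = M * (LINT x|lborel. E x)"
    using iT K0 by (simp add: has_bochner_integral_iff)
  finally have H: "(LINT x|lborel. G x) \<le> M * (2 / d) * (LINT x|lborel. E x)"
    using d by (simp add: field_simps)
  \<comment> \<open>Both |X_m|^2 and c_m increase with m, so sqrt q_3 is the smallest of the
    denominators.\<close>
  have Tb: "norm (T \<sigma> c x) \<le> real n * B / sqrt (q c 3 x)" for x
  proof -
    have "norm (T \<sigma> c x) \<le> (\<Sum>m=3..n. \<bar>\<sigma> m\<bar> / q c m x * norm (P m x))"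
      unfolding T_def using q by (intro order.trans[OF norm_sum]) (auto simp: less_imp_le abs_of_pos intro!: sum_mono)
    also have "\<dots> \<le> (\<Sum>m=3..n. B / sqrt (q c 3 x))"
    proof (intro sum_mono)
      fix m assume m: "m \<in> {3..n}"
      have cm: "c 3 \<le> c m" unfolding c_def using \<epsilon> L m by (intro power_mono mult_left_mono power_increasing) auto
      have q3: "sqrt (q c 3 x) \<le> sqrt (q c m x)" unfolding q_def using m cm by (intro real_sqrt_le_mono add_mono r_mono) auto
      have "\<bar>\<sigma> m\<bar> / q c m x * norm (P m x) \<le> B / q c m x * sqrt (q c m x)"
        using \<sigma>[OF m] nP[of m x] q[of m x] B by (intro mult_mono divide_right_mono) auto
      also have "\<dots> = B / sqrt (q c m x)" using q[of m x] by (simp add: real_div_sqrt field_simps)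
      also have "\<dots> \<le> B / sqrt (q c 3 x)" using q3 q[of 3 x] B by (intro divide_left_mono) auto
      finally show "\<bar>\<sigma> m\<bar> / q c m x * norm (P m x) \<le> B / sqrt (q c 3 x)" .
    qed
    also have "\<dots> = real (n - 2) * (B / sqrt (q c 3 x))" using n3 by simp
    also have "\<dots> \<le> real n * (B / sqrt (q c 3 x))" using B q[of 3 x] by (intro mult_right_mono) auto
    finally show ?thesis by simp
  qed
  have "(LINT x|lborel. norm (Df x)) \<le> (LINT x|lborel. E x + real n * B * G x)"
  proof (intro integral_mono)
    fix x
    have "norm (f x *\<^sub>R T \<sigma> c x) = f x * norm (T \<sigma> c x)" using f0[of x] by simp
    moreover have "f x * norm (T \<sigma> c x) \<le> f x * (real n * B / sqrt (q c 3 x))" by (rule mult_left_mono[OF Tb f0])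
    moreover have "f x * (real n * B / sqrt (q c 3 x)) = real n * B * G x" by (simp add: G_def)
    moreover have "norm (Df x) \<le> E x + norm (f x *\<^sub>R T \<sigma> c x)"
      unfolding E_def using norm_triangle_ineq[of "Df x - f x *\<^sub>R T \<sigma> c x" "f x *\<^sub>R T \<sigma> c x"] by simp
    ultimately show "norm (Df x) \<le> E x + real n * B * G x" by linarith
  qed (use iD iT iF in auto)
  also have "\<dots> = (LINT x|lborel. E x) + real n * B * (LINT x|lborel. G x)"
    using iT iF by simp
  also have "\<dots> \<le> (LINT x|lborel. E x) + real n * B * (M * (2 / d) * (LINT x|lborel. E x))"
    using H B by (intro add_left_mono mult_left_mono) auto
  finally show ?thesis by (simp add: M_def E_def algebra_simps)
qed

end


subsection \<open>The noncritical case\<close>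

lemma abs_powr_tendsto_0: "0 < s \<Longrightarrow> ((\<lambda>y::real. \<bar>y\<bar> powr s) \<longlongrightarrow> 0) (at 0)"
  using tendsto_powr'[of "\<lambda>y::real. \<bar>y\<bar>" 0 "at 0" "\<lambda>_. s" s] by (auto intro!: tendsto_eq_intros)

lemma DERIV_abs_powr:
  fixes p y :: real
  assumes p: "1 < p"
  shows "((\<lambda>y. \<bar>y\<bar> powr p) has_real_derivative p * \<bar>y\<bar> powr (p - 1) * sgn y) (at y)"
proof -
  consider "y > 0" | "y < 0" | "y = 0" by linarith
  then show ?thesis
  proof cases
    case 1
    have "((\<lambda>y. y powr p) has_real_derivative p * \<bar>y\<bar> powr (p - 1) * sgn y) (at y)"
      using 1 by (auto intro!: derivative_eq_intros)
    then show ?thesis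
      by (rule has_field_derivative_transform_within_open[where S = "{0<..}"]) (use 1 in auto)
  next
    case 2
    have "((\<lambda>y. (- y) powr p) has_real_derivative p * \<bar>y\<bar> powr (p - 1) * sgn y) (at y)"
      using 2 by (auto intro!: derivative_eq_intros)
    then show ?thesis
      by (rule has_field_derivative_transform_within_open[where S = "{..<0}"]) (use 2 in auto)
  next
    case 3
    have "((\<lambda>h::real. \<bar>h\<bar> powr p / h) \<longlongrightarrow> 0) (at 0)"
    proof (rule Lim_null_comparison)
      show "((\<lambda>h::real. \<bar>h\<bar> powr (p - 1)) \<longlongrightarrow> 0) (at 0)" using p by (intro abs_powr_tendsto_0) simp
      show "\<forall>\<^sub>F h::real in at 0. norm (\<bar>h\<bar> powr p / h) \<le> \<bar>h\<bar> powr (p - 1)"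
        using eventually_neq_at_within[of 0 0 UNIV]
        by eventually_elim (auto simp: powr_diff)
    qed
    then show ?thesis using 3 by (simp add: DERIV_def)
  qed
qed

lemma continuous_abs_powr_sgn:
  fixes s :: real
  assumes s: "0 < s"
  shows "continuous_on UNIV (\<lambda>y::real. \<bar>y\<bar> powr s * sgn y)"
proof (intro continuous_at_imp_continuous_on ballI)
  fix y :: real
  show "isCont (\<lambda>y::real. \<bar>y\<bar> powr s * sgn y) y"
  proof (cases "y = 0")
    case True
    have "((\<lambda>y::real. \<bar>y\<bar> powr s * sgn y) \<longlongrightarrow> 0) (at 0)"
    proof (rule Lim_null_comparison)
      show "((\<lambda>h::real. \<bar>h\<bar> powr s) \<longlongrightarrow> 0) (at 0)" using s by (rule abs_powr_tendsto_0)
      show "\<forall>\<^sub>F h::real in at 0. norm (\<bar>h\<bar> powr s * sgn h) \<le> \<bar>h\<bar> powr s"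
        by (rule always_eventually) (auto simp: abs_mult sgn_if)
    qed
    then show ?thesis using True by (simp add: isCont_def)
  next
    case False
    then show ?thesis
      unfolding isCont_def
      by (intro tendsto_mult tendsto_powr tendsto_rabs tendsto_sgn tendsto_ident_at tendsto_const) auto
  qed
qed

lemma C1_compact_abs_powr:
  assumes u: "C1_compact u Du" and p: "1 < p"
  shows "C1_compact (\<lambda>x. \<bar>u x\<bar> powr p) (\<lambda>x. (p * (\<bar>u x\<bar> powr (p - 1) * sgn (u x))) *\<^sub>R Du x)"
  unfolding C1_compact_def
proof (intro conjI allI)
  fix x
  show "((\<lambda>x. \<bar>u x\<bar> powr p) has_derivative (\<lambda>v. ((p * (\<bar>u x\<bar> powr (p - 1) * sgn (u x))) *\<^sub>R Du x) \<bullet> v)) (at x)"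
    using has_derivative_compose[OF C1_compactD(1)[OF u, of x] DERIV_abs_powr[OF p, of "u x", unfolded has_field_derivative_def]]
    by (simp add: mult_ac)
next
  show "continuous_on UNIV (\<lambda>x. (p * (\<bar>u x\<bar> powr (p - 1) * sgn (u x))) *\<^sub>R Du x)"
    using p C1_compactD[OF u]
    by (intro continuous_intros continuous_on_compose2[OF continuous_abs_powr_sgn[of "p - 1"], of UNIV u]) auto
  show "\<exists>R. \<forall>x. R < norm x \<longrightarrow> \<bar>u x\<bar> powr p = 0" using u by (auto simp: C1_compact_def)
qed

section \<open>Removing the regularization, and the Hardy-Sobolev estimate\<close>

context ordered_coords
begin

lemma potential_bound:
  assumes x: "r 3 x > 0"
  shows "\<bar>potential b x\<bar> \<le> (\<Sum>m=3..n. \<bar>b m\<bar>) / r 3 x"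
  unfolding sum_divide_distrib
proof (rule order.trans[OF sum_abs], rule sum_mono)
  fix m assume "m \<in> {3..n}"
  then have "r 3 x \<le> r m x" by (intro r_mono) auto
  then show "\<bar>b m / r m x\<bar> \<le> \<bar>b m\<bar> / r 3 x" using x by (auto intro!: divide_left_mono)
qed

lemma potential_integrable:
  assumes u: "C1_compact u Du"
  shows "integrable lborel (\<lambda>x. potential b x * (u x)\<^sup>2)"
proof (rule Bochner_Integration.integrable_bound)
  have [measurable]: "u \<in> borel_measurable borel" using C1_compactD[OF u] by simp
  show "integrable lborel (\<lambda>x. (\<Sum>m=3..n. \<bar>b m\<bar>) * ((u x)\<^sup>2 / r 3 x))"
    by (intro integrable_mult_right hardy_integrable[OF u])
  show "(\<lambda>x. potential b x * (u x)\<^sup>2) \<in> borel_measurable lborel" by measurable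
  show "AE x in lborel. norm (potential b x * (u x)\<^sup>2) \<le> norm ((\<Sum>m=3..n. \<bar>b m\<bar>) * ((u x)\<^sup>2 / r 3 x))"
    using AE_r_pos
  proof eventually_elim
    case (elim x)
    have "\<bar>potential b x\<bar> * (u x)\<^sup>2 \<le> (\<Sum>m=3..n. \<bar>b m\<bar>) / r 3 x * (u x)\<^sup>2"
      by (intro mult_right_mono potential_bound elim) auto
    then show ?case using elim by (simp add: abs_mult sum_nonneg)
  qed
qed

text \<open>Dominated convergence in the energy identity: Z tends to minus the potential wherever
  X_3 is nonzero, and u^2 |Z| is bounded by a multiple of u^2 / |X_3|^2, integrable by the Hardy
  inequality.\<close>

lemma energy_limit:
  fixes A a :: "nat \<Rightarrow> real" and c :: "nat \<Rightarrow> nat \<Rightarrow> real"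
  assumes u: "C1_compact u Du"
    and A2: "A 2 = 0" and a: "\<And>m. a m = A m - A (m - 1) - 1 / 2"
    and b: "\<And>m. m \<in> {3..n} \<Longrightarrow> b m = (A (m - 1) + 1 / 2)\<^sup>2 - (A m)\<^sup>2"
    and c: "\<And>j m. m \<in> {3..n} \<Longrightarrow> c j m > 0" "\<And>m. m \<in> {3..n} \<Longrightarrow> (\<lambda>j. c j m) \<longlonglongrightarrow> 0"
  shows "(\<lambda>j. LINT x|lborel. (norm (Du x - u x *\<^sub>R T a (c j) x))\<^sup>2)
    \<longlonglongrightarrow> (LINT x|lborel. (norm (Du x))\<^sup>2) - (LINT x|lborel. potential b x * (u x)\<^sup>2)"
proof -
  have [measurable]: "u \<in> borel_measurable borel" using C1_compactD[OF u] by simp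
  have [measurable]: "Z a (c j) \<in> borel_measurable borel" for j
    by (intro borel_measurable_continuous_onI Z_continuous c)
  define CZ where "CZ = (\<Sum>m=3..n. \<bar>a m\<bar> * (real n + 2)) + (\<Sum>m=3..n. \<bar>a m\<bar>)\<^sup>2"
  have "(\<lambda>j. LINT x|lborel. (u x)\<^sup>2 * Z a (c j) x) \<longlonglongrightarrow> (LINT x|lborel. - (potential b x * (u x)\<^sup>2))"
  proof (rule integral_dominated_convergence[where w = "\<lambda>x. CZ * ((u x)\<^sup>2 / r 3 x)"])
    show "integrable lborel (\<lambda>x. CZ * ((u x)\<^sup>2 / r 3 x))" by (intro integrable_mult_right hardy_integrable[OF u])
    show "AE x in lborel. (\<lambda>j. (u x)\<^sup>2 * Z a (c j) x) \<longlonglongrightarrow> - (potential b x * (u x)\<^sup>2)"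
      using AE_r_pos
    proof eventually_elim
      case (elim x)
      have "(\<Sum>m=3..n. ((A m)\<^sup>2 - (A (m - 1) + 1 / 2)\<^sup>2) / r m x) = - potential b x"
        unfolding sum_negf[symmetric] using b by (intro sum.cong) (auto simp: diff_divide_distrib)
      then have "(\<lambda>j. (u x)\<^sup>2 * Z a (c j) x) \<longlonglongrightarrow> (u x)\<^sup>2 * (- potential b x)"
        using Z_limit[where A = A and a = a and c = c, OF A2 a c(2) elim] by (intro tendsto_intros) simp
      then show ?case by (simp add: mult.commute)
    qed
    show "AE x in lborel. norm ((u x)\<^sup>2 * Z a (c j) x) \<le> CZ * ((u x)\<^sup>2 / r 3 x)" for j
      using AE_r_pos
    proof eventually_elim
      case (elim x)
      have "\<bar>Z a (c j) x\<bar> \<le> CZ / r 3 x"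
        unfolding CZ_def using c(1) by (intro Z_bound elim) (simp add: less_imp_le)
      then have "(u x)\<^sup>2 * \<bar>Z a (c j) x\<bar> \<le> (u x)\<^sup>2 * (CZ / r 3 x)" by (intro mult_left_mono) auto
      then show ?case by (simp add: abs_mult mult.commute)
    qed
  qed measurable
  then have "(\<lambda>j. (LINT x|lborel. (norm (Du x))\<^sup>2) + (LINT x|lborel. (u x)\<^sup>2 * Z a (c j) x))
    \<longlonglongrightarrow> (LINT x|lborel. (norm (Du x))\<^sup>2) + (LINT x|lborel. - (potential b x * (u x)\<^sup>2))"
    by (intro tendsto_intros)
  then show ?thesis using energy_identity(3)[OF u c(1), where a = a] by simp
qed

text \<open>
  The exponent \<open>p\<close> satisfies \<open>2 p - 2 = p n / (n - 1) = 2 n / (n - 2)\<close>, so the Lebesgue norm produced by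
  Cauchy-Schwarz is the one that the Gagliardo inequality controls and can be absorbed.
\<close>
lemma hardy_sobolev_regularized:
  fixes a :: "nat \<Rightarrow> real" and Q d L \<epsilon> :: real
  defines "p \<equiv> 2 * (real n - 1) / (real n - 2)" and "c \<equiv> \<lambda>m. (\<epsilon> * L ^ (2 * m))\<^sup>2"
    and "B \<equiv> \<Sum>m=3..n. \<bar>2 * (real n - 1) / (real n - 2) * a m\<bar>"
  defines "K \<equiv> p * (1 + real n * B * (\<Sum>m=3..n. L ^ m) * (2 / d))"
  assumes Q: "p < Q" "Q \<le> 2 * real n / (real n - 2)"
    and u: "C1_compact u Du"
    and d: "d > 0" "\<And>m. m \<in> {3..n} \<Longrightarrow> d \<le> real m - 1 + p * (\<Sum>k=3..m. a k)"
      "\<And>m. m \<in> {3..n} \<Longrightarrow> d \<le> real m + p * (\<Sum>k=3..<m. a k)"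
    and L: "L \<ge> 2" "L \<ge> 1 + 4 * B / d" and \<epsilon>: "\<epsilon> > 0"
  shows "weighted_power ((Q - 2) / 2 * real n - Q) Q u powr (2 / Q)
    \<le> (2 / (1 + ((Q - 2) / 2 * real n - Q)) + 3) powr (2 / Q) * K\<^sup>2 * (LINT x|lborel. (norm (Du x - u x *\<^sub>R T a c x))\<^sup>2)"
proof -
  define s where "s = (Q - 2) / 2 * real n - Q"
  define J where "J = weighted_power s Q u"
  define E where "E = (LINT x|lborel. (norm (Du x - u x *\<^sub>R T a c x))\<^sup>2)"
  define C2 where "C2 = 2 / (1 + s) + 3"
  have N: "real n \<ge> 3" using n3 by simp
  have p: "p > 2" "p > 1" using N by (auto simp: p_def field_simps)
  have Q0: "Q > 0" using p Q by simp
  have c: "c m > 0" for m using L \<epsilon> by (simp add: c_def)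
  have B: "B \<ge> 0" unfolding B_def by (intro sum_nonneg) auto
  have M: "(\<Sum>m=3..n. L ^ m) \<ge> 0" using L by (intro sum_nonneg) auto
  have "0 \<le> real n * B * (\<Sum>m=3..n. L ^ m) * (2 / d)" using B M d(1) by simp
  then have K: "K > 0" using p unfolding K_def by (intro mult_pos_pos) auto
  have C2: "C2 > 0"
  proof -
    have "1 + s > 0" using Q(1) N by (simp add: s_def p_def field_simps)
    then show ?thesis by (simp add: C2_def add_pos_pos)
  qed
  have [measurable]: "u \<in> borel_measurable borel" "Du \<in> borel_measurable borel" using C1_compactD[OF u] by auto
  have [measurable]: "T a c \<in> borel_measurable borel" by (intro borel_measurable_continuous_onI T_continuous c)
  obtain R where R: "R > 0" "\<And>x. R < norm x \<Longrightarrow> u x = 0" "\<And>x. R < norm x \<Longrightarrow> Du x = 0"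
    using C1_compact_bound[OF u] by metis
  define f where "f x = \<bar>u x\<bar> powr p" for x
  define Df where "Df x = (p * (\<bar>u x\<bar> powr (p - 1) * sgn (u x))) *\<^sub>R Du x" for x
  have f: "C1_compact f Df" unfolding f_def Df_def by (rule C1_compact_abs_powr[OF u p(2)])
  note [measurable] = C1_compactD(4,5)[OF f]
  define \<sigma> where "\<sigma> m = p * a m" for m
  have T\<sigma>: "T \<sigma> c x = p *\<^sub>R T a c x" for x
    by (simp add: T_def \<sigma>_def scaleR_sum_right)
  \<comment> \<open>Since f = |u|^p, the difference Df - p f T is p |u|^(p-1) sgn(u) (Du - u T): the
    exponents \<sigma> = p a make the power compatible with the ground state transformation.\<close>
  have nf: "norm (Df x - f x *\<^sub>R T \<sigma> c x) = p * (\<bar>u x\<bar> powr (p - 1) * norm (Du x - u x *\<^sub>R T a c x))" for x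
  proof (cases "u x = 0")
    case False
    have "f x = \<bar>u x\<bar> powr (p - 1) * sgn (u x) * u x"
    proof -
      have "sgn (u x) * u x = \<bar>u x\<bar>" by (simp add: sgn_if abs_if)
      then show ?thesis using False powr_add[of "\<bar>u x\<bar>" "p - 1" 1] by (simp add: f_def mult.assoc)
    qed
    then have "Df x - f x *\<^sub>R T \<sigma> c x = (p * (\<bar>u x\<bar> powr (p - 1) * sgn (u x))) *\<^sub>R (Du x - u x *\<^sub>R T a c x)"
      by (simp add: Df_def T\<sigma> scaleR_diff_right mult_ac)
    then show ?thesis using p False by (simp add: abs_mult abs_sgn_eq)
  qed (use p in \<open>simp add: Df_def f_def\<close>)
  have grad: "(LINT x|lborel. norm (Df x)) \<le> K * (LINT x|lborel. \<bar>u x\<bar> powr (p - 1) * norm (Du x - u x *\<^sub>R T a c x))"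
  proof -
    have "(LINT x|lborel. norm (Df x)) \<le> (1 + real n * B * (\<Sum>m=3..n. L ^ m) * (2 / d)) * (LINT x|lborel. norm (Df x - f x *\<^sub>R T \<sigma> c x))"
      unfolding c_def
    proof (rule weighted_L1_gradient_bound[OF f _ _ d(1) _ _ L \<epsilon>])
      show "0 \<le> f x" for x by (simp add: f_def)
      show "\<bar>\<sigma> m\<bar> \<le> B" if "m \<in> {3..n}" for m
        unfolding B_def \<sigma>_def p_def using that by (intro member_le_sum) auto
      show "d \<le> real m - 1 + sum \<sigma> {3..m}" "d \<le> real m + sum \<sigma> {3..<m}" if "m \<in> {3..n}" for m
        using d(2,3)[OF that] by (auto simp: \<sigma>_def sum_distrib_left)
    qed
    then show ?thesis by (simp only: nf Bochner_Integration.integral_mult_right_zero K_def) (simp add: mult_ac)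
  qed
  define Y where "Y = (LINT x|lborel. \<bar>u x\<bar> powr (2 * p - 2))"
  have iY: "integrable lborel (\<lambda>x. \<bar>u x\<bar> powr (2 * p - 2))"
    using R p C1_compactD[OF u]
    by (intro integrable_continuous_compact_support[where R=R] continuous_on_powr' continuous_intros) auto
  have iE: "integrable lborel (\<lambda>x. (norm (Du x - u x *\<^sub>R T a c x))\<^sup>2)" by (rule energy_identity(1)[OF u c])
  have E0: "E \<ge> 0" unfolding E_def by (intro integral_nonneg_AE) auto
  have Y0: "Y \<ge> 0" unfolding Y_def by (intro integral_nonneg_AE) auto
  have CS: "(LINT x|lborel. \<bar>u x\<bar> powr (p - 1) * norm (Du x - u x *\<^sub>R T a c x)) \<le> sqrt Y * sqrt E"
  proof (rule integral_real_bounded)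
    have "(\<integral>\<^sup>+x. ennreal ((\<bar>u x\<bar> powr (2 * p - 2)) powr (1 / 2) * ((norm (Du x - u x *\<^sub>R T a c x))\<^sup>2) powr (1 - 1 / 2)) \<partial>lborel)
        \<le> ennreal (Y powr (1 / 2) * E powr (1 - 1 / 2))"
      using iY iE Y0 E0
      by (intro nn_integral_Holder) (auto simp: nn_integral_eq_integral Y_def E_def)
    moreover have "(\<bar>u x\<bar> powr (2 * p - 2)) powr (1 / 2) = \<bar>u x\<bar> powr (p - 1)" for x
      by (simp add: powr_powr diff_divide_distrib)
    ultimately show "(\<integral>\<^sup>+x. ennreal (\<bar>u x\<bar> powr (p - 1) * norm (Du x - u x *\<^sub>R T a c x)) \<partial>lborel) \<le> ennreal (sqrt Y * sqrt E)"
      using Y0 E0 by (simp add: powr_half_sqrt)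
  qed (use Y0 E0 in simp)
  define k where "k = n - 1"
  have card: "CARD('n) = Suc k" "k \<ge> 1" using n3 by (auto simp: card_n k_def)
  have k: "real k = real n - 1" using n3 by (simp add: k_def)
  have k1: "1 + 1 / real k = real n / (real n - 1)" using N by (simp add: k field_simps)
  have p1: "p = 1 + real n / (real n - 2)" using N by (simp add: p_def field_simps)
  have pn: "p * (1 + 1 / real k) = 2 * real n / (real n - 2)"
    unfolding k1 p_def using N by (simp add: frac_eq_eq)
  have "2 * p - 2 = 2 * real n / (real n - 2)" unfolding p1 by simp
  then have pe: "p * (1 + 1 / real k) = 2 * p - 2" by (simp only: pn)
  have line: "ennreal (f x) \<le> (\<integral>\<^sup>+t. norm (Df (\<chi> j. if j = i then t else x $ j)) \<partial>lborel)" for i x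
    by (rule C1_compact_le_line_integral[OF f])
  \<comment> \<open>E may be 0, whereas the Gagliardo inequalities ask for a positive mass; hence E'
    > E, with E' tending to E at the end. If Y = 0, then u = 0 almost everywhere.\<close>
  have "J powr (2 / Q) \<le> C2 powr (2 / Q) * K\<^sup>2 * E'" if E': "E' > E" for E'
  proof (cases "Y = 0")
    case True
    then have "AE x in lborel. \<bar>u x\<bar> powr (2 * p - 2) = 0"
      unfolding Y_def using iY by (subst (asm) integral_nonneg_eq_0_iff_AE) auto
    then have "AE x in lborel. \<bar>x $ e 1\<bar> powr s * \<bar>u x\<bar> powr Q = 0" by eventually_elim auto
    then have "J = 0" unfolding J_def by (rule integral_eq_zero_AE)
    then show ?thesis using E' E0 Q0 by simp
  next
    case False
    then have Y: "Y > 0" using Y0 by simp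
    have E'0: "E' > 0" using E0 E' by simp
    define X where "X = K * sqrt E'"
    have X: "X > 0" using K E'0 by (simp add: X_def)
    define w where "w = X * sqrt Y"
    have w: "w > 0" using X Y by (simp add: w_def)
    have "(LINT x|lborel. norm (Df x)) \<le> w"
    proof -
      have "(LINT x|lborel. norm (Df x)) \<le> K * (sqrt Y * sqrt E)" using grad CS K by (meson mult_left_mono less_imp_le order_trans)
      also have "\<dots> \<le> K * (sqrt Y * sqrt E')" using K Y0 E' by (intro mult_left_mono) auto
      finally show ?thesis by (simp add: w_def X_def mult_ac)
    qed
    moreover have "integrable lborel (\<lambda>x. norm (Df x))"
    proof -
      obtain R' where R': "\<And>x. R' < norm x \<Longrightarrow> Df x = 0" using C1_compact_bound[OF f] by metis
      show ?thesis
        using R' C1_compactD[OF f] by (intro integrable_continuous_compact_support[where R=R'] continuous_intros) auto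
    qed
    ultimately have wI: "(\<integral>\<^sup>+x. norm (Df x) \<partial>lborel) \<le> ennreal w"
      by (simp add: nn_integral_eq_integral ennreal_leI)
    have "(\<integral>\<^sup>+x. ennreal (f x powr (1 + 1 / real k)) \<partial>lborel) \<le> ennreal (w powr (1 + 1 / real k))"
      by (rule gagliardo[OF card _ _ _ _ line wI w]) (auto simp: f_def)
    moreover have "f x powr (1 + 1 / real k) = \<bar>u x\<bar> powr (2 * p - 2)" for x
      by (simp add: f_def powr_powr pe)
    ultimately have "ennreal Y \<le> ennreal (w powr (1 + 1 / real k))"
      using iY by (simp add: nn_integral_eq_integral Y_def)
    then have "Y \<le> w powr (1 + 1 / real k)" by (simp add: ennreal_le_iff)
    \<comment> \<open>The absorption in logarithms: Y <= w^(n/(n-1)) with w = X sqrt Y. As Y is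
      finite and positive and n / (2 (n - 1)) < 1, ln Y can be moved to the left, and w <= X^p
      results.\<close>
    then have "ln Y \<le> (1 + 1 / real k) * ln w" using Y w by (metis ln_le_cancel_iff ln_powr powr_gt_zero less_irrefl)
    moreover have lw: "ln w = ln X + ln Y / 2" using X Y by (simp add: w_def ln_mult ln_sqrt)
    ultimately have "ln Y \<le> real n * (ln X + ln Y / 2) / (real n - 1)" by (simp add: k1)
    then have "ln Y * (real n - 1) \<le> real n * (ln X + ln Y / 2)" using N by (simp add: pos_le_divide_eq)
    then have "ln Y / 2 * (real n - 2) \<le> real n * ln X" by (simp add: algebra_simps)
    then have "ln Y / 2 \<le> real n * ln X / (real n - 2)" using N by (simp add: pos_le_divide_eq)
    then have "ln w \<le> p * ln X" unfolding lw p1 by (simp add: distrib_right)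
    then have wX: "w \<le> X powr p" using w X by (metis ln_le_cancel_iff ln_powr powr_gt_zero less_irrefl)
    \<comment> \<open>The weighted inequality with exponent Q / p, whose \<tau> is then -s. With w
      <= X^p it bounds J by a multiple of X^Q, so the power 2 / Q turns it into a multiple of X^2 =
      K^2 E'.\<close>
    have "(\<integral>\<^sup>+x. ennreal (\<bar>x $ e 1\<bar> powr (- (- s)) * f x powr (Q / p)) \<partial>lborel) \<le> ennreal ((2 / (1 - (- s)) + 3) * w powr (Q / p))"
    proof (rule weighted_gagliardo[OF card _ _ _ _ _ _ _ line wI w])
      show "1 < Q / p" using Q p by simp
      show "Q / p \<le> 1 + 1 / real k" using Q(2) p unfolding pn[symmetric] by (simp add: pos_divide_le_eq mult.commute)
      show "- s = real CARD('n) - real k * (Q / p)" using N by (simp add: card_n s_def p_def k field_simps)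
    qed (auto simp: f_def)
    then have "(\<integral>\<^sup>+x. ennreal (\<bar>x $ e 1\<bar> powr s * \<bar>u x\<bar> powr Q) \<partial>lborel) \<le> ennreal (C2 * w powr (Q / p))"
      using p by (simp add: f_def powr_powr C2_def)
    then have "J \<le> C2 * w powr (Q / p)" unfolding J_def using C2 by (intro integral_real_bounded) auto
    also have "\<dots> \<le> C2 * (X powr p) powr (Q / p)" using C2 wX w Q0 p by (intro mult_left_mono powr_mono2) auto
    also have "\<dots> = C2 * X powr Q" using p by (simp add: powr_powr)
    finally have "J powr (2 / Q) \<le> (C2 * X powr Q) powr (2 / Q)"
      using Q0 by (intro powr_mono2) (auto simp: J_def intro!: integral_nonneg_AE)
    also have "\<dots> = C2 powr (2 / Q) * X powr 2" using C2 X Q0 by (simp add: powr_mult powr_powr)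
    also have "X powr 2 = K\<^sup>2 * E'" using X K E'0 by (simp add: X_def power_mult_distrib)
    finally show ?thesis by simp
  qed
  then have "J powr (2 / Q) \<le> C2 powr (2 / Q) * K\<^sup>2 * (E + \<delta>)" if "\<delta> > 0" for \<delta> using that by simp
  moreover have "((\<lambda>\<delta>. C2 powr (2 / Q) * K\<^sup>2 * (E + \<delta>)) \<longlongrightarrow> C2 powr (2 / Q) * K\<^sup>2 * (E + 0)) (at_right 0)"
    by (intro tendsto_intros)
  ultimately have "J powr (2 / Q) \<le> C2 powr (2 / Q) * K\<^sup>2 * (E + 0)"
    by (intro tendsto_lowerbound) (auto simp: eventually_at_right_field intro!: exI[of _ 1])
  then show ?thesis by (simp add: J_def C2_def E_def s_def)
qed

end


context ordered_coords
begin

text \<open>L, K and the constant of the weighted inequality are fixed before \<epsilon>, so the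
  estimate survives the limit \<epsilon> -> 0, in which the energy becomes the Hardy deficit. It
  remains to verify the lower bounds on the partial sums of \<open>a\<close>.\<close>

lemma hardy_sobolev_noncritical:
  fixes A b :: "nat \<Rightarrow> real" and Q :: real
  assumes A: "A 2 = 0" "\<And>m. m \<in> {3..n} \<Longrightarrow> 0 \<le> A m" "0 < A n"
    and b: "\<And>m. m \<in> {3..n} \<Longrightarrow> b m = (A (m - 1) + 1 / 2)\<^sup>2 - (A m)\<^sup>2"
    and Q: "2 * (real n - 1) / (real n - 2) < Q" "Q \<le> 2 * real n / (real n - 2)"
  shows "\<exists>C>0. \<forall>u. test_function u \<longrightarrow> hardy_sobolev_ineq e n b Q C u"
proof -
  have N: "real n \<ge> 3" using n3 by simp
  define p where "p = 2 * (real n - 1) / (real n - 2)"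
  have p: "p > 2" using N by (simp add: p_def field_simps)
  define a where "a m = A m - A (m - 1) - 1 / 2" for m
  have S: "(\<Sum>k=3..m. a k) = A m - (real m - 2) / 2" if m: "m \<ge> 2" for m
  proof -
    have e: "2 + (m - 2) = m" "real (m - 2) = real m - 2" using m by auto
    show ?thesis by (rule potential_algebra(1)[where A = A and a = a and j = "m - 2", OF A(1) a_def, unfolded e])
  qed
  \<comment> \<open>The active bound at level m equals (n - m) / (n - 2) + p A_m, at least 1 / (n -
    2) for m < n and p A_n for m = n. The switched-off bound equals (3 n - 3 - m) / (n - 2) + p
    A_(m-1), which is at least 1 / (n - 2) for all m up to n.\<close>
  define d where "d = min (1 / (real n - 2)) (p * A n)"
  have d: "d > 0" using N p A(3) by (simp add: d_def)
  have dle: "d \<le> 1 / (real n - 2)" "d \<le> p * A n" by (simp_all add: d_def)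
  have "p * (real n - 2) = 2 * (real n - 1)" unfolding p_def using N by simp
  then have p2: "p / 2 * (real n - 2) = real n - 1" by simp
  have pA: "p * (t - s / 2) = p * t - p / 2 * s" for t s by (simp add: field_simps)
  have d1: "d \<le> real m - 1 + p * (\<Sum>k=3..m. a k)" if m: "m \<in> {3..n}" for m
  proof (cases "m = n")
    case True
    have "(\<Sum>k=3..n. a k) = A n - (real n - 2) / 2" using n3 by (intro S) auto
    then have "real m - 1 + p * (\<Sum>k=3..m. a k) = p * A n" unfolding True by (simp only: pA p2)
    then show ?thesis using dle by simp
  next
    case False
    then have mn: "real m + 1 \<le> real n" using m by simp
    have "1 / (real n - 2) \<le> (real n - real m) / (real n - 2)" using mn N by (intro divide_right_mono) auto
    also have "\<dots> = real m - 1 - p / 2 * (real m - 2)" using N by (simp add: p_def field_simps)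
    also have "\<dots> \<le> real m - 1 + p * (\<Sum>k=3..m. a k)"
      using A(2)[OF m] p m by (subst S) (auto simp only: pA, auto)
    finally show ?thesis using dle by simp
  qed
  have d2: "d \<le> real m + p * (\<Sum>k=3..<m. a k)" if m: "m \<in> {3..n}" for m
  proof -
    have set: "{3..<m} = {3..m - 1}" using m by auto
    have Am: "A (m - 1) \<ge> 0"
    proof (cases "m = 3")
      case False
      then have "m - 1 \<in> {3..n}" using m by auto
      then show ?thesis by (rule A(2))
    qed (use A(1) in simp)
    have m1: "m - 1 \<ge> 2" "real (m - 1) - 2 = real m - 3" using m by auto
    have "1 / (real n - 2) \<le> (3 * real n - 3 - real m) / (real n - 2)" using m N by (intro divide_right_mono) auto
    also have "\<dots> = real m - p / 2 * (real m - 3)" using N by (simp add: p_def field_simps)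
    also have "\<dots> \<le> real m + p * (\<Sum>k=3..<m. a k)"
      using Am p unfolding set S[OF m1(1)] m1(2) pA by simp
    finally show ?thesis using dle by simp
  qed
  define B where "B = (\<Sum>m=3..n. \<bar>2 * (real n - 1) / (real n - 2) * a m\<bar>)"
  define L where "L = max 2 (1 + 4 * B / d)"
  have L: "L \<ge> 2" "L \<ge> 1 + 4 * B / d" by (simp_all add: L_def)
  define K where "K = p * (1 + real n * B * (\<Sum>m=3..n. L ^ m) * (2 / d))"
  define s where "s = (Q - 2) / 2 * real n - Q"
  \<comment> \<open>The summand 1 makes C3 visibly positive, so that 1 / C3 can serve as the
    constant.\<close>
  define C3 where "C3 = (2 / (1 + s) + 3) powr (2 / Q) * K\<^sup>2 + 1"
  have C3: "C3 > 0" by (simp add: C3_def add_nonneg_pos)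
  show ?thesis
  proof (intro exI[of _ "1 / C3"] conjI allI impI)
    show "1 / C3 > 0" using C3 by simp
    fix u :: "real ^ 'n \<Rightarrow> real" assume "test_function u"
    then have u: "C1_compact u (grad u)" by (rule test_function_C1_compact)
    let ?E = "(LINT x|lborel. (norm (grad u x))\<^sup>2) - (LINT x|lborel. potential b x * (u x)\<^sup>2)"
    define J where "J = weighted_power s Q u"
    define c where "c j m = (1 / real (Suc j) * L ^ (2 * m))\<^sup>2" for j m
    have c: "c j m > 0" for j m using L by (simp add: c_def)
    have c0: "(\<lambda>j. c j m) \<longlonglongrightarrow> 0" for m
    proof -
      have "(\<lambda>j. (1 / real (Suc j) * L ^ (2 * m))\<^sup>2) \<longlonglongrightarrow> (0 * L ^ (2 * m))\<^sup>2"
        by (intro tendsto_intros) (use LIMSEQ_inverse_real_of_nat in \<open>simp add: inverse_eq_divide\<close>)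
      then show ?thesis by (simp add: c_def)
    qed
    define E where "E j = (LINT x|lborel. (norm (grad u x - u x *\<^sub>R T a (c j) x))\<^sup>2)" for j
    have JE: "J powr (2 / Q) \<le> C3 * E j" for j
    proof -
      have "J powr (2 / Q) \<le> (2 / (1 + s) + 3) powr (2 / Q) * K\<^sup>2 * E j"
        unfolding J_def s_def K_def p_def B_def E_def c_def
      proof (rule hardy_sobolev_regularized)
        show "2 * (real n - 1) / (real n - 2) < Q" "Q \<le> 2 * real n / (real n - 2)" using Q by auto
        show "0 < d" by (rule d)
        show "d \<le> real m - 1 + 2 * (real n - 1) / (real n - 2) * sum a {3..m}"
          "d \<le> real m + 2 * (real n - 1) / (real n - 2) * sum a {3..<m}" if "m \<in> {3..n}" for m
          using d1[OF that] d2[OF that] by (auto simp: p_def)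
        show "1 + 4 * (\<Sum>m = 3..n. \<bar>2 * (real n - 1) / (real n - 2) * a m\<bar>) / d \<le> L"
          using L(2) by (simp only: B_def)
      qed (use L u in auto)
      also have "\<dots> \<le> C3 * E j" unfolding C3_def E_def by (intro mult_right_mono) auto
      finally show ?thesis .
    qed
    have "E \<longlonglongrightarrow> ?E"
      unfolding E_def by (rule energy_limit[where A = A, OF u A(1) a_def b c c0])
    then have "(\<lambda>j. C3 * E j) \<longlonglongrightarrow> C3 * ?E"
      by (intro tendsto_intros)
    then have "J powr (2 / Q) \<le> C3 * ?E"
      by (rule LIMSEQ_le_const) (use JE in auto)
    then have "J powr (2 / Q) / C3 \<le> ?E"
      using C3 by (simp add: pos_divide_le_eq mult.commute)
    then show "hardy_sobolev_ineq e n b Q (1 / C3) u"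
      by (simp add: hardy_sobolev_ineq_iff J_def s_def)
  qed
qed

end

subsection \<open>Smooth functions\<close>

lemma Ck_fun_SucD: "Ck_fun (Suc k) u \<Longrightarrow> Ck_fun k u"
proof (induction k arbitrary: u)
  case 0
  then show ?case using differentiable_imp_continuous_on by auto
next
  case (Suc k)
  from Suc.prems have "u differentiable_on UNIV \<and> (\<forall>v. Ck_fun (Suc k) (\<lambda>x. frechet_derivative u (at x) v))"
    by (subst (asm) Ck_fun.simps(2))
  then show ?case by (subst Ck_fun.simps(2)) (use Suc.IH in blast)
qed

lemma Ck_fun_SucI:
  fixes u :: "real ^ 'n \<Rightarrow> real"
  assumes "\<And>x. (u has_derivative D x) (at x)" "\<And>v. Ck_fun k (\<lambda>x. D x v)"
  shows "Ck_fun (Suc k) u"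
proof -
  have "frechet_derivative u (at x) = D x" for x using assms(1) by (metis frechet_derivative_at)
  moreover have "u differentiable_on UNIV"
    using assms(1) by (auto simp: differentiable_on_def differentiable_def intro: has_derivative_at_withinI)
  ultimately show ?thesis using assms(2) by simp
qed

lemma Ck_fun_SucE:
  fixes u :: "real ^ 'n \<Rightarrow> real"
  assumes "Ck_fun (Suc k) u"
  obtains D where "\<And>x. (u has_derivative D x) (at x)" "\<And>v. Ck_fun k (\<lambda>x. D x v)"
proof (rule that)
  show "(u has_derivative frechet_derivative u (at x)) (at x)" for x
    using assms by (simp add: differentiable_on_def frechet_derivative_works[symmetric])
  show "Ck_fun k (\<lambda>x. frechet_derivative u (at x) v)" for v using assms by simp
qed

lemma Ck_fun_const: "Ck_fun k (\<lambda>_. c)"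
proof (induction k arbitrary: c)
  case (Suc k)
  show ?case by (rule Ck_fun_SucI[where D = "\<lambda>_ _. 0"]) (use Suc in auto)
qed simp

lemma Ck_fun_coordinate: "Ck_fun k (\<lambda>x. x $ i)"
proof (cases k)
  case (Suc j)
  show ?thesis unfolding Suc
    by (rule Ck_fun_SucI[where D = "\<lambda>_ v. v $ i"])
      (auto intro!: bounded_linear_imp_has_derivative[OF bounded_linear_vec_nth] Ck_fun_const)
qed (auto intro!: continuous_intros)

lemma Ck_fun_add: "Ck_fun k f \<Longrightarrow> Ck_fun k g \<Longrightarrow> Ck_fun k (\<lambda>x. f x + g x)"
proof (induction k arbitrary: f g)
  case 0
  then show ?case by (auto intro!: continuous_intros)
next
  case (Suc k)
  obtain D where D: "\<And>x. (f has_derivative D x) (at x)" "\<And>v. Ck_fun k (\<lambda>x. D x v)" using Ck_fun_SucE[OF Suc.prems(1)] by metis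
  obtain E where E: "\<And>x. (g has_derivative E x) (at x)" "\<And>v. Ck_fun k (\<lambda>x. E x v)" using Ck_fun_SucE[OF Suc.prems(2)] by metis
  show ?case
    by (rule Ck_fun_SucI[where D = "\<lambda>x v. D x v + E x v"]) (use D E Suc.IH in \<open>auto intro: has_derivative_add\<close>)
qed

lemma Ck_fun_mult: "Ck_fun k f \<Longrightarrow> Ck_fun k g \<Longrightarrow> Ck_fun k (\<lambda>x. f x * g x)"
proof (induction k arbitrary: f g)
  case 0
  then show ?case by (auto intro!: continuous_intros)
next
  case (Suc k)
  obtain D where D: "\<And>x. (f has_derivative D x) (at x)" "\<And>v. Ck_fun k (\<lambda>x. D x v)" using Ck_fun_SucE[OF Suc.prems(1)] by metis
  obtain E where E: "\<And>x. (g has_derivative E x) (at x)" "\<And>v. Ck_fun k (\<lambda>x. E x v)" using Ck_fun_SucE[OF Suc.prems(2)] by metis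
  have fg: "Ck_fun k f" "Ck_fun k g" using Suc.prems by (auto intro: Ck_fun_SucD)
  show ?case
    by (rule Ck_fun_SucI[where D = "\<lambda>x v. f x * E x v + D x v * g x"])
      (use D E fg Suc.IH in \<open>auto intro: has_derivative_mult Ck_fun_add\<close>)
qed

lemma Ck_fun_sum: "(\<And>i. i \<in> I \<Longrightarrow> Ck_fun k (f i)) \<Longrightarrow> Ck_fun k (\<lambda>x. \<Sum>i\<in>I. f i x)"
  by (induction I rule: infinite_finite_induct) (auto intro: Ck_fun_const Ck_fun_add)

text \<open>H is the tower of successive derivatives of the outer function on S. The chain rule
  turns level j into level j + 1 times a derivative of f, so the induction on k runs over all j at
  once.\<close>

lemma Ck_fun_compose:
  fixes H :: "nat \<Rightarrow> real \<Rightarrow> real" and f :: "real ^ 'n \<Rightarrow> real"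
  assumes H: "\<And>j y. y \<in> S \<Longrightarrow> (H j has_real_derivative H (Suc j) y) (at y)" and f: "\<And>x. f x \<in> S"
  shows "Ck_fun k f \<Longrightarrow> Ck_fun k (\<lambda>x. H j (f x))"
proof (induction k arbitrary: j)
  case 0
  have "isCont (\<lambda>x. H j (f x)) x" for x
  proof (rule isCont_o2[where g = "H j" and f = f])
    show "isCont f x" using 0 by (simp add: continuous_on_eq_continuous_at)
    show "isCont (H j) (f x)" using H[OF f] by (rule DERIV_isCont)
  qed
  then show ?case by (simp add: continuous_on_eq_continuous_at)
next
  case (Suc k)
  obtain D where D: "\<And>x. (f has_derivative D x) (at x)" "\<And>v. Ck_fun k (\<lambda>x. D x v)" using Ck_fun_SucE[OF Suc.prems(1)] by metis
  have "((\<lambda>x. H j (f x)) has_derivative (\<lambda>v. H (Suc j) (f x) * D x v)) (at x)" for x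
    by (rule has_derivative_compose[OF D(1) H[OF f, unfolded has_field_derivative_def]])
  then show ?case
    by (rule Ck_fun_SucI) (intro Ck_fun_mult Suc.IH Ck_fun_SucD[OF Suc.prems] D(2))
qed

lemma Ck_fun_exp: "Ck_fun k f \<Longrightarrow> Ck_fun k (\<lambda>x. exp (f x))"
  by (rule Ck_fun_compose[where H = "\<lambda>_. exp" and S = UNIV]) (auto intro!: derivative_eq_intros)

lemma Ck_fun_ln:
  fixes f :: "real ^ 'n \<Rightarrow> real"
  assumes f: "\<And>x. f x > 0" and "Ck_fun k f"
  shows "Ck_fun k (\<lambda>x. ln (f x))"
proof -
  \<comment> \<open>The derivatives of ln: (-1)^(j-1) (j-1)! y^(-j) for j >= 1.\<close>
  define H :: "nat \<Rightarrow> real \<Rightarrow> real" where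
    "H j y = (if j = 0 then ln y else (- 1) ^ (j - 1) * fact (j - 1) * y powr (- real j))" for j y
  have *: "(H j has_real_derivative H (Suc j) y) (at y)" if "y \<in> {0<..}" for j y
  proof (cases j)
    case 0
    then show ?thesis using that by (auto simp: H_def[abs_def] powr_minus_divide intro!: derivative_eq_intros)
  next
    case (Suc i)
    have "((\<lambda>y. (- 1) ^ i * fact i * y powr (- real (Suc i))) has_real_derivative
        (- 1) ^ i * fact i * (- real (Suc i) * y powr (- real (Suc i) - 1))) (at y)"
      using that by (intro DERIV_cmult has_real_derivative_powr) auto
    moreover have "- real (Suc i) - 1 = - real (Suc (Suc i))" by simp
    moreover have "(- 1) ^ i * fact i * (- real (Suc i) * Y) = (- 1) ^ Suc i * fact (Suc i) * Y" for Y :: real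
      by (simp add: algebra_simps)
    ultimately show ?thesis by (simp add: Suc H_def[abs_def] del: of_nat_Suc fact_Suc power_Suc)
  qed
  have "Ck_fun k (\<lambda>x. H 0 (f x))"
    by (rule Ck_fun_compose[where H = H and S = "{0<..}"]) (use * assms in auto)
  then show ?thesis by (simp add: H_def)
qed

section \<open>The smooth profile exp (-1/t) and its derivatives\<close>

definition bump :: "real \<Rightarrow> real" where
  "bump t = (if t > 0 then exp (- 1 / t) else 0)"

text \<open>All derivatives of the profile have this form, a polynomial in 1/t times exp
  (-1/t).\<close>

definition bump_poly :: "real poly \<Rightarrow> real \<Rightarrow> real" where
  "bump_poly p t = (if t > 0 then poly p (1 / t) * exp (- 1 / t) else 0)"

lemma bump_eq: "bump = bump_poly 1"
  by (simp add: fun_eq_iff bump_def bump_poly_def)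

lemma poly_exp_tendsto_0: "((\<lambda>y::real. poly p y / exp y) \<longlongrightarrow> 0) at_top"
proof -
  have "((\<lambda>y::real. \<Sum>i\<le>degree p. coeff p i * (y ^ i / exp y)) \<longlongrightarrow> (\<Sum>i\<le>degree p. coeff p i * 0)) at_top"
    by (intro tendsto_intros tendsto_power_div_exp_0)
  then show ?thesis by (simp add: poly_altdef sum_divide_distrib)
qed

text \<open>The derivative of p(1/t) exp (-1/t) is t^(-2) (p - p')(1/t) exp (-1/t), and
  \<open>[:0, 0, 1:]\<close> is the factor t^(-2) as a polynomial in 1/t. At 0 the difference
  quotient from the right is again a polynomial in 1/t against an exponential, so it tends to
  0.\<close>

lemma DERIV_bump_poly:
  "(bump_poly p has_real_derivative bump_poly ([:0, 0, 1:] * (p - pderiv p)) t) (at t)"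
proof -
  consider "t > 0" | "t < 0" | "t = 0" by linarith
  then show ?thesis
  proof cases
    case 1
    have "((\<lambda>t. poly p (1 / t) * exp (- 1 / t)) has_real_derivative bump_poly ([:0, 0, 1:] * (p - pderiv p)) t) (at t)"
      using 1 by (auto intro!: derivative_eq_intros poly_DERIV[THEN DERIV_chain2] simp: bump_poly_def field_simps power2_eq_square)
    then show ?thesis
      by (rule has_field_derivative_transform_within_open[where S = "{0<..}"]) (use 1 in \<open>auto simp: bump_poly_def\<close>)
  next
    case 2
    have "((\<lambda>t. 0) has_real_derivative bump_poly ([:0, 0, 1:] * (p - pderiv p)) t) (at t)"
      using 2 by (simp add: bump_poly_def)
    then show ?thesis
      by (rule has_field_derivative_transform_within_open[where S = "{..<0}"]) (use 2 in \<open>auto simp: bump_poly_def\<close>)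
  next
    case 3
    have "((\<lambda>h. bump_poly p h / h) \<longlongrightarrow> 0) (at_right 0)"
    proof -
      have "((\<lambda>h. poly (pCons 0 p) (inverse h) / exp (inverse h)) \<longlongrightarrow> 0) (at_right (0::real))"
        by (rule filterlim_compose[OF poly_exp_tendsto_0 filterlim_inverse_at_top_right])
      moreover have "\<forall>\<^sub>F h in at_right (0::real). poly (pCons 0 p) (inverse h) / exp (inverse h) = bump_poly p h / h"
        using eventually_at_right_less[of 0]
        by eventually_elim (simp add: bump_poly_def exp_minus field_simps)
      ultimately show ?thesis by (rule Lim_transform_eventually)
    qed
    moreover have "((\<lambda>h. bump_poly p h / h) \<longlongrightarrow> 0) (at_left 0)"
    proof (rule Lim_transform_eventually)
      show "\<forall>\<^sub>F h in at_left (0::real). 0 = bump_poly p h / h"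
        unfolding eventually_at_filter by (rule always_eventually) (auto simp: bump_poly_def)
    qed simp
    ultimately have "((\<lambda>h. bump_poly p h / h) \<longlongrightarrow> 0) (at 0)" by (simp add: filterlim_split_at)
    then show ?thesis using 3 by (simp add: DERIV_def bump_poly_def)
  qed
qed

lemma Ck_fun_bump:
  fixes f :: "real ^ 'n \<Rightarrow> real"
  assumes "Ck_fun k f"
  shows "Ck_fun k (\<lambda>x. bump (f x))"
proof -
  define F :: "real poly \<Rightarrow> real poly" where "F p = [:0, 0, 1:] * (p - pderiv p)" for p
  define H where "H j = bump_poly ((F ^^ j) 1)" for j
  have "(H j has_real_derivative H (Suc j) y) (at y)" for j y
    using DERIV_bump_poly[of "(F ^^ j) 1" y] by (simp add: H_def F_def)
  from Ck_fun_compose[where H = H and S = UNIV and j = 0, OF this _ assms] show ?thesis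
    by (simp add: H_def bump_eq)
qed

lemma DERIV_bump: "(bump has_real_derivative bump_poly [:0, 0, 1:] t) (at t)"
  using DERIV_bump_poly[of 1 t] by (simp add: bump_eq pderiv_1)

lemma bump_derivative_bound: "\<exists>M>0. \<forall>t\<in>{0..1}. \<bar>bump_poly [:0, 0, 1:] t\<bar> \<le> M"
proof -
  have "continuous_on {0..1} (\<lambda>t. bump_poly [:0, 0, 1:] t)"
    by (intro continuous_at_imp_continuous_on) (auto intro: DERIV_isCont[OF DERIV_bump_poly])
  then have "bounded (bump_poly [:0, 0, 1:] ` {0..1})"
    by (intro compact_imp_bounded compact_continuous_image) auto
  then show ?thesis by (auto simp: bounded_pos)
qed


subsection \<open>The critical case\<close>

lemma nn_integral_lborel_vec_prod:
  fixes F :: "'n::finite \<Rightarrow> real \<Rightarrow> ennreal"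
  assumes [measurable]: "\<And>i. F i \<in> borel_measurable borel"
  shows "(\<integral>\<^sup>+x. (\<Prod>i\<in>UNIV. F i (x $ i)) \<partial>(lborel :: (real ^ 'n) measure)) = (\<Prod>i\<in>UNIV. \<integral>\<^sup>+t. F i t \<partial>lborel)"
proof -
  interpret P: product_sigma_finite "\<lambda>_::'n. lborel :: real measure" by standard
  have "(\<integral>\<^sup>+x. (\<Prod>i\<in>UNIV. F i (x $ i)) \<partial>(lborel :: (real ^ 'n) measure))
    = (\<integral>\<^sup>+y. (\<Prod>i\<in>UNIV. F i (y i)) \<partial>Pi\<^sub>M UNIV (\<lambda>_. lborel))"
    by (subst nn_integral_lborel_vec) auto
  also have "\<dots> = (\<Prod>i\<in>UNIV. \<integral>\<^sup>+t. F i t \<partial>lborel)"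
    by (rule P.product_nn_integral_prod) auto
  finally show ?thesis .
qed

text \<open>The ball lies in a cube, over which the integral is a product of one-dimensional
  integrals, each finite because its exponent is below 1.\<close>

lemma coordinate_powers_locally_integrable:
  fixes \<gamma> :: "'n::finite \<Rightarrow> real"
  assumes \<gamma>: "\<And>i. \<gamma> i < 1" and R: "R \<ge> 0"
  shows "(\<integral>\<^sup>+x. ennreal (\<Prod>i\<in>UNIV. \<bar>x $ i\<bar> powr (- \<gamma> i)) * indicator (cball 0 R) x \<partial>(lborel :: (real ^ 'n) measure)) < \<infinity>"
proof -
  have "(\<integral>\<^sup>+x. ennreal (\<Prod>i\<in>UNIV. \<bar>x $ i\<bar> powr (- \<gamma> i)) * indicator (cball 0 R) x \<partial>(lborel :: (real ^ 'n) measure))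
    \<le> (\<integral>\<^sup>+x. (\<Prod>i\<in>UNIV. ennreal (\<bar>x $ i\<bar> powr (- \<gamma> i)) * indicator {0..R} \<bar>x $ i\<bar>) \<partial>(lborel :: (real ^ 'n) measure))"
  proof (rule nn_integral_mono)
    fix x :: "real ^ 'n"
    show "ennreal (\<Prod>i\<in>UNIV. \<bar>x $ i\<bar> powr (- \<gamma> i)) * indicator (cball 0 R) x
      \<le> (\<Prod>i\<in>UNIV. ennreal (\<bar>x $ i\<bar> powr (- \<gamma> i)) * indicator {0..R} \<bar>x $ i\<bar>)"
    proof (cases "norm x \<le> R")
      case True
      then have "\<bar>x $ i\<bar> \<le> R" for i using component_le_norm_cart[of x i] by linarith
      then show ?thesis by (simp add: indicator_def prod_ennreal)
    qed (simp add: indicator_def)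
  qed
  also have "\<dots> = (\<Prod>i\<in>UNIV. \<integral>\<^sup>+t. ennreal (\<bar>t\<bar> powr (- \<gamma> i)) * indicator {0..R} \<bar>t\<bar> \<partial>lborel)"
    by (rule nn_integral_lborel_vec_prod) measurable
  also have "\<dots> < \<infinity>"
  proof -
    have "(\<integral>\<^sup>+t. ennreal (\<bar>t\<bar> powr (- \<gamma> i)) * indicator {0..R} \<bar>t\<bar> \<partial>lborel)
        \<le> ennreal (2 * (R powr (- \<gamma> i + 1) / (- \<gamma> i + 1)))" for i
      using \<gamma>[of i] R by (intro nn_integral_even[where k="\<lambda>t. t powr (- \<gamma> i)"] has_integral_powr_from_0) auto
    then have *: "(\<integral>\<^sup>+t. ennreal (\<bar>t\<bar> powr (- \<gamma> i)) * indicator {0..R} \<bar>t\<bar> \<partial>lborel) < \<infinity>" for i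
      by (rule le_less_trans) simp
    have fin: "(\<Prod>i\<in>I. F i) < \<infinity>" if "\<And>i. F i < \<infinity>" for I :: "'n set" and F :: "'n \<Rightarrow> ennreal"
      by (induction I rule: infinite_finite_induct) (use that in \<open>auto simp: ennreal_mult_less_top\<close>)
    show ?thesis by (rule fin[OF *])
  qed
  finally show ?thesis .
qed

section \<open>The regularized ground state and integrals of its majorant\<close>

context ordered_coords
begin

text \<open>Written through logarithms, so that derivatives and comparisons of products of powers
  become linear in the exponents.\<close>

definition phi :: "(nat \<Rightarrow> real) \<Rightarrow> (nat \<Rightarrow> real) \<Rightarrow> real ^ 'n \<Rightarrow> real" where
  "phi a c x = exp (\<Sum>m=3..n. a m / 2 * ln (q c m x))"

text \<open>
  For \<open>A\<^sub>m \<ge> \<eta>\<close> this bounds \<open>\<phi>\<^sup>2\<close> up to a power of \<open>|x|\<close>, uniformly in the regularization. With \<open>\<eta> = 0\<close> it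
  has degree \<open>2 - n\<close>; with \<open>\<eta> > 0\<close> its quotient by \<open>|X\<^sub>3|\<^sup>2\<close> is still locally integrable.
\<close>
definition weight :: "real \<Rightarrow> real ^ 'n \<Rightarrow> real" where
  "weight \<eta> x = r 3 x powr (\<eta> - 1 / 2) * (\<Prod>m=4..n. r m x powr (- 1 / 2))"

lemma weight_nonneg [simp]: "0 \<le> weight \<eta> x"
  unfolding weight_def by (intro mult_nonneg_nonneg prod_nonneg) auto

lemma weight_measurable [measurable]: "weight \<eta> \<in> borel_measurable borel"
  unfolding weight_def by measurable

lemma phi_has_derivative:
  assumes c: "\<And>m. m \<in> {3..n} \<Longrightarrow> c m > 0"
  shows "(phi a c has_derivative (\<lambda>v. (phi a c x *\<^sub>R T a c x) \<bullet> v)) (at x)"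
proof -
  have q: "q c m x > 0" if "m \<in> {3..n}" for m using q_pos[of c m x] c[OF that] by simp
  have dq: "((\<lambda>x. q c m x) has_derivative (\<lambda>v. (2 *\<^sub>R P m x) \<bullet> v)) (at x)" for m
    unfolding q_def by (rule has_derivative_eq_rhs[OF has_derivative_add[OF r_has_derivative has_derivative_const]]) simp
  have "((\<lambda>x. a m / 2 * ln (q c m x)) has_derivative (\<lambda>v. a m / q c m x * (P m x \<bullet> v))) (at x)" if m: "m \<in> {3..n}" for m
    using q[OF m] by (auto intro!: derivative_eq_intros dq simp: field_simps)
  then have "((\<lambda>x. \<Sum>m=3..n. a m / 2 * ln (q c m x)) has_derivative (\<lambda>v. \<Sum>m=3..n. a m / q c m x * (P m x \<bullet> v))) (at x)"
    by (intro has_derivative_sum) auto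
  then have "((\<lambda>x. exp (\<Sum>m=3..n. a m / 2 * ln (q c m x))) has_derivative
      (\<lambda>v. exp (\<Sum>m=3..n. a m / 2 * ln (q c m x)) * (\<Sum>m=3..n. a m / q c m x * (P m x \<bullet> v)))) (at x)"
    by (rule has_derivative_eq_rhs[OF has_derivative_exp]) (simp add: mult.commute)
  then show ?thesis
    by (simp add: phi_def[abs_def] inner_commute[of "T a c x"] inner_T inner_commute[of "P _ x"])
qed

text \<open>Summation by parts: the coefficient A_m - \<eta> >= 0 is moved from y_m to the larger
  y_(m+1), until it is left with the top level. With y_m = ln q_m the sum is the logarithm of
  \<phi>^2.\<close>

lemma weighted_sum_le:
  fixes A a y :: "nat \<Rightarrow> real"
  assumes A2: "A 2 = 0" and a: "\<And>m. a m = A m - A (m - 1) - 1 / 2"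
    and A: "\<And>m. m \<in> {3..n} \<Longrightarrow> \<eta> \<le> A m" and y: "\<And>m. y m \<le> y (Suc m)"
  shows "3 + j \<le> n \<Longrightarrow> (\<Sum>m=3..3+j. a m * y m) \<le> (A (3 + j) - \<eta>) * y (3 + j) + (\<eta> - 1 / 2) * y 3 - (\<Sum>m=4..3+j. y m) / 2"
proof (induction j)
  case 0
  have a3: "a 3 = A 3 - 1 / 2" using a[of 3] A2 by simp
  show ?case by (simp add: a3 field_simps)
next
  case (Suc j)
  have e: "3 + Suc j = Suc (3 + j)" by simp
  have aS: "a (3 + Suc j) = A (3 + Suc j) - A (3 + j) - 1 / 2" using a[of "3 + Suc j"] by simp
  have "(A (3 + j) - \<eta>) * (y (3 + j) - y (3 + Suc j)) \<le> 0"
    using A[of "3 + j"] y[of "3 + j"] Suc.prems by (intro mult_nonneg_nonpos) auto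
  moreover have "(\<Sum>m=3..3+Suc j. a m * y m) = (\<Sum>m=3..3+j. a m * y m) + a (3 + Suc j) * y (3 + Suc j)"
    unfolding e by (simp only: sum.cl_ivl_Suc) simp
  moreover have "(\<Sum>m=4..3+Suc j. y m) = (\<Sum>m=4..3+j. y m) + y (3 + Suc j)"
    unfolding e by (simp only: sum.cl_ivl_Suc) simp
  moreover have "(\<Sum>m=3..3+j. a m * y m) \<le> (A (3 + j) - \<eta>) * y (3 + j) + (\<eta> - 1 / 2) * y 3 - (\<Sum>m=4..3+j. y m) / 2"
    using Suc by simp
  moreover have "S + (B' - B - 1 / 2) * z' \<le> (B' - \<eta>) * z' + h - (R + z') / 2"
    if "(B - \<eta>) * (z - z') \<le> 0" "S \<le> (B - \<eta>) * z + h - R / 2" for S B B' z z' h R :: real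
    using that by (simp add: field_simps)
  ultimately show ?case unfolding aS by simp
qed

text \<open>One common \<delta> keeps q_m increasing in m, as summation by parts requires. The
  remaining exponents \<eta> - 1/2 and -1/2 are at most 0, so replacing q_m by the smaller |X_m|^2
  can only increase those factors; only the top level keeps its regularized form.\<close>

lemma phi_power2_le:
  fixes A a :: "nat \<Rightarrow> real"
  assumes A2: "A 2 = 0" and a: "\<And>m. a m = A m - A (m - 1) - 1 / 2"
    and A: "\<And>m. m \<in> {3..n} \<Longrightarrow> \<eta> \<le> A m" and \<eta>: "\<eta> \<le> 1 / 2" and \<delta>: "\<delta> > 0" and x: "r 3 x > 0"
  shows "(phi a (\<lambda>_. \<delta>) x)\<^sup>2 \<le> q (\<lambda>_. \<delta>) n x powr (A n - \<eta>) * weight \<eta> x"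
proof -
  define y where "y m = ln (q (\<lambda>_. \<delta>) m x)" for m
  have qp: "q (\<lambda>_. \<delta>) m x > 0" for m using q_pos[of "\<lambda>_. \<delta>" m x] \<delta> by simp
  have y: "y m \<le> y (Suc m)" for m
    unfolding y_def using qp[of m] qp[of "Suc m"] r_mono[of m "Suc m" x] by (simp add: q_def)
  have rp: "r m x > 0" if "m \<ge> 3" for m using r_mono[of 3 m x] x that by simp
  have lr: "ln (r m x) \<le> y m" if "m \<ge> 3" for m
    unfolding y_def using rp[OF that] \<delta> by (simp add: q_def)
  have n: "3 + (n - 3) = n" using n3 by simp
  have "(\<Sum>m=3..n. a m * y m) \<le> (A n - \<eta>) * y n + (\<eta> - 1 / 2) * y 3 - (\<Sum>m=4..n. y m) / 2"
    using weighted_sum_le[where A = A and a = a and y = y and \<eta> = \<eta> and j = "n - 3", OF A2 a A y] unfolding n by simp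
  also have "\<dots> \<le> (A n - \<eta>) * y n + (\<eta> - 1 / 2) * ln (r 3 x) + (\<Sum>m=4..n. - 1 / 2 * ln (r m x))"
  proof -
    have "(\<eta> - 1 / 2) * y 3 \<le> (\<eta> - 1 / 2) * ln (r 3 x)" using \<eta> lr[of 3] by (intro mult_left_mono_neg) auto
    moreover have "(\<Sum>m=4..n. ln (r m x)) \<le> (\<Sum>m=4..n. y m)" by (intro sum_mono lr) auto
    ultimately show ?thesis unfolding sum_distrib_left[symmetric] by simp
  qed
  finally have "exp (\<Sum>m=3..n. a m * y m) \<le> exp ((A n - \<eta>) * y n + (\<eta> - 1 / 2) * ln (r 3 x) + (\<Sum>m=4..n. - 1 / 2 * ln (r m x)))"
    by simp
  also have "\<dots> = exp ((A n - \<eta>) * y n) * (exp ((\<eta> - 1 / 2) * ln (r 3 x)) * (\<Prod>m=4..n. exp (- 1 / 2 * ln (r m x))))"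
    by (simp only: exp_add exp_sum finite_atLeastAtMost mult.assoc)
  also have "\<dots> = q (\<lambda>_. \<delta>) n x powr (A n - \<eta>) * weight \<eta> x"
  proof -
    have pw: "exp (s * ln z) = z powr s" if "z > 0" for s z :: real using that by (simp add: powr_def)
    have "(\<Prod>m=4..n. exp (- 1 / 2 * ln (r m x))) = (\<Prod>m=4..n. r m x powr (- 1 / 2))"
      by (intro prod.cong refl pw rp) auto
    then show ?thesis unfolding weight_def y_def by (simp only: pw[OF qp] pw[OF x])
  qed
  also have "exp (\<Sum>m=3..n. a m * y m) = (phi a (\<lambda>_. \<delta>) x)\<^sup>2"
    unfolding phi_def exp_double[symmetric] y_def by (simp add: sum_distrib_left)
  finally show ?thesis .
qed

text \<open>The integrand is |X_3|^(2 \<eta> - 3) times the product of the |X_m|^(-1), m >= 4. The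
  bound 1 / |x_m| would just fail to be integrable, so a little of the slack 2 \<eta> at X_3 is
  spent: |X_m|^(-1) <= |x_m|^(-(1 - \<mu>)) |X_3|^(-\<mu>). The resulting power |X_3|^(-2 G) is
  shared equally among three coordinates, by the inequality of arithmetic and geometric
  means.\<close>

lemma weight_locally_integrable:
  assumes \<eta>: "0 < \<eta>" "\<eta> \<le> 1 / 2" and R: "R \<ge> 0"
  shows "(\<integral>\<^sup>+x. ennreal (weight \<eta> x / r 3 x) * indicator (cball 0 R) x \<partial>lborel) < \<infinity>"
proof -
  have N: "real n \<ge> 3" using n3 by simp
  \<comment> \<open>With \<mu> = \<eta> / n the levels 4, ..., n spend (n - 3) \<mu> < \<eta>, so G
    stays below 3/2 and each of the first three coordinates gets an exponent 2 G / 3 < 1.\<close>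
  define \<mu> where "\<mu> = \<eta> / real n"
  have \<mu>: "0 < \<mu>" "\<mu> < 1" "real n * \<mu> = \<eta>" using \<eta> N by (auto simp: \<mu>_def field_simps)
  define G where "G = 3 / 2 - \<eta> + (real n - 3) * \<mu> / 2"
  have G: "G > 0" "G < 3 / 2"
  proof -
    have "(real n - 3) * \<mu> \<ge> 0" using N \<mu> by simp
    then show "G > 0" using \<eta> by (simp add: G_def)
    have "(real n - 3) * \<mu> < \<eta>" using \<mu> by (simp add: algebra_simps)
    then show "G < 3 / 2" using \<eta> by (simp add: G_def)
  qed
  define g where "g m = (if m \<le> 3 then 2 * G / 3 else 1 - \<mu>)" for m :: nat
  define \<gamma> where "\<gamma> i = g (inv_into {1..n} e i)" for i
  have \<gamma>1: "\<gamma> i < 1" for i using G \<mu> by (simp add: \<gamma>_def g_def)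
  have pt: "weight \<eta> x / r 3 x \<le> (\<Prod>i\<in>UNIV. \<bar>x $ i\<bar> powr (- \<gamma> i))" if x: "\<forall>i. x $ i \<noteq> 0" for x :: "real ^ 'n"
  proof -
    define l where "l m = ln ((x $ e m)\<^sup>2)" for m
    have le: "(x $ e i)\<^sup>2 \<le> r m x" if "1 \<le> i" "i \<le> m" for i m using that by (intro coordinate_le_r) auto
    have xp: "(x $ e m)\<^sup>2 > 0" for m using x by simp
    have rp: "r m x > 0" if "m \<ge> 3" for m using le[of 1 m] xp[of 1] that by linarith
    have ly: "l i \<le> ln (r m x)" if "1 \<le> i" "i \<le> m" "m \<ge> 3" for i m
      unfolding l_def using le[OF that(1,2)] xp[of i] rp[OF that(3)] by simp
    define y where "y m = ln (r m x)" for m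
    have y3: "(l 1 + l 2 + l 3) / 3 \<le> y 3" using ly[of 1 3] ly[of 2 3] ly[of 3 3] by (simp add: y_def)
    have ym: "(1 - \<mu>) * l m + \<mu> * y 3 \<le> y m" if "m \<ge> 4" for m
    proof -
      have "l m \<le> y m" "y 3 \<le> y m" using ly[of m m] that rp[of 3] r_mono[of 3 m x] rp[of m] by (auto simp: y_def)
      then have "(1 - \<mu>) * l m + \<mu> * y 3 \<le> (1 - \<mu>) * y m + \<mu> * y m" using \<mu> by (intro add_mono mult_left_mono) auto
      then show ?thesis by (simp add: algebra_simps)
    qed
    have S: "(\<Sum>m=4..n. (1 - \<mu>) * l m) + (real n - 3) * (\<mu> * y 3) \<le> (\<Sum>m=4..n. y m)"
    proof -
      have "(\<Sum>m=4..n. (1 - \<mu>) * l m + \<mu> * y 3) \<le> (\<Sum>m=4..n. y m)" by (intro sum_mono ym) auto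
      then show ?thesis using n3 by (simp add: sum.distrib of_nat_diff)
    qed
    have "(\<eta> - 1 / 2) * y 3 + (\<Sum>m=4..n. - 1 / 2 * y m) - y 3 \<le> - G * y 3 + (\<Sum>m=4..n. - (1 - \<mu>) / 2 * l m)"
    proof -
      have "(\<Sum>m=4..n. - (1 - \<mu>) / 2 * l m) = - (\<Sum>m=4..n. (1 - \<mu>) * l m) / 2"
        unfolding sum_divide_distrib sum_negf[symmetric] by (intro sum.cong) (auto simp: field_simps)
      moreover have "(\<Sum>m=4..n. - 1 / 2 * y m) = - (\<Sum>m=4..n. y m) / 2"
        unfolding sum_divide_distrib sum_negf[symmetric] by (intro sum.cong) auto
      ultimately show ?thesis using S by (simp add: G_def field_simps)
    qed
    also have "\<dots> \<le> - G * ((l 1 + l 2 + l 3) / 3) + (\<Sum>m=4..n. - (1 - \<mu>) / 2 * l m)"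
      using y3 G by (intro add_right_mono mult_left_mono_neg) auto
    also have "\<dots> = (\<Sum>m=1..n. - g m / 2 * l m)"
    proof -
      have "{1..n} = {1..3} \<union> {4..n}" using n3 by auto
      then have "(\<Sum>m=1..n. - g m / 2 * l m) = (\<Sum>m=1..3. - g m / 2 * l m) + (\<Sum>m=4..n. - g m / 2 * l m)"
        by (simp only:) (rule sum.union_disjoint, auto)
      moreover have "(\<Sum>m=1..3. - g m / 2 * l m) = - G * ((l 1 + l 2 + l 3) / 3)"
        by (simp add: g_def numeral_3_eq_3 field_simps) (simp add: numeral_2_eq_2)
      moreover have "(\<Sum>m=4..n. - g m / 2 * l m) = (\<Sum>m=4..n. - (1 - \<mu>) / 2 * l m)"
        by (intro sum.cong) (auto simp: g_def)
      ultimately show ?thesis by simp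
    qed
    finally have "exp ((\<eta> - 1 / 2) * y 3 + (\<Sum>m=4..n. - 1 / 2 * y m) - y 3) \<le> exp (\<Sum>m=1..n. - g m / 2 * l m)" by simp
    moreover have "exp ((\<eta> - 1 / 2) * y 3 + (\<Sum>m=4..n. - 1 / 2 * y m) - y 3) = weight \<eta> x / r 3 x"
    proof -
      have pw: "exp (s * ln z) = z powr s" if "z > 0" for s z :: real using that by (simp add: powr_def)
      have "exp ((\<eta> - 1 / 2) * y 3 + (\<Sum>m=4..n. - 1 / 2 * y m) - y 3)
        = exp ((\<eta> - 1 / 2) * y 3) * (\<Prod>m=4..n. exp (- 1 / 2 * y m)) / exp (y 3)"
        by (simp only: exp_add exp_diff exp_sum finite_atLeastAtMost)
      moreover have "(\<Prod>m=4..n. exp (- 1 / 2 * y m)) = (\<Prod>m=4..n. r m x powr (- 1 / 2))"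
        unfolding y_def by (intro prod.cong refl pw rp) auto
      moreover have "exp ((\<eta> - 1 / 2) * y 3) = r 3 x powr (\<eta> - 1 / 2)" unfolding y_def by (intro pw rp) auto
      moreover have "exp (y 3) = r 3 x" unfolding y_def using rp[of 3] by simp
      ultimately show ?thesis by (simp only: weight_def)
    qed
    moreover have "exp (\<Sum>m=1..n. - g m / 2 * l m) = (\<Prod>m=1..n. \<bar>x $ e m\<bar> powr (- g m))"
    proof -
      have "exp (- g m / 2 * l m) = \<bar>x $ e m\<bar> powr (- g m)" for m
      proof -
        have "l m = 2 * ln \<bar>x $ e m\<bar>" using x ln_realpow[of "\<bar>x $ e m\<bar>" 2] by (simp add: l_def)
        then show ?thesis using x by (simp add: powr_def)
      qed
      then show ?thesis by (simp only: exp_sum finite_atLeastAtMost)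
    qed
    moreover have "(\<Prod>m=1..n. \<bar>x $ e m\<bar> powr (- g m)) = (\<Prod>i\<in>UNIV. \<bar>x $ i\<bar> powr (- \<gamma> i))"
    proof -
      have "(\<Prod>m=1..n. \<bar>x $ e m\<bar> powr (- g m)) = (\<Prod>m=1..n. \<bar>x $ e m\<bar> powr (- \<gamma> (e m)))"
        using bij by (intro prod.cong refl) (simp add: \<gamma>_def bij_betw_def inv_into_f_f)
      also have "\<dots> = (\<Prod>i\<in>UNIV. \<bar>x $ i\<bar> powr (- \<gamma> i))" by (rule prod.reindex_bij_betw[OF bij])
      finally show ?thesis .
    qed
    ultimately show ?thesis by linarith
  qed
  have "(\<integral>\<^sup>+x. ennreal (weight \<eta> x / r 3 x) * indicator (cball 0 R) x \<partial>lborel)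
    \<le> (\<integral>\<^sup>+x. ennreal (\<Prod>i\<in>UNIV. \<bar>x $ i\<bar> powr (- \<gamma> i)) * indicator (cball 0 R) x \<partial>lborel)"
  proof (rule nn_integral_mono_AE)
    show "AE x in lborel. ennreal (weight \<eta> x / r 3 x) * indicator (cball 0 R) x
      \<le> ennreal (\<Prod>i\<in>UNIV. \<bar>x $ i\<bar> powr (- \<gamma> i)) * indicator (cball 0 R) x"
      using AE_coordinates_nonzero by eventually_elim (intro mult_right_mono ennreal_leI pt, auto)
  qed
  also have "\<dots> < \<infinity>" by (rule coordinate_powers_locally_integrable[OF \<gamma>1 R])
  finally show ?thesis .
qed

lemma r_scale: "r m (R *\<^sub>R x) = R\<^sup>2 * r m x"
  by (simp add: r_eq_sum sum_distrib_left power_mult_distrib)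

lemma weight_scale:
  assumes R: "R > 0"
  shows "weight 0 (R *\<^sub>R x) = R powr (2 - real n) * weight 0 x"
proof -
  have R2: "R\<^sup>2 = R powr 2" using R by simp
  have "(R powr 2) powr (- 1 / 2) = 1 / R" unfolding powr_powr using R by (simp add: powr_neg_one)
  then have s: "(R\<^sup>2 * y) powr (- 1 / 2) = (1 / R) * y powr (- 1 / 2)" if "y \<ge> 0" for y
    unfolding R2 using R that by (subst powr_mult) auto
  have "weight 0 (R *\<^sub>R x) = (1 / R) * r 3 x powr (- 1 / 2) * (\<Prod>m=4..n. (1 / R) * r m x powr (- 1 / 2))"
    using s by (simp add: weight_def r_scale)
  also have "\<dots> = (1 / R) * (1 / R) ^ (n - 3) * weight 0 x"
  proof -
    have "(\<Prod>m=4..n. (1 / R) * r m x powr (- 1 / 2)) = (1 / R) ^ (n - 3) * (\<Prod>m=4..n. r m x powr (- 1 / 2))"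
      unfolding prod.distrib using n3 by simp
    then show ?thesis by (simp add: weight_def)
  qed
  also have "(1 / R) * (1 / R) ^ (n - 3) = (1 / R) ^ (n - 2)"
  proof -
    have "n - 2 = Suc (n - 3)" using n3 by simp
    then show ?thesis by simp
  qed
  also have "\<dots> = R powr (2 - real n)"
  proof -
    have "2 - real n = - real (n - 2)" using n3 by (simp add: of_nat_diff)
    then show ?thesis using R by (simp only: powr_minus powr_realpow) (simp add: power_one_over inverse_eq_divide)
  qed
  finally show ?thesis .
qed

text \<open>Dilation contributes R^n from Lebesgue measure and R^(2 - n) from the homogeneity of the
  weight.\<close>

lemma weight_ball_integral:
  assumes R: "R > 0"
  shows "(\<integral>\<^sup>+x. ennreal (weight 0 x) * indicator (cball 0 R) x \<partial>lborel)
    = ennreal (R\<^sup>2) * (\<integral>\<^sup>+x. ennreal (weight 0 x) * indicator (cball 0 1) x \<partial>lborel)"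
proof -
  have eq: "(lborel :: (real ^ 'n) measure) = density (distr lborel borel (\<lambda>x. 0 + R *\<^sub>R x)) (\<lambda>_. \<bar>R\<bar> ^ DIM(real ^ 'n))"
    using R by (intro lborel_affine) simp
  have "(\<integral>\<^sup>+x. ennreal (weight 0 x) * indicator (cball 0 R) x \<partial>lborel)
    = (\<integral>\<^sup>+x. ennreal (R ^ n) * (ennreal (weight 0 (R *\<^sub>R x)) * indicator (cball 0 R) (R *\<^sub>R x)) \<partial>lborel)"
  proof -
    define g where "g x = ennreal (weight 0 x) * indicator (cball 0 R) x" for x
    have [measurable]: "g \<in> borel_measurable borel"
      unfolding g_def by (auto intro!: borel_measurable_times_ennreal borel_measurable_indicator)
    have "(\<integral>\<^sup>+x. g x \<partial>lborel) = (\<integral>\<^sup>+x. g x \<partial>density (distr lborel borel (\<lambda>x. 0 + R *\<^sub>R x)) (\<lambda>_. \<bar>R\<bar> ^ DIM(real ^ 'n)))"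
      using eq by simp
    also have "\<dots> = (\<integral>\<^sup>+x. \<bar>R\<bar> ^ DIM(real ^ 'n) * g x \<partial>distr lborel borel (\<lambda>x. 0 + R *\<^sub>R x))"
      by (rule nn_integral_density) auto
    also have "\<dots> = (\<integral>\<^sup>+x. \<bar>R\<bar> ^ DIM(real ^ 'n) * g (0 + R *\<^sub>R x) \<partial>lborel)"
      by (rule nn_integral_distr) auto
    finally show ?thesis using R by (simp add: g_def card_n)
  qed
  also have "\<dots> = (\<integral>\<^sup>+x. ennreal (R\<^sup>2) * (ennreal (weight 0 x) * indicator (cball 0 1) x) \<partial>lborel)"
  proof (intro nn_integral_cong)
    fix x :: "real ^ 'n"
    have "R ^ n * R powr (2 - real n) = R powr (real n + (2 - real n))"
      using R by (simp only: powr_add powr_realpow)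
    then have "R ^ n * R powr (2 - real n) = R\<^sup>2" using R by simp
    then have "R ^ n * (R powr (2 - real n) * weight 0 x) = R\<^sup>2 * weight 0 x" by (simp only: mult.assoc[symmetric])
    moreover have "indicator (cball 0 R) (R *\<^sub>R x) = (indicator (cball 0 1) x :: ennreal)" using R by (simp add: indicator_def)
    moreover from calculation(1) have "ennreal (R ^ n) * ennreal (weight 0 (R *\<^sub>R x)) = ennreal (R\<^sup>2) * ennreal (weight 0 x)"
      using R by (subst (1 2) ennreal_mult[symmetric]) (auto simp: weight_scale)
    ultimately show "ennreal (R ^ n) * (ennreal (weight 0 (R *\<^sub>R x)) * indicator (cball 0 R) (R *\<^sub>R x))
        = ennreal (R\<^sup>2) * (ennreal (weight 0 x) * indicator (cball 0 1) x)"
      by (simp only: mult.assoc[symmetric])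
  qed
  also have "\<dots> = ennreal (R\<^sup>2) * (\<integral>\<^sup>+x. ennreal (weight 0 x) * indicator (cball 0 1) x \<partial>lborel)"
    by (rule nn_integral_cmult) (auto intro!: borel_measurable_times_ennreal borel_measurable_indicator)
  finally show ?thesis .
qed

text \<open>On the unit ball |X_3| <= 1, so the more singular function with \<eta> = 1/4 divided by
  |X_3|^2 dominates.\<close>

lemma weight_unit_ball_finite: "(\<integral>\<^sup>+x. ennreal (weight 0 x) * indicator (cball 0 1) x \<partial>lborel) < \<infinity>"
proof -
  have "(\<integral>\<^sup>+x. ennreal (weight 0 x) * indicator (cball 0 1) x \<partial>lborel)
    \<le> (\<integral>\<^sup>+x. ennreal (weight (1 / 4) x / r 3 x) * indicator (cball 0 1) x \<partial>lborel)"
  proof (rule nn_integral_mono)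
    fix x :: "real ^ 'n"
    show "ennreal (weight 0 x) * indicator (cball 0 1) x \<le> ennreal (weight (1 / 4) x / r 3 x) * indicator (cball 0 1) x"
    proof (cases "norm x \<le> 1 \<and> r 3 x > 0")
      case True
      have "r 3 x \<le> r n x" using n3 by (intro r_mono)
      also have "\<dots> \<le> 1" using True by (simp add: r_n abs_square_le_1)
      finally have "r 3 x powr (- 1 / 2) \<le> r 3 x powr (- 5 / 4)" using True by (intro powr_mono') auto
      also have "\<dots> = r 3 x powr (1 / 4 - 1 / 2) / r 3 x" using True powr_diff[of "r 3 x" "- 1 / 4" 1] by simp
      finally have "weight 0 x \<le> weight (1 / 4) x / r 3 x"
        unfolding weight_def times_divide_eq_left[symmetric] by (intro mult_right_mono prod_nonneg) auto
      then show ?thesis by (intro mult_right_mono ennreal_leI) auto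
    next
      case False
      then have "norm x > 1 \<or> r 3 x = 0" using r_nonneg[of 3 x] by linarith
      then show ?thesis by (auto simp: weight_def)
    qed
  qed
  also have "\<dots> < \<infinity>" by (rule weight_locally_integrable) auto
  finally show ?thesis .
qed

end

text \<open>
  If some \<open>A\<^sub>m\<close> vanishes, \<open>\<phi>\<close> is not locally of finite energy. The perturbed exponents are positive and
  keep all coefficients of the potential except the one of \<open>1 / |X\<^sub>3|\<^sup>2\<close>, which decreases: the resulting
  error in the energy has the right sign and needs no estimate.
\<close>
lemma perturbed_exponents:
  fixes A :: "nat \<Rightarrow> real" and \<epsilon> :: real
  assumes A: "\<And>m. 0 \<le> A m" and \<epsilon>: "\<epsilon> > 0"
  obtains A' \<delta> where "\<delta> > 0" "A' 2 = 0" "\<And>m. m \<in> {3..n} \<Longrightarrow> 0 < A' m" "\<And>m. m \<in> {3..n} \<Longrightarrow> A' m \<le> A m + \<epsilon>"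
    "(A' 3)\<^sup>2 = (A 3)\<^sup>2 + \<delta>"
    "\<And>m. m \<in> {4..n} \<Longrightarrow> (A' (m - 1) + 1 / 2)\<^sup>2 - (A' m)\<^sup>2 = (A (m - 1) + 1 / 2)\<^sup>2 - (A m)\<^sup>2"
proof -
  \<comment> \<open>\<open>G \<delta> k\<close> is the new exponent at level 3 + k: the square at
    level 3 is raised by \<open>\<delta>\<close>, and each later level solves the equation that
    keeps its potential coefficient. The result exceeds A at every level and tends to A as
    \<open>\<delta>\<close> tends to 0.\<close>
  define G where "G \<delta> k = rec_nat (sqrt ((A 3)\<^sup>2 + \<delta>)) (\<lambda>k g. sqrt ((A (4 + k))\<^sup>2 + (g + 1 / 2)\<^sup>2 - (A (3 + k) + 1 / 2)\<^sup>2)) k" for \<delta> :: real and k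
  have G0: "G \<delta> 0 = sqrt ((A 3)\<^sup>2 + \<delta>)" for \<delta> by (simp add: G_def)
  have GS: "G \<delta> (Suc k) = sqrt ((A (4 + k))\<^sup>2 + (G \<delta> k + 1 / 2)\<^sup>2 - (A (3 + k) + 1 / 2)\<^sup>2)" for \<delta> k by (simp add: G_def)
  have gt: "A (3 + k) < G \<delta> k" if \<delta>: "\<delta> > 0" for \<delta> k
  proof (induction k)
    case 0
    show ?case unfolding G0 using \<delta> A by (intro real_less_rsqrt) simp
  next
    case (Suc k)
    have "(A (3 + k) + 1 / 2)\<^sup>2 < (G \<delta> k + 1 / 2)\<^sup>2" using Suc A[of "3 + k"] by (intro power_strict_mono) auto
    then have "A (4 + k) < G \<delta> (Suc k)" unfolding GS by (intro real_less_rsqrt) simp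
    then show ?case by simp
  qed
  have lim: "((\<lambda>\<delta>. G \<delta> k) \<longlongrightarrow> A (3 + k)) (at_right 0)" for k
  proof (induction k)
    case 0
    have "((\<lambda>\<delta>. sqrt ((A 3)\<^sup>2 + \<delta>)) \<longlongrightarrow> sqrt ((A 3)\<^sup>2 + 0)) (at_right 0)" by (intro tendsto_intros)
    then show ?case using A[of 3] by (simp add: G0)
  next
    case (Suc k)
    have "((\<lambda>\<delta>. G \<delta> (Suc k)) \<longlongrightarrow> sqrt ((A (4 + k))\<^sup>2 + (A (3 + k) + 1 / 2)\<^sup>2 - (A (3 + k) + 1 / 2)\<^sup>2)) (at_right 0)"
      unfolding GS by (intro tendsto_intros Suc)
    then show ?case using A[of "4 + k"] by simp
  qed
  have "\<forall>\<^sub>F \<delta> in at_right 0. \<forall>k\<in>{..n}. G \<delta> k < A (3 + k) + \<epsilon>"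
    using \<epsilon> by (intro eventually_ball_finite ballI order_tendstoD(2)[OF lim]) auto
  moreover have "\<forall>\<^sub>F \<delta> in at_right (0::real). 0 < \<delta>" by (rule eventually_at_right_less)
  ultimately have "\<forall>\<^sub>F \<delta> in at_right 0. 0 < \<delta> \<and> (\<forall>k\<in>{..n}. G \<delta> k < A (3 + k) + \<epsilon>)" by eventually_elim auto
  then obtain \<delta> where \<delta>: "\<delta> > 0" "\<And>k. k \<le> n \<Longrightarrow> G \<delta> k < A (3 + k) + \<epsilon>"
    using eventually_happens'[of "at_right (0::real)"] by force
  define A' where "A' m = (if m \<le> 2 then 0 else G \<delta> (m - 3))" for m
  show ?thesis
  proof (rule that[of \<delta> A'])
    show "\<delta> > 0" by (rule \<delta>)
    show "A' 2 = 0" by (simp add: A'_def)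
    show "0 < A' m" if "m \<in> {3..n}" for m
      using gt[OF \<delta>(1), of "m - 3"] A[of m] that by (simp add: A'_def)
    show "A' m \<le> A m + \<epsilon>" if "m \<in> {3..n}" for m
    proof -
      have "m - 3 \<le> n" "3 + (m - 3) = m" using that by auto
      then show ?thesis using \<delta>(2)[of "m - 3"] that by (simp add: A'_def)
    qed
    show "(A' 3)\<^sup>2 = (A 3)\<^sup>2 + \<delta>" using \<delta>(1) by (simp add: A'_def G0)
    fix m assume m: "m \<in> {4..n}"
    then obtain k where k: "m = 4 + k" by (metis atLeastAtMost_iff le_Suc_ex)
    have "(A (3 + k) + 1 / 2)\<^sup>2 \<le> (G \<delta> k + 1 / 2)\<^sup>2" using gt[OF \<delta>(1), of k] A[of "3 + k"] by (intro power_mono) auto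
    then have "0 \<le> (A (4 + k))\<^sup>2 + (G \<delta> k + 1 / 2)\<^sup>2 - (A (3 + k) + 1 / 2)\<^sup>2"
      using zero_le_power2[of "A (4 + k)"] by linarith
    then have "(G \<delta> (Suc k))\<^sup>2 = (A (4 + k))\<^sup>2 + (G \<delta> k + 1 / 2)\<^sup>2 - (A (3 + k) + 1 / 2)\<^sup>2" by (simp add: GS)
    then show "(A' (m - 1) + 1 / 2)\<^sup>2 - (A' m)\<^sup>2 = (A (m - 1) + 1 / 2)\<^sup>2 - (A m)\<^sup>2"
      by (simp add: A'_def k)
  qed
qed


lemma bump_nonneg: "0 \<le> bump t" and bump_le_1: "bump t \<le> 1" and bump_eq_0: "t \<le> 0 \<Longrightarrow> bump t = 0"
  by (auto simp: bump_def)

lemma power2_power_2: "((2::real) ^ k)\<^sup>2 = 4 ^ k"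
  by (simp add: power2_eq_square flip: power_mult_distrib)

text \<open>In the shell 2^N < |x| <= 2^(N+1) the left-hand side is at most 4^(-N), the coefficient
  of the ball of radius 2^(N+1). Summing over balls matches the scaling law of the weight.\<close>

lemma dyadic_bound:
  fixes x :: "'a::real_normed_vector"
  shows "norm x \<le> 2 ^ N \<Longrightarrow> 1 / (1 + (norm x)\<^sup>2) \<le> (\<Sum>j\<le>N. 4 / 4 ^ j * indicator (cball 0 (2 ^ j)) x)"
proof (induction N)
  case 0
  have "1 / (1 + (norm x)\<^sup>2) \<le> 1" by (simp add: field_simps add_pos_nonneg)
  then show ?case using 0 by simp
next
  case (Suc N)
  show ?case
  proof (cases "norm x \<le> 2 ^ N")
    case True
    then show ?thesis using Suc.IH by (simp add: add_increasing2)
  next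
    case False
    then have "(2 ^ N)\<^sup>2 \<le> (norm x)\<^sup>2" by (intro power_mono) auto
    then have "4 ^ N \<le> 1 + (norm x)\<^sup>2" by (simp add: power2_power_2)
    then have "1 / (1 + (norm x)\<^sup>2) \<le> 1 / 4 ^ N" by (intro divide_left_mono) (auto simp: add_pos_nonneg)
    also have "\<dots> = 4 / 4 ^ Suc N * indicator (cball 0 (2 ^ Suc N)) x" using Suc.prems by simp
    also have "\<dots> \<le> (\<Sum>j\<le>Suc N. 4 / 4 ^ j * indicator (cball 0 (2 ^ j)) x)" by (intro member_le_sum) auto
    finally show ?thesis .
  qed
qed

section \<open>The logarithmic cutoff and the cost of its gradient\<close>

context ordered_coords
begin

text \<open>The integral of the weight over the ball of radius 2^j scales like 4^j and cancels the
  dyadic coefficient, so each of the N + 1 balls contributes the same amount. The growth is linear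
  in N, logarithmic in the radius.\<close>

lemma weight_log_bound:
  obtains F where "F \<ge> 0" "\<And>N. (\<integral>\<^sup>+x. ennreal (weight 0 x * (1 / (1 + (norm x)\<^sup>2))) * indicator (cball 0 (2 ^ N)) x \<partial>lborel)
    \<le> ennreal (4 * (real N + 1) * F)"
proof -
  define W where "W R = (\<integral>\<^sup>+x. ennreal (weight 0 x) * indicator (cball 0 R) x \<partial>lborel)" for R
  define F where "F = enn2real (W 1)"
  have F: "W 1 = ennreal F" unfolding F_def W_def using weight_unit_ball_finite by simp
  have F0: "F \<ge> 0" by (simp add: F_def)
  have "(\<integral>\<^sup>+x. ennreal (weight 0 x * (1 / (1 + (norm x)\<^sup>2))) * indicator (cball 0 (2 ^ N)) x \<partial>lborel)
    \<le> ennreal (4 * (real N + 1) * F)" for N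
  proof -
    have "(\<integral>\<^sup>+x. ennreal (weight 0 x * (1 / (1 + (norm x)\<^sup>2))) * indicator (cball 0 (2 ^ N)) x \<partial>lborel)
      \<le> (\<integral>\<^sup>+x. (\<Sum>j\<le>N. ennreal (4 / 4 ^ j) * (ennreal (weight 0 x) * indicator (cball 0 (2 ^ j)) x)) \<partial>lborel)"
    proof (rule nn_integral_mono)
      fix x :: "real ^ 'n"
      have ind: "(indicator S x :: ennreal) = ennreal (indicator S x)" for S by (simp add: indicator_def)
      show "ennreal (weight 0 x * (1 / (1 + (norm x)\<^sup>2))) * indicator (cball 0 (2 ^ N)) x
        \<le> (\<Sum>j\<le>N. ennreal (4 / 4 ^ j) * (ennreal (weight 0 x) * indicator (cball 0 (2 ^ j)) x))"
      proof (cases "norm x \<le> 2 ^ N")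
        case True
        have "weight 0 x * (1 / (1 + (norm x)\<^sup>2)) \<le> weight 0 x * (\<Sum>j\<le>N. 4 / 4 ^ j * indicator (cball 0 (2 ^ j)) x)"
          by (intro mult_left_mono dyadic_bound True) simp
        also have "\<dots> = (\<Sum>j\<le>N. 4 / 4 ^ j * (weight 0 x * indicator (cball 0 (2 ^ j)) x))"
          by (simp add: sum_distrib_left mult_ac)
        finally have "ennreal (weight 0 x * (1 / (1 + (norm x)\<^sup>2))) \<le> ennreal (\<Sum>j\<le>N. 4 / 4 ^ j * (weight 0 x * indicator (cball 0 (2 ^ j)) x))"
          by (rule ennreal_leI)
        also have "\<dots> = (\<Sum>j\<le>N. ennreal (4 / 4 ^ j * (weight 0 x * indicator (cball 0 (2 ^ j)) x)))"
          by (rule sum_ennreal[symmetric]) auto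
        also have "\<dots> = (\<Sum>j\<le>N. ennreal (4 / 4 ^ j) * (ennreal (weight 0 x) * indicator (cball 0 (2 ^ j)) x))"
          unfolding ind
          by (intro sum.cong refl) (simp only: ennreal_mult mult_nonneg_nonneg divide_nonneg_nonneg
            zero_le_numeral zero_le_power weight_nonneg indicator_pos_le)
        finally show ?thesis using True by simp
      qed simp
    qed
    also have "\<dots> = (\<Sum>j\<le>N. \<integral>\<^sup>+x. ennreal (4 / 4 ^ j) * (ennreal (weight 0 x) * indicator (cball 0 (2 ^ j)) x) \<partial>lborel)"
      by (rule nn_integral_sum) (auto intro!: borel_measurable_times_ennreal borel_measurable_indicator)
    also have "\<dots> = (\<Sum>j\<le>N. ennreal (4 / 4 ^ j) * W (2 ^ j))"
      unfolding W_def by (intro sum.cong refl nn_integral_cmult) (auto intro!: borel_measurable_times_ennreal borel_measurable_indicator)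
    also have "\<dots> = (\<Sum>j\<le>N. ennreal (4 * F))"
    proof (intro sum.cong refl)
      fix j
      have "W (2 ^ j) = ennreal ((2 ^ j)\<^sup>2) * ennreal F"
        unfolding F[symmetric] unfolding W_def by (rule weight_ball_integral) simp
      then have "ennreal (4 / 4 ^ j) * W (2 ^ j) = ennreal (4 / 4 ^ j * ((2 ^ j)\<^sup>2 * F))"
        using F0 by (simp only: ennreal_mult mult_nonneg_nonneg divide_nonneg_nonneg zero_le_numeral zero_le_power)
      also have "4 / 4 ^ j * ((2 ^ j)\<^sup>2 * F) = 4 * F"
        by (simp add: power2_power_2)
      finally show "ennreal (4 / 4 ^ j) * W (2 ^ j) = ennreal (4 * F)" .
    qed
    also have "\<dots> = ennreal (4 * (real N + 1) * F)"
      using F0 by (subst sum_ennreal) (auto simp: algebra_simps)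
    finally show ?thesis .
  qed
  then show ?thesis by (rule that[OF F0])
qed

lemma Ck_fun_r: "Ck_fun k (r m)"
proof -
  have "Ck_fun k (\<lambda>x. \<Sum>i\<in>e ` {1..m}. x $ i * x $ i)" by (intro Ck_fun_sum Ck_fun_mult Ck_fun_coordinate)
  then show ?thesis by (simp add: r_eq_sum[abs_def] power2_eq_square)
qed

lemma Ck_fun_phi:
  assumes c: "\<And>m. c m > 0"
  shows "Ck_fun k (phi a c)"
proof -
  have "Ck_fun k (\<lambda>x. exp (\<Sum>m=3..n. a m / 2 * ln (r m x + c m)))"
    using c by (intro Ck_fun_exp Ck_fun_sum Ck_fun_mult Ck_fun_const Ck_fun_ln Ck_fun_add Ck_fun_r) (simp add: add_nonneg_pos)
  then show ?thesis by (simp add: phi_def[abs_def] q_def)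
qed

text \<open>It varies with the logarithm of the radius, and 1 + |x|^2 in place of |x|^2 keeps it
  smooth at the origin. There is no plateau; a positive lower bound on a fixed cube, uniform in N >=
  2, takes its place.\<close>

definition cutoff :: "real \<Rightarrow> real ^ 'n \<Rightarrow> real" where
  "cutoff N x = bump (1 - ln (1 + (norm x)\<^sup>2) / N)"

definition cutoff_grad :: "real \<Rightarrow> real ^ 'n \<Rightarrow> real ^ 'n" where
  "cutoff_grad N x = (bump_poly [:0, 0, 1:] (1 - ln (1 + (norm x)\<^sup>2) / N) * (- 2 / (N * (1 + (norm x)\<^sup>2)))) *\<^sub>R x"

lemma Ck_fun_cutoff: "Ck_fun k (cutoff N)"
proof -
  have "Ck_fun k (\<lambda>x. bump (1 + - 1 / N * ln (1 + r n x)))"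
    by (intro Ck_fun_bump Ck_fun_mult Ck_fun_const Ck_fun_ln Ck_fun_add Ck_fun_r) (simp add: add_pos_nonneg)
  then show ?thesis by (simp add: cutoff_def[abs_def] r_n)
qed

lemma cutoff_has_derivative:
  assumes N: "N > 0"
  shows "(cutoff N has_derivative (\<lambda>v. cutoff_grad N x \<bullet> v)) (at x)"
proof -
  have p: "1 + (norm x)\<^sup>2 > 0" by (simp add: add_pos_nonneg)
  have "((\<lambda>x. x \<bullet> x) has_derivative (\<lambda>v. 2 * (x \<bullet> v))) (at x)"
    by (rule has_derivative_eq_rhs[OF has_derivative_inner[OF has_derivative_ident has_derivative_ident]])
      (auto simp: inner_commute)
  then have d: "((\<lambda>x. (norm x)\<^sup>2) has_derivative (\<lambda>v. 2 * (x \<bullet> v))) (at x)" by (simp add: power2_norm_eq_inner)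
  have "((\<lambda>x. 1 - ln (1 + (norm x)\<^sup>2) / N) has_derivative (\<lambda>v. - 2 / (N * (1 + (norm x)\<^sup>2)) * (x \<bullet> v))) (at x)"
  proof -
    have "((\<lambda>x. 1 + (norm x)\<^sup>2) has_derivative (\<lambda>v. 0 + 2 * (x \<bullet> v))) (at x)"
      by (intro has_derivative_add has_derivative_const d)
    then have "((\<lambda>x. ln (1 + (norm x)\<^sup>2)) has_derivative (\<lambda>v. (0 + 2 * (x \<bullet> v)) * inverse (1 + (norm x)\<^sup>2))) (at x)"
      by (rule has_derivative_ln[rotated]) (rule p)
    then have "((\<lambda>x. 1 - ln (1 + (norm x)\<^sup>2) / N) has_derivative
        (\<lambda>v. 0 - (0 + 2 * (x \<bullet> v)) * inverse (1 + (norm x)\<^sup>2) / N)) (at x)"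
      by (intro has_derivative_diff has_derivative_const bounded_linear.has_derivative[OF bounded_linear_divide])
    then show ?thesis
      by (rule has_derivative_eq_rhs) (simp add: divide_inverse mult_ac)
  qed
  from has_derivative_compose[OF this DERIV_bump[unfolded has_field_derivative_def]]
  show ?thesis by (simp add: cutoff_def[abs_def] cutoff_grad_def mult_ac)
qed

lemma cutoff_support:
  assumes "N > 0" "cutoff N x \<noteq> 0"
  shows "1 + (norm x)\<^sup>2 < exp N"
proof -
  have "ln (1 + (norm x)\<^sup>2) < N"
  proof (rule ccontr)
    assume "\<not> ln (1 + (norm x)\<^sup>2) < N"
    then have "1 \<le> ln (1 + (norm x)\<^sup>2) / N" using assms(1) by (simp add: pos_le_divide_eq)
    then show False using assms(2) bump_eq_0[of "1 - ln (1 + (norm x)\<^sup>2) / N"] by (simp add: cutoff_def)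
  qed
  then have "exp (ln (1 + (norm x)\<^sup>2)) < exp N" by simp
  then show ?thesis by (simp add: add_pos_nonneg)
qed

lemma norm_le_power_2:
  fixes x :: "real ^ 'n"
  assumes "1 + (norm x)\<^sup>2 \<le> exp (real N)"
  shows "norm x \<le> 2 ^ N"
proof -
  have "exp (1::real) \<le> 4" using exp_le by simp
  then have "exp 1 ^ N \<le> (4::real) ^ N" by (intro power_mono) auto
  moreover have "exp (real N) = exp 1 ^ N" using exp_of_nat_mult[of N "1::real"] by simp
  ultimately have "exp (real N) \<le> 4 ^ N" by simp
  then have "(norm x)\<^sup>2 \<le> (2 ^ N)\<^sup>2" using assms by (simp add: power2_power_2)
  then show ?thesis by (rule power2_le_imp_le) simp
qed

text \<open>The argument of \<open>bump\<close> never exceeds 1 and is negative once 1 + |x|^2 > exp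
  N, where the gradient vanishes; elsewhere M bounds the derivative of the profile, and |x|^2 <= 1 +
  |x|^2 cancels one factor of the denominator.\<close>

lemma cutoff_grad_bound:
  fixes M :: real and N :: nat
  assumes N: "N \<ge> 1" and M: "M > 0" "\<And>t. t \<in> {0..1} \<Longrightarrow> \<bar>bump_poly [:0, 0, 1:] t\<bar> \<le> M"
  shows "(norm (cutoff_grad N x))\<^sup>2 \<le> 4 * M\<^sup>2 / (real N)\<^sup>2 * (1 / (1 + (norm x)\<^sup>2)) * (if 1 + (norm x)\<^sup>2 \<le> exp (real N) then 1 else 0)"
proof -
  define s where "s = 1 + (norm x)\<^sup>2"
  have s: "s \<ge> 1" by (simp add: s_def)
  have Np: "real N > 0" using N by simp
  define t where "t = 1 - ln s / N"
  have t1: "t \<le> 1" using s Np by (simp add: t_def)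
  show ?thesis
  proof (cases "s \<le> exp (real N)")
    case True
    have "ln s \<le> ln (exp (real N))" using True s by (subst ln_le_cancel_iff) auto
    then have "t \<ge> 0" using Np by (simp add: t_def pos_divide_le_eq)
    then have b: "\<bar>bump_poly [:0, 0, 1:] t\<bar> \<le> M" using t1 M(2) by simp
    have "(norm (cutoff_grad N x))\<^sup>2 = (bump_poly [:0, 0, 1:] t)\<^sup>2 * ((2 / (N * s))\<^sup>2 * (norm x)\<^sup>2)"
      unfolding cutoff_grad_def s_def[symmetric] t_def[symmetric] by (simp add: power_mult_distrib power_divide)
    also have "\<dots> \<le> M\<^sup>2 * ((2 / (N * s))\<^sup>2 * s)"
    proof (rule mult_mono)
      show "(bump_poly [:0, 0, 1:] t)\<^sup>2 \<le> M\<^sup>2" using b M(1) by (simp add: abs_le_square_iff[symmetric])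
      show "(2 / (N * s))\<^sup>2 * (norm x)\<^sup>2 \<le> (2 / (N * s))\<^sup>2 * s" by (intro mult_left_mono) (auto simp: s_def)
    qed auto
    also have "\<dots> = 4 * M\<^sup>2 / (real N)\<^sup>2 * (1 / s)"
      using s by (simp add: power_divide power_mult_distrib power2_eq_square mult_ac)
    finally show ?thesis using True by (simp add: s_def)
  next
    case False
    then have "ln (exp (real N)) < ln s" using s by (subst ln_less_cancel_iff) auto
    then have "t < 0" using Np by (simp add: t_def pos_less_divide_eq)
    then have "bump_poly [:0, 0, 1:] t = 0" by (simp add: bump_poly_def)
    then show ?thesis unfolding cutoff_grad_def s_def[symmetric] t_def[symmetric] using False by simp
  qed
qed

text \<open>On the support q_n <= 1 + |x|^2 <= exp N, so A_n <= 1/N keeps q_n^(A_n) below exp 1 and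
  \<phi>^2 below a multiple of the weight. The squared gradient gives N^(-2), the logarithmic
  integral gives N. The constant serves all admissible exponents and \<delta>, because both will
  vary with N.\<close>

lemma critical_gradient_term_bound:
  obtains C where "C \<ge> 0" "\<And>(N::nat) A a \<delta>. N \<ge> 1 \<Longrightarrow> A 2 = 0 \<Longrightarrow> (\<And>m. a m = A m - A (m - 1) - 1 / 2)
      \<Longrightarrow> (\<And>m. m \<in> {3..n} \<Longrightarrow> 0 \<le> A m) \<Longrightarrow> A n \<le> 1 / real N \<Longrightarrow> 0 < \<delta> \<Longrightarrow> \<delta> \<le> 1
      \<Longrightarrow> (LINT x|lborel. (phi a (\<lambda>_. \<delta>) x)\<^sup>2 * (norm (cutoff_grad N x))\<^sup>2) \<le> C / real N"
proof -
  obtain M where M: "M > 0" "\<And>t. t \<in> {0..1} \<Longrightarrow> \<bar>bump_poly [:0, 0, 1:] t\<bar> \<le> M" using bump_derivative_bound by blast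
  obtain F where F: "F \<ge> 0" "\<And>N. (\<integral>\<^sup>+x. ennreal (weight 0 x * (1 / (1 + (norm x)\<^sup>2))) * indicator (cball 0 (2 ^ N)) x \<partial>lborel)
    \<le> ennreal (4 * (real N + 1) * F)" by (rule weight_log_bound) blast
  \<comment> \<open>exp 1 bounds the power of q_n, 4 M^2 comes from the gradient of the cutoff, and
    8 F from 4 (N + 1) F <= 8 F N.\<close>
  define C where "C = exp 1 * (4 * M\<^sup>2) * (8 * F)"
  show ?thesis
  proof (rule that[of C])
    show "C \<ge> 0" using F by (simp add: C_def)
    fix N :: nat and A a :: "nat \<Rightarrow> real" and \<delta> :: real
    assume N: "N \<ge> 1" and A2: "A 2 = 0" and a: "\<And>m. a m = A m - A (m - 1) - 1 / 2"
      and A: "\<And>m. m \<in> {3..n} \<Longrightarrow> 0 \<le> A m" and An: "A n \<le> 1 / real N" and \<delta>: "0 < \<delta>" "\<delta> \<le> 1"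
    have Np: "real N \<ge> 1" using N by simp
    define K where "K = exp 1 * (4 * M\<^sup>2 / (real N)\<^sup>2)"
    have K: "K \<ge> 0" by (simp add: K_def)
    have pt: "(phi a (\<lambda>_. \<delta>) x)\<^sup>2 * (norm (cutoff_grad N x))\<^sup>2
      \<le> K * (weight 0 x * (1 / (1 + (norm x)\<^sup>2)) * indicator (cball 0 (2 ^ N)) x)" if x: "r 3 x > 0" for x
    proof (cases "1 + (norm x)\<^sup>2 \<le> exp (real N)")
      case True
      have An0: "0 \<le> A n" using A n3 by simp
      have qn: "q (\<lambda>_. \<delta>) n x \<le> exp (real N)" "q (\<lambda>_. \<delta>) n x > 0"
        using True \<delta> q_pos[of "\<lambda>_. \<delta>" n x] by (auto simp: q_def r_n)
      have "q (\<lambda>_. \<delta>) n x powr A n \<le> exp (real N) powr A n" using qn An0 by (intro powr_mono2) auto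
      also have "\<dots> = exp (real N * A n)" by (simp add: powr_def mult.commute)
      also have "\<dots> \<le> exp 1" using An Np by (simp add: field_simps)
      finally have "q (\<lambda>_. \<delta>) n x powr A n * weight 0 x \<le> exp 1 * weight 0 x" by (intro mult_right_mono) auto
      moreover have "(phi a (\<lambda>_. \<delta>) x)\<^sup>2 \<le> q (\<lambda>_. \<delta>) n x powr (A n - 0) * weight 0 x"
        using phi_power2_le[where A = A and a = a and \<eta> = 0, OF A2 a A _ \<delta>(1) x] by simp
      ultimately have "(phi a (\<lambda>_. \<delta>) x)\<^sup>2 \<le> exp 1 * weight 0 x" by simp
      moreover have "(norm (cutoff_grad N x))\<^sup>2 \<le> 4 * M\<^sup>2 / (real N)\<^sup>2 * (1 / (1 + (norm x)\<^sup>2))"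
        using cutoff_grad_bound[OF N M, of x] True by simp
      ultimately have "(phi a (\<lambda>_. \<delta>) x)\<^sup>2 * (norm (cutoff_grad N x))\<^sup>2 \<le> (exp 1 * weight 0 x) * (4 * M\<^sup>2 / (real N)\<^sup>2 * (1 / (1 + (norm x)\<^sup>2)))"
        by (intro mult_mono) auto
      then show ?thesis using norm_le_power_2[OF True] by (simp add: K_def mult_ac)
    next
      case False
      then have "cutoff_grad N x = 0" using cutoff_grad_bound[OF N M, of x] by simp
      then show ?thesis using K by (auto simp: add_nonneg_nonneg)
    qed
    show "(LINT x|lborel. (phi a (\<lambda>_. \<delta>) x)\<^sup>2 * (norm (cutoff_grad N x))\<^sup>2) \<le> C / real N"
    proof (rule integral_real_bounded)
      show "0 \<le> C / real N" using F by (simp add: C_def)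
      have "(\<integral>\<^sup>+x. ennreal ((phi a (\<lambda>_. \<delta>) x)\<^sup>2 * (norm (cutoff_grad N x))\<^sup>2) \<partial>lborel)
        \<le> (\<integral>\<^sup>+x. ennreal K * (ennreal (weight 0 x * (1 / (1 + (norm x)\<^sup>2))) * indicator (cball 0 (2 ^ N)) x) \<partial>lborel)"
      proof (rule nn_integral_mono_AE)
        show "AE x in lborel. ennreal ((phi a (\<lambda>_. \<delta>) x)\<^sup>2 * (norm (cutoff_grad N x))\<^sup>2)
          \<le> ennreal K * (ennreal (weight 0 x * (1 / (1 + (norm x)\<^sup>2))) * indicator (cball 0 (2 ^ N)) x)"
          using AE_r_pos
        proof eventually_elim
          case (elim x)
          have ind: "(indicator (cball 0 (2 ^ N)) x :: ennreal) = ennreal (indicator (cball 0 (2 ^ N)) x)" by (simp add: indicator_def)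
          have nn: "0 \<le> weight 0 x * (1 / (1 + (norm x)\<^sup>2))" by (intro mult_nonneg_nonneg) (auto simp: add_nonneg_nonneg)
          show ?case unfolding ind using ennreal_leI[OF pt[OF elim]] K nn
            by (simp only: ennreal_mult mult_nonneg_nonneg indicator_pos_le)
        qed
      qed
      also have "\<dots> = ennreal K * (\<integral>\<^sup>+x. ennreal (weight 0 x * (1 / (1 + (norm x)\<^sup>2))) * indicator (cball 0 (2 ^ N)) x \<partial>lborel)"
        by (rule nn_integral_cmult) (auto intro!: borel_measurable_times_ennreal borel_measurable_indicator)
      also have "\<dots> \<le> ennreal K * ennreal (4 * (real N + 1) * F)" by (intro mult_left_mono F(2)) simp
      also have "\<dots> = ennreal (K * (4 * (real N + 1) * F))" using K F by (simp add: ennreal_mult)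
      also have "\<dots> \<le> ennreal (C / real N)"
      proof (rule ennreal_leI)
        have "4 * (real N + 1) * F \<le> 8 * F * real N" using Np F(1) mult_left_mono[of 1 "real N" F] by (simp add: algebra_simps)
        then have "K * (4 * (real N + 1) * F) \<le> K * (8 * F * real N)" using K by (rule mult_left_mono)
        also have "\<dots> = C / real N" using Np by (simp add: K_def C_def power2_eq_square)
        finally show "K * (4 * (real N + 1) * F) \<le> C / real N" .
      qed
      finally show "(\<integral>\<^sup>+x. ennreal ((phi a (\<lambda>_. \<delta>) x)\<^sup>2 * (norm (cutoff_grad N x))\<^sup>2) \<partial>lborel) \<le> ennreal (C / real N)" .
    qed
  qed
qed

text \<open>u is bounded with bounded support, and |x_1|^s is locally integrable for s > -1.
  Bounding the weighted integral from below depends on this, since the Bochner integral of a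
  nonintegrable function is 0 by convention.\<close>

lemma weighted_power_integrable:
  assumes u: "C1_compact u Du" and s: "- 1 < s" and Q: "Q > 0"
  shows "integrable lborel (\<lambda>x. \<bar>x $ e 1\<bar> powr s * \<bar>u x\<bar> powr Q)"
proof (rule integrableI_bounded)
  have [measurable]: "u \<in> borel_measurable borel" using C1_compactD[OF u] by simp
  show "(\<lambda>x. \<bar>x $ e 1\<bar> powr s * \<bar>u x\<bar> powr Q) \<in> borel_measurable lborel" by measurable
  obtain R where R: "R > 0" "\<And>x. R < norm x \<Longrightarrow> u x = 0" using C1_compact_bound[OF u] by metis
  obtain M where M: "M > 0" "\<And>x. norm (u x) \<le> M"
    using bounded_continuous_compact_support[OF C1_compactD(3)[OF u] R(2)] by metis
  define \<gamma> where "\<gamma> i = (if i = e 1 then - s else 0)" for i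
  have "(\<integral>\<^sup>+x. ennreal (norm (\<bar>x $ e 1\<bar> powr s * \<bar>u x\<bar> powr Q)) \<partial>lborel)
    \<le> (\<integral>\<^sup>+x. ennreal (M powr Q) * (ennreal (\<Prod>i\<in>UNIV. \<bar>x $ i\<bar> powr (- \<gamma> i)) * indicator (cball 0 R) x) \<partial>lborel)"
  proof (rule nn_integral_mono_AE)
    show "AE x in lborel. ennreal (norm (\<bar>x $ e 1\<bar> powr s * \<bar>u x\<bar> powr Q))
      \<le> ennreal (M powr Q) * (ennreal (\<Prod>i\<in>UNIV. \<bar>x $ i\<bar> powr (- \<gamma> i)) * indicator (cball 0 R) x)"
      using AE_coordinates_nonzero
    proof eventually_elim
      case (elim x)
      have "(\<Prod>i\<in>UNIV. \<bar>x $ i\<bar> powr (- \<gamma> i)) = (\<Prod>i\<in>UNIV. if i = e 1 then \<bar>x $ i\<bar> powr s else 1)"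
        using elim by (intro prod.cong) (auto simp: \<gamma>_def)
      then have p: "(\<Prod>i\<in>UNIV. \<bar>x $ i\<bar> powr (- \<gamma> i)) = \<bar>x $ e 1\<bar> powr s" by simp
      have "\<bar>u x\<bar> powr Q \<le> M powr Q" using M(2)[of x] Q by (intro powr_mono2) auto
      then have "\<bar>x $ e 1\<bar> powr s * \<bar>u x\<bar> powr Q \<le> M powr Q * \<bar>x $ e 1\<bar> powr s"
        by (subst mult.commute) (intro mult_right_mono, auto)
      then show ?case using R(2)[of x] unfolding p
        by (cases "norm x \<le> R") (auto simp: ennreal_mult[symmetric] ennreal_leI)
    qed
  qed
  also have "\<dots> = ennreal (M powr Q) * (\<integral>\<^sup>+x. ennreal (\<Prod>i\<in>UNIV. \<bar>x $ i\<bar> powr (- \<gamma> i)) * indicator (cball 0 R) x \<partial>lborel)"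
    by (rule nn_integral_cmult) (auto intro!: borel_measurable_times_ennreal borel_measurable_indicator)
  also have "\<dots> < \<infinity>"
  proof -
    have "(\<integral>\<^sup>+x. ennreal (\<Prod>i\<in>UNIV. \<bar>x $ i\<bar> powr (- \<gamma> i)) * indicator (cball 0 R) x \<partial>(lborel :: (real ^ 'n) measure)) < \<infinity>"
      using s R by (intro coordinate_powers_locally_integrable) (auto simp: \<gamma>_def)
    then show ?thesis by (simp add: ennreal_mult_less_top)
  qed
  finally show "(\<integral>\<^sup>+x. ennreal (norm (\<bar>x $ e 1\<bar> powr s * \<bar>u x\<bar> powr Q)) \<partial>lborel) < \<infinity>" .
qed

end


section \<open>Cut-off ground states as test functions, and the contradiction\<close>

context ordered_coords
begin

lemma test_function_phi_cutoff:
  assumes c: "\<And>m. c m > 0" and N: "N > 0"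
  shows "test_function (\<lambda>x. phi a c x * cutoff N x)"
  unfolding test_function_def
proof (intro conjI allI)
  show "Ck_fun k (\<lambda>x. phi a c x * cutoff N x)" for k
    by (intro Ck_fun_mult Ck_fun_phi Ck_fun_cutoff c)
  have "{x. phi a c x * cutoff N x \<noteq> 0} \<subseteq> cball 0 (sqrt (exp N))"
  proof
    fix x assume "x \<in> {x. phi a c x * cutoff N x \<noteq> 0}"
    then have "(norm x)\<^sup>2 \<le> exp N" using cutoff_support[OF N, of x] by auto
    then show "x \<in> cball 0 (sqrt (exp N))" by (simp add: real_le_rsqrt)
  qed
  then show "compact (closure {x. phi a c x * cutoff N x \<noteq> 0})"
    using bounded_subset[OF bounded_cball] by (simp add: compact_closure)
qed

text \<open>The gradient of phi is phi T, so subtracting u T from the gradient of u leaves phi times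
  the gradient of the cutoff: the regularized energy sees only the cutoff.\<close>

lemma grad_phi_cutoff:
  assumes c: "\<And>m. c m > 0" and N: "N > 0"
  shows "grad (\<lambda>x. phi a c x * cutoff N x) x = phi a c x *\<^sub>R cutoff_grad N x + (phi a c x * cutoff N x) *\<^sub>R T a c x"
proof -
  let ?u = "\<lambda>x. phi a c x * cutoff N x"
  let ?D = "phi a c x *\<^sub>R cutoff_grad N x + (phi a c x * cutoff N x) *\<^sub>R T a c x"
  have "(?u has_derivative (\<lambda>v. phi a c x * (cutoff_grad N x \<bullet> v) + ((phi a c x *\<^sub>R T a c x) \<bullet> v) * cutoff N x)) (at x)"
    using c by (intro has_derivative_mult phi_has_derivative cutoff_has_derivative N)
  then have "(?u has_derivative (\<lambda>v. ?D \<bullet> v)) (at x)"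
    by (rule has_derivative_eq_rhs) (simp add: inner_add_left mult_ac)
  moreover have "(?u has_derivative (\<lambda>v. grad ?u x \<bullet> v)) (at x)"
    by (rule C1_compactD(1)[OF test_function_C1_compact[OF test_function_phi_cutoff[OF c N]]])
  ultimately have "(\<lambda>v. grad ?u x \<bullet> v) = (\<lambda>v. ?D \<bullet> v)" by (rule has_derivative_unique[rotated])
  then have "\<And>v. grad ?u x \<bullet> v = ?D \<bullet> v" by (rule fun_cong)
  then show ?thesis by (subst vector_eq_rdot[symmetric]) blast
qed

text \<open>On a fixed cube in the unit ball, away from the coordinate hyperplanes, all q_m lie
  between 1 / (4 n^2) and 2, so the logarithm of phi is bounded below in terms of B0. The cutoff is
  at least exp (-2) there once N >= 2, and |x_1|^s >= 1 because s <= 0.\<close>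

lemma weighted_power_lower_bound:
  assumes s: "- 1 < s" "s \<le> 0" and Q: "Q > 0" and B0: "B0 \<ge> 0"
  obtains J0 where "J0 > 0" "\<And>(N::nat) a \<delta>. N \<ge> 2 \<Longrightarrow> 0 < \<delta> \<Longrightarrow> \<delta> \<le> 1 \<Longrightarrow> (\<And>m. m \<in> {3..n} \<Longrightarrow> \<bar>a m\<bar> \<le> B0)
    \<Longrightarrow> J0 \<le> (LINT x|lborel. \<bar>x $ e 1\<bar> powr s * \<bar>phi a (\<lambda>_. \<delta>) x * cutoff (real N) x\<bar> powr Q)"
proof -
  have n: "real n \<ge> 3" using n3 by simp
  define l where "l = ln (4 * (real n)\<^sup>2)"
  \<comment> \<open>The first factor bounds phi from below on S. The second is the value of
    \<open>bump\<close> at 1/2, a lower bound for its argument when N >= 2.\<close>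
  define \<kappa> where "\<kappa> = exp (- (real n * (B0 / 2 * l))) * exp (- 2)"
  define S where "S = cbox (\<chi> i. 1 / (2 * real n)) ((\<chi> i. 1 / real n) :: real ^ 'n)"
  have "3 * 3 \<le> real n * real n" using n by (intro mult_mono) auto
  then have n2: "4 * (real n)\<^sup>2 \<ge> 2" unfolding power2_eq_square by linarith
  have l0: "l \<ge> ln 2" unfolding l_def using n2 n by (subst ln_le_cancel_iff) auto
  then have l00: "l \<ge> 0" using ln_ge_zero[of "2::real"] by linarith
  have vol: "measure lborel S > 0"
  proof -
    have "1 / (2 * real n) < 1 / real n" using n by (intro divide_strict_left_mono) auto
    then show ?thesis unfolding S_def by (intro content_pos_lt) (auto simp: Basis_vec_def inner_axis)
  qed
  have Sfin: "emeasure lborel S < \<infinity>" unfolding S_def by (rule emeasure_bounded_finite[OF bounded_cbox])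
  have pos: "\<kappa> powr Q * measure lborel S > 0" using vol by (simp add: \<kappa>_def)
  have "\<kappa> powr Q * measure lborel S \<le> (LINT x|lborel. \<bar>x $ e 1\<bar> powr s * \<bar>phi a (\<lambda>_. \<delta>) x * cutoff (real N) x\<bar> powr Q)"
    if N: "N \<ge> 2" and \<delta>: "0 < \<delta>" "\<delta> \<le> 1" and a: "\<And>m. m \<in> {3..n} \<Longrightarrow> \<bar>a m\<bar> \<le> B0"
    for N :: nat and a :: "nat \<Rightarrow> real" and \<delta> :: real
  proof -
    have Np: "real N \<ge> 2" using N by simp
    have pt: "\<kappa> powr Q \<le> \<bar>x $ e 1\<bar> powr s * \<bar>phi a (\<lambda>_. \<delta>) x * cutoff (real N) x\<bar> powr Q" if x: "x \<in> S" for x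
    proof -
      have xi: "1 / (2 * real n) \<le> x $ i" "x $ i \<le> 1 / real n" for i
        using x by (auto simp: S_def mem_box_cart)
      have xp: "x $ i > 0" for i using xi(1)[of i] n by (simp add: less_le_trans[OF _ xi(1)])
      have sq: "(x $ i)\<^sup>2 \<le> (1 / real n)\<^sup>2" for i using xi(2)[of i] xp[of i] by (intro power_mono) auto
      have "r n x \<le> (\<Sum>i\<in>e ` {1..n}. (1 / real n)\<^sup>2)" unfolding r_eq_sum by (intro sum_mono sq)
      also have "\<dots> = real n * (1 / real n)\<^sup>2" using card_image_e[of n] by simp
      also have "\<dots> \<le> 1" using n by (simp add: power2_eq_square)
      finally have rn: "r n x \<le> 1" .
      have q: "1 / (4 * (real n)\<^sup>2) \<le> q (\<lambda>_. \<delta>) m x" "q (\<lambda>_. \<delta>) m x \<le> 2" if m: "m \<in> {3..n}" for m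
      proof -
        have "(1 / (2 * real n))\<^sup>2 \<le> (x $ e 1)\<^sup>2" using xi(1)[of "e 1"] by (intro power_mono) auto
        also have "\<dots> \<le> r m x" using m by (intro coordinate_le_r) auto
        finally show "1 / (4 * (real n)\<^sup>2) \<le> q (\<lambda>_. \<delta>) m x" using \<delta> by (simp add: q_def power_divide power_mult_distrib)
        show "q (\<lambda>_. \<delta>) m x \<le> 2" using r_mono[of m n x] rn m \<delta> by (simp add: q_def)
      qed
      have "a m / 2 * ln (q (\<lambda>_. \<delta>) m x) \<ge> - (B0 / 2 * l)" if m: "m \<in> {3..n}" for m
      proof -
        have qp: "q (\<lambda>_. \<delta>) m x > 0" using q_pos[of "\<lambda>_. \<delta>" m x] \<delta> by simp
        have "ln (1 / (4 * (real n)\<^sup>2)) \<le> ln (q (\<lambda>_. \<delta>) m x)" using q(1)[OF m] n qp by (subst ln_le_cancel_iff) auto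
        then have "- l \<le> ln (q (\<lambda>_. \<delta>) m x)" using n by (simp add: l_def ln_div)
        moreover have "ln (q (\<lambda>_. \<delta>) m x) \<le> ln 2" using q(2)[OF m] qp by (subst ln_le_cancel_iff) auto
        ultimately have "\<bar>ln (q (\<lambda>_. \<delta>) m x)\<bar> \<le> l" using l0 by linarith
        then have "\<bar>a m\<bar> * \<bar>ln (q (\<lambda>_. \<delta>) m x)\<bar> \<le> B0 * l" using a[OF m] B0 by (intro mult_mono) auto
        then have "\<bar>a m * ln (q (\<lambda>_. \<delta>) m x)\<bar> \<le> B0 * l" by (simp only: abs_mult)
        then show ?thesis by simp
      qed
      then have "(\<Sum>m=3..n. - (B0 / 2 * l)) \<le> (\<Sum>m=3..n. a m / 2 * ln (q (\<lambda>_. \<delta>) m x))" by (intro sum_mono) auto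
      moreover have "- (real n * (B0 / 2 * l)) \<le> (\<Sum>m=3..n. - (B0 / 2 * l))"
      proof -
        have "(\<Sum>m=3..n. - (B0 / 2 * l)) = - (real (n - 2) * (B0 / 2 * l))" by simp
        moreover have "real (n - 2) * (B0 / 2 * l) \<le> real n * (B0 / 2 * l)" using B0 l00 by (intro mult_right_mono) auto
        ultimately show ?thesis by linarith
      qed
      ultimately have ph: "exp (- (real n * (B0 / 2 * l))) \<le> phi a (\<lambda>_. \<delta>) x" by (simp add: phi_def)
      have cu: "exp (- 2) \<le> cutoff (real N) x"
      proof -
        have "ln (1 + (norm x)\<^sup>2) \<le> 1"
        proof -
          have "(norm x)\<^sup>2 \<le> 1" using rn by (simp add: r_n)
          then show ?thesis using ln_add_one_self_le_self[of "(norm x)\<^sup>2"] by simp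
        qed
        then have "ln (1 + (norm x)\<^sup>2) / N \<le> 1 / 2" using Np ln_ge_zero[of "1 + (norm x)\<^sup>2"] by (intro frac_le) auto
        then have t: "1 / 2 \<le> 1 - ln (1 + (norm x)\<^sup>2) / N" by simp
        define t where "t = 1 - ln (1 + (norm x)\<^sup>2) / N"
        have "1 / t \<le> 2" using t unfolding t_def[symmetric] by (simp add: field_simps)
        then have "exp (- 2) \<le> bump t" using t unfolding t_def[symmetric] by (simp add: bump_def)
        then show ?thesis by (simp add: cutoff_def t_def)
      qed
      have "\<kappa> \<le> phi a (\<lambda>_. \<delta>) x * cutoff (real N) x" unfolding \<kappa>_def by (intro mult_mono ph cu) (auto simp: phi_def)
      then have "\<kappa> powr Q \<le> \<bar>phi a (\<lambda>_. \<delta>) x * cutoff (real N) x\<bar> powr Q" using Q by (intro powr_mono2) (auto simp: \<kappa>_def)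
      moreover have "1 \<le> \<bar>x $ e 1\<bar> powr s"
      proof -
        have "x $ e 1 \<le> 1" using order.trans[OF xi(2)[of "e 1"], of 1] n by simp
        then have "(x $ e 1) powr 0 \<le> (x $ e 1) powr s" using xp[of "e 1"] s by (intro powr_mono') auto
        then show ?thesis using xp[of "e 1"] by simp
      qed
      ultimately show ?thesis
        using mult_mono[of 1 "\<bar>x $ e 1\<bar> powr s" "\<kappa> powr Q" "\<bar>phi a (\<lambda>_. \<delta>) x * cutoff (real N) x\<bar> powr Q"] by simp
    qed
    have C1: "C1_compact (\<lambda>x. phi a (\<lambda>_. \<delta>) x * cutoff (real N) x) (grad (\<lambda>x. phi a (\<lambda>_. \<delta>) x * cutoff (real N) x))"
      using \<delta> Np by (intro test_function_C1_compact test_function_phi_cutoff) auto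
    have "\<kappa> powr Q * measure lborel S = (LINT x|lborel. \<kappa> powr Q * indicator S x)"
      using Sfin by (simp add: S_def)
    also have "\<dots> \<le> (LINT x|lborel. \<bar>x $ e 1\<bar> powr s * \<bar>phi a (\<lambda>_. \<delta>) x * cutoff (real N) x\<bar> powr Q)"
    proof (rule integral_mono)
      show "integrable lborel (\<lambda>x. \<kappa> powr Q * indicator S x)"
        using Sfin by (intro integrable_mult_right integrable_real_indicator) (auto simp: S_def)
      show "integrable lborel (\<lambda>x. \<bar>x $ e 1\<bar> powr s * \<bar>phi a (\<lambda>_. \<delta>) x * cutoff (real N) x\<bar> powr Q)"
        by (rule weighted_power_integrable[OF C1 s(1) Q])
      show "\<kappa> powr Q * indicator S x \<le> \<bar>x $ e 1\<bar> powr s * \<bar>phi a (\<lambda>_. \<delta>) x * cutoff (real N) x\<bar> powr Q" for x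
        using pt[of x] by (cases "x \<in> S") auto
    qed
    finally show ?thesis .
  qed
  then show ?thesis by (rule that[OF pos])
qed

text \<open>The perturbed coefficients differ from b at level 3 alone, so Z + potential tends to
  \<delta> / |X_3|^2 and the limit is the integral of a nonnegative function. Positive exponents A'
  leave room for \<eta> > 0, and the majorant weight / |X_3|^2 is then integrable on balls.\<close>

lemma perturbed_potential_limit:
  fixes A' a b :: "nat \<Rightarrow> real" and \<delta> :: real and N :: nat
  assumes A': "A' 2 = 0" "\<And>m. m \<in> {3..n} \<Longrightarrow> 0 < A' m" and a: "\<And>m. a m = A' m - A' (m - 1) - 1 / 2"
    and b: "\<And>m. m \<in> {4..n} \<Longrightarrow> b m = (A' (m - 1) + 1 / 2)\<^sup>2 - (A' m)\<^sup>2"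
      "b 3 = (A' 2 + 1 / 2)\<^sup>2 - (A' 3)\<^sup>2 + \<delta>" and \<delta>: "\<delta> \<ge> 0" and N: "N \<ge> 1"
  defines "c \<equiv> \<lambda>j (_::nat). 1 / real (Suc j)"
  shows "\<exists>L\<ge>0. (\<lambda>j. LINT x|lborel. (phi a (c j) x * cutoff (real N) x)\<^sup>2 * (Z a (c j) x + potential b x)) \<longlonglongrightarrow> L"
proof -
  have Np: "real N > 0" using N by simp
  have c: "c j m > 0" for j m by (simp add: c_def)
  have c1: "c j m \<le> 1" for j m by (simp add: c_def)
  have c0: "(\<lambda>j. c j m) \<longlonglongrightarrow> 0" for m
    unfolding c_def using LIMSEQ_inverse_real_of_nat by (simp add: inverse_eq_divide)
  have qpos: "q (c j) m x > 0" for j m x using q_pos[of "c j" m x] c by simp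
  have phi_meas [measurable]: "phi a (c j) \<in> borel_measurable borel" for j
  proof -
    have "q (c j) m x \<noteq> 0" for m x using qpos[of j m x] by simp
    then have "continuous_on UNIV (phi a (c j))" unfolding phi_def by (intro continuous_intros) auto
    then show ?thesis by (rule borel_measurable_continuous_onI)
  qed
  have [measurable]: "cutoff N \<in> borel_measurable borel"
    using Ck_fun_cutoff[of 0 "real N"] by (intro borel_measurable_continuous_onI) simp
  have [measurable]: "Z a (c j) \<in> borel_measurable borel" for j
    by (intro borel_measurable_continuous_onI Z_continuous c)
  define V where "V x = potential b x" for x
  have [measurable]: "V \<in> borel_measurable borel" unfolding V_def by measurable
  define \<phi> where "\<phi> x = exp (\<Sum>m=3..n. a m / 2 * ln (r m x))" for x
  have [measurable]: "\<phi> \<in> borel_measurable borel" unfolding \<phi>_def by measurable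
  define W where "W x = (\<phi> x * cutoff (real N) x)\<^sup>2 * (\<delta> / r 3 x)" for x
  have [measurable]: "W \<in> borel_measurable borel" unfolding W_def by measurable
  \<comment> \<open>Positive because the finitely many A' m are; the cap 1/2 is the range in which
    \<open>phi_power2_le\<close> and the integrability of the majorant hold.\<close>
  define \<eta> where "\<eta> = Min (insert (1 / 2) (A' ` {3..n}))"
  have \<eta>: "0 < \<eta>" "\<eta> \<le> 1 / 2" "\<And>m. m \<in> {3..n} \<Longrightarrow> \<eta> \<le> A' m"
    unfolding \<eta>_def using A'(2) by (auto simp only: Min_gr_iff finite_insert finite_imageI finite_atLeastAtMost insert_not_empty
      intro!: Min_le) auto
  have An: "\<eta> \<le> A' n" using \<eta>(3) n3 by simp
  define CZ where "CZ = (\<Sum>m=3..n. \<bar>a m\<bar> * (real n + 2)) + (\<Sum>m=3..n. \<bar>a m\<bar>)\<^sup>2"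
  define CV where "CV = (\<Sum>m=3..n. \<bar>b m\<bar>)"
  have C0: "CZ \<ge> 0" "CV \<ge> 0" unfolding CZ_def CV_def by (auto intro!: sum_nonneg add_nonneg_nonneg)
  define K where "K = exp (real N) powr (A' n - \<eta>) * (CZ + CV)"
  have K: "K \<ge> 0" using C0 by (simp add: K_def)
  define D where "D x = K * (weight \<eta> x / r 3 x * indicator (cball 0 (2 ^ N)) x)" for x
  have intD: "integrable lborel D"
    unfolding D_def
  proof (intro integrable_mult_right integrableI_nonneg)
    show "(\<lambda>x. weight \<eta> x / r 3 x * indicator (cball 0 (2 ^ N)) x) \<in> borel_measurable lborel"
      by (intro borel_measurable_times borel_measurable_divide borel_measurable_indicator) auto
    show "AE x in lborel. 0 \<le> weight \<eta> x / r 3 x * indicator (cball 0 (2 ^ N)) x" by (auto simp: indicator_def)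
    have "(\<integral>\<^sup>+x. ennreal (weight \<eta> x / r 3 x * indicator (cball 0 (2 ^ N)) x) \<partial>lborel)
      = (\<integral>\<^sup>+x. ennreal (weight \<eta> x / r 3 x) * indicator (cball 0 (2 ^ N)) x \<partial>lborel)"
      by (intro nn_integral_cong) (auto simp: indicator_def)
    also have "\<dots> < \<infinity>" by (rule weight_locally_integrable[OF \<eta>(1,2)]) simp
    finally show "(\<integral>\<^sup>+x. ennreal (weight \<eta> x / r 3 x * indicator (cball 0 (2 ^ N)) x) \<partial>lborel) < \<infinity>" .
  qed
  have bound: "norm ((phi a (c j) x * cutoff (real N) x)\<^sup>2 * (Z a (c j) x + V x)) \<le> D x" if x: "r 3 x > 0" for j x
  proof (cases "cutoff (real N) x = 0")
    case True
    then show ?thesis using K x by (simp add: D_def)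
  next
    case False
    then have s: "1 + (norm x)\<^sup>2 \<le> exp (real N)" using cutoff_support[OF Np, of x] by simp
    have cut: "\<bar>cutoff (real N) x\<bar> \<le> 1" using bump_nonneg bump_le_1 by (simp add: cutoff_def)
    have qn: "q (c j) n x \<le> exp (real N)" using s c1[of j n] by (simp add: q_def r_n)
    have "(phi a (c j) x)\<^sup>2 \<le> q (c j) n x powr (A' n - \<eta>) * weight \<eta> x"
      unfolding c_def by (rule phi_power2_le[where A = A', OF A'(1) a \<eta>(3) \<eta>(2) _ x]) auto
    also have "\<dots> \<le> exp (real N) powr (A' n - \<eta>) * weight \<eta> x"
      using qn qpos[of j n x] An by (intro mult_right_mono powr_mono2) auto
    finally have p: "(phi a (c j) x)\<^sup>2 \<le> exp (real N) powr (A' n - \<eta>) * weight \<eta> x" .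
    have "(phi a (c j) x * cutoff (real N) x)\<^sup>2 \<le> (phi a (c j) x)\<^sup>2"
      using cut by (simp add: power_mult_distrib mult_left_le abs_square_le_1)
    then have p: "(phi a (c j) x * cutoff (real N) x)\<^sup>2 \<le> exp (real N) powr (A' n - \<eta>) * weight \<eta> x" using p by linarith
    have "\<bar>Z a (c j) x\<bar> \<le> CZ / r 3 x" unfolding CZ_def using c by (intro Z_bound x) (simp add: less_imp_le)
    moreover have "\<bar>V x\<bar> \<le> CV / r 3 x" unfolding V_def CV_def by (rule potential_bound[OF x])
    ultimately have "\<bar>Z a (c j) x + V x\<bar> \<le> (CZ + CV) / r 3 x" by (simp add: add_divide_distrib)
    then have "(phi a (c j) x * cutoff (real N) x)\<^sup>2 * \<bar>Z a (c j) x + V x\<bar> \<le> (exp (real N) powr (A' n - \<eta>) * weight \<eta> x) * ((CZ + CV) / r 3 x)"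
      using p by (intro mult_mono) auto
    then show ?thesis using norm_le_power_2[OF s] by (simp add: D_def K_def abs_mult mult_ac)
  qed
  have lim: "(\<lambda>j. (phi a (c j) x * cutoff (real N) x)\<^sup>2 * (Z a (c j) x + V x)) \<longlonglongrightarrow> W x" if x: "r 3 x > 0" for x
  proof -
    have rp: "r m x > 0" if "m \<in> {3..n}" for m using r_mono[of 3 m x] x that by simp
    have ql: "(\<lambda>j. q (c j) m x) \<longlonglongrightarrow> r m x" for m
      unfolding q_def using tendsto_add[OF tendsto_const c0[of m], of "r m x"] by simp
    have rne: "r m x \<noteq> 0" if "m \<in> {3..n}" for m using rp[OF that] by simp
    have ph: "(\<lambda>j. phi a (c j) x) \<longlonglongrightarrow> \<phi> x" unfolding phi_def \<phi>_def by (intro tendsto_intros ql rne)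
    have "(\<lambda>j. Z a (c j) x + V x) \<longlonglongrightarrow> (\<Sum>m=3..n. ((A' m)\<^sup>2 - (A' (m - 1) + 1 / 2)\<^sup>2) / r m x) + V x"
      using Z_limit[where A = A' and a = a and c = c, OF A'(1) a c0 x] by (intro tendsto_intros)
    also have "(\<Sum>m=3..n. ((A' m)\<^sup>2 - (A' (m - 1) + 1 / 2)\<^sup>2) / r m x) + V x = \<delta> / r 3 x"
    proof -
      have "{3..n} = insert 3 {4..n}" using n3 by auto
      moreover have "(\<Sum>m=4..n. b m / r m x) = - (\<Sum>m=4..n. ((A' m)\<^sup>2 - (A' (m - 1) + 1 / 2)\<^sup>2) / r m x)"
        unfolding sum_negf[symmetric] using b(1) by (intro sum.cong) (auto simp: diff_divide_distrib)
      ultimately show ?thesis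
        by (simp add: V_def b(2) add_divide_distrib diff_divide_distrib)
    qed
    finally show ?thesis unfolding W_def using ph by (intro tendsto_intros)
  qed
  have "(\<lambda>j. LINT x|lborel. (phi a (c j) x * cutoff (real N) x)\<^sup>2 * (Z a (c j) x + V x)) \<longlonglongrightarrow> (LINT x|lborel. W x)"
  proof (rule integral_dominated_convergence[OF _ _ intD])
    show "AE x in lborel. (\<lambda>j. (phi a (c j) x * cutoff (real N) x)\<^sup>2 * (Z a (c j) x + V x)) \<longlonglongrightarrow> W x"
      using AE_r_pos by eventually_elim (rule lim)
    show "AE x in lborel. norm ((phi a (c j) x * cutoff (real N) x)\<^sup>2 * (Z a (c j) x + V x)) \<le> D x" for j
      using AE_r_pos by eventually_elim (rule bound)
  qed measurable
  moreover have "(LINT x|lborel. W x) \<ge> 0" unfolding W_def using \<delta> by (intro integral_nonneg_AE) auto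
  ultimately show ?thesis unfolding V_def by blast
qed

text \<open>For each N >= 2 the exponents are perturbed by at most 1/N, then the regularization is
  removed with N fixed. The term I_j has a nonnegative limit and may be dropped, which leaves a
  positive constant independent of N below C4 / N.\<close>

lemma hardy_sobolev_critical:
  fixes A b :: "nat \<Rightarrow> real" and Q C :: real
  assumes A: "A 2 = 0" "\<And>m. 0 \<le> A m" "A n = 0"
    and b: "\<And>m. m \<in> {3..n} \<Longrightarrow> b m = (A (m - 1) + 1 / 2)\<^sup>2 - (A m)\<^sup>2"
    and Q: "2 * (real n - 1) / (real n - 2) < Q" "Q \<le> 2 * real n / (real n - 2)"
    and C: "C > 0"
    and ineq: "\<And>u. test_function u \<Longrightarrow> hardy_sobolev_ineq e n b Q C u"
  shows False
proof -
  have N3: "real n \<ge> 3" using n3 by simp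
  define s where "s = (Q - 2) / 2 * real n - Q"
  have s1: "- 1 < s" using Q(1) N3 by (simp add: s_def field_simps)
  have s0: "s \<le> 0" using Q(2) N3 by (simp add: s_def field_simps)
  have "2 * (real n - 1) / (real n - 2) > 0" using N3 by simp
  then have Q0: "Q > 0" using Q(1) by linarith
  \<comment> \<open>A uniform bound for all perturbed |a_m|: since A' <= A + 1, each is at most A_m
    + A_(m-1) + 5/2. Hence J0 does not depend on N.\<close>
  define B0 where "B0 = (\<Sum>m=3..n. A m + A (m - 1) + 3)"
  have B0: "B0 \<ge> 0" unfolding B0_def using A(2) by (intro sum_nonneg) (simp add: add_nonneg_nonneg)
  obtain J0 where J0: "J0 > 0" "\<And>(N::nat) a \<delta>. N \<ge> 2 \<Longrightarrow> 0 < \<delta> \<Longrightarrow> \<delta> \<le> 1 \<Longrightarrow> (\<And>m. m \<in> {3..n} \<Longrightarrow> \<bar>a m\<bar> \<le> B0)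
    \<Longrightarrow> J0 \<le> (LINT x|lborel. \<bar>x $ e 1\<bar> powr s * \<bar>phi a (\<lambda>_. \<delta>) x * cutoff (real N) x\<bar> powr Q)"
    by (rule weighted_power_lower_bound[OF s1 s0 Q0 B0]) blast
  obtain C4 where C4: "C4 \<ge> 0" "\<And>(N::nat) A a \<delta>. N \<ge> 1 \<Longrightarrow> A 2 = 0 \<Longrightarrow> (\<And>m. a m = A m - A (m - 1) - 1 / 2)
      \<Longrightarrow> (\<And>m. m \<in> {3..n} \<Longrightarrow> 0 \<le> A m) \<Longrightarrow> A n \<le> 1 / real N \<Longrightarrow> 0 < \<delta> \<Longrightarrow> \<delta> \<le> 1
      \<Longrightarrow> (LINT x|lborel. (phi a (\<lambda>_. \<delta>) x)\<^sup>2 * (norm (cutoff_grad (real N) x))\<^sup>2) \<le> C4 / real N"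
    by (rule critical_gradient_term_bound) blast
  have key: "C * J0 powr (2 / Q) \<le> C4 / real N" if N: "N \<ge> 2" for N :: nat
  proof -
    have Np: "real N > 0" "real N \<ge> 2" using N by auto
    have eps: "1 / real N > 0" using Np by simp
    obtain A' \<delta> where \<delta>: "\<delta> > 0" and A': "A' 2 = 0" "\<And>m. m \<in> {3..n} \<Longrightarrow> 0 < A' m" "\<And>m. m \<in> {3..n} \<Longrightarrow> A' m \<le> A m + 1 / real N"
      "(A' 3)\<^sup>2 = (A 3)\<^sup>2 + \<delta>"
      "\<And>m. m \<in> {4..n} \<Longrightarrow> (A' (m - 1) + 1 / 2)\<^sup>2 - (A' m)\<^sup>2 = (A (m - 1) + 1 / 2)\<^sup>2 - (A m)\<^sup>2"
    proof (rule perturbed_exponents[of A "1 / real N" n, OF A(2) eps], goal_cases)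
      case (1 A' \<delta>)
      show ?case by (rule 1(1)[OF 1(2-)])
    qed
    define a where "a m = A' m - A' (m - 1) - 1 / 2" for m
    have aB: "\<bar>a m\<bar> \<le> B0" if m: "m \<in> {3..n}" for m
    proof -
      have N1: "1 / real N \<le> 1" using Np by simp
      have "A' (m - 1) \<le> A (m - 1) + 1" "0 \<le> A' (m - 1)"
      proof -
        consider "m = 3" | "m - 1 \<in> {3..n}" using m by force
        then have "A' (m - 1) \<le> A (m - 1) + 1 \<and> 0 \<le> A' (m - 1)"
        proof cases
          case 1
          then show ?thesis using A'(1) A(1) by simp
        next
          case 2
          then show ?thesis using A'(2)[OF 2] A'(3)[OF 2] N1 by simp
        qed
        then show "A' (m - 1) \<le> A (m - 1) + 1" "0 \<le> A' (m - 1)" by auto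
      qed
      then have "\<bar>a m\<bar> \<le> A m + A (m - 1) + 3"
        using A'(2)[OF m] A'(3)[OF m] N1 A(2)[of m] A(2)[of "m - 1"] unfolding a_def abs_le_iff by linarith
      also have "\<dots> \<le> B0" unfolding B0_def using m A(2) by (intro member_le_sum) (auto simp: add_nonneg_nonneg)
      finally show ?thesis .
    qed
    have b4: "b m = (A' (m - 1) + 1 / 2)\<^sup>2 - (A' m)\<^sup>2" if "m \<in> {4..n}" for m
      using A'(5)[OF that] b[of m] that by simp
    have b3: "b 3 = (A' 2 + 1 / 2)\<^sup>2 - (A' 3)\<^sup>2 + \<delta>" using A'(1,4) A(1) b[of 3] n3 by simp
    define c where "c j k = 1 / real (Suc j)" for j and k :: nat
    have c: "c j m > 0" "c j m \<le> 1" for j m by (auto simp: c_def)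
    define I where "I j = (LINT x|lborel. (phi a (c j) x * cutoff (real N) x)\<^sup>2 * (Z a (c j) x + potential b x))" for j
    have "\<exists>L\<ge>0. I \<longlonglongrightarrow> L"
      unfolding I_def c_def
      by (rule perturbed_potential_limit[where A' = A' and \<delta> = \<delta>, OF A'(1,2) a_def b4 b3]) (use \<delta> N in auto)
    then obtain L where L: "L \<ge> 0" "I \<longlonglongrightarrow> L" by blast
    have step: "C * J0 powr (2 / Q) \<le> C4 / real N - I j" for j
    proof -
      define u where "u x = phi a (c j) x * cutoff (real N) x" for x
      have test: "test_function u" unfolding u_def[abs_def] by (rule test_function_phi_cutoff[OF c(1) Np(1)])
      have u: "C1_compact u (grad u)" by (rule test_function_C1_compact[OF test])
      have g: "grad u x - u x *\<^sub>R T a (c j) x = phi a (c j) x *\<^sub>R cutoff_grad (real N) x" for x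
        unfolding u_def[abs_def] by (subst grad_phi_cutoff[OF c(1) Np(1)]) simp
      have E: "(LINT x|lborel. (phi a (c j) x)\<^sup>2 * (norm (cutoff_grad (real N) x))\<^sup>2)
        = (LINT x|lborel. (norm (grad u x))\<^sup>2) + (LINT x|lborel. (u x)\<^sup>2 * Z a (c j) x)"
        using energy_identity(3)[OF u, of "c j" a] c(1) unfolding g by (simp add: power_mult_distrib)
      have "I j = (LINT x|lborel. (u x)\<^sup>2 * Z a (c j) x + potential b x * (u x)\<^sup>2)"
        unfolding I_def u_def by (intro Bochner_Integration.integral_cong refl) (simp add: algebra_simps)
      also have "\<dots> = (LINT x|lborel. (u x)\<^sup>2 * Z a (c j) x) + (LINT x|lborel. potential b x * (u x)\<^sup>2)"
        using energy_identity(2)[OF u, of "c j" a] c(1) potential_integrable[OF u, of b] by (intro Bochner_Integration.integral_add) auto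
      finally have I: "I j = \<dots>" .
      have "J0 \<le> weighted_power s Q u"
        unfolding u_def c_def by (rule J0(2)[OF N _ _ aB]) auto
      then have "J0 powr (2 / Q) \<le> weighted_power s Q u powr (2 / Q)"
        using J0(1) Q0 by (intro powr_mono2) auto
      then have "C * J0 powr (2 / Q) \<le> C * weighted_power s Q u powr (2 / Q)"
        using C by (intro mult_left_mono) auto
      also have "\<dots> \<le> (LINT x|lborel. (norm (grad u x))\<^sup>2) - (LINT x|lborel. potential b x * (u x)\<^sup>2)"
        using ineq[OF test] by (simp add: hardy_sobolev_ineq_iff s_def)
      also have "\<dots> = (LINT x|lborel. (phi a (c j) x)\<^sup>2 * (norm (cutoff_grad (real N) x))\<^sup>2) - I j"
        unfolding I E by simp
      also have "\<dots> \<le> C4 / real N - I j"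
      proof -
        \<comment> \<open>Here A n = 0 is decisive: the perturbed top exponent is then small enough
          for the gradient estimate.\<close>
        have "A' n \<le> 1 / real N" using A'(3)[of n] A(3) n3 by simp
        then have "(LINT x|lborel. (phi a (c j) x)\<^sup>2 * (norm (cutoff_grad (real N) x))\<^sup>2) \<le> C4 / real N"
          unfolding c_def using A'(1,2) N by (intro C4(2)[where A = A']) (auto simp: a_def less_imp_le)
        then show ?thesis by simp
      qed
      finally show ?thesis .
    qed
    have "(\<lambda>j. C4 / real N - I j) \<longlonglongrightarrow> C4 / real N - L" by (intro tendsto_intros L)
    then have "C * J0 powr (2 / Q) \<le> C4 / real N - L" by (rule LIMSEQ_le_const) (use step in auto)
    then show ?thesis using L by simp
  qed
  define X where "X = C * J0 powr (2 / Q)"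
  have X: "X > 0" using C J0 by (simp add: X_def)
  obtain N :: nat where N: "real N > C4 / X + 2" using reals_Archimedean2 by blast
  have "C4 / X \<ge> 0" using C4(1) X by simp
  then have "N \<ge> 2" using N by linarith
  then have "X \<le> C4 / real N" unfolding X_def by (rule key)
  then have "X * real N \<le> C4" using \<open>N \<ge> 2\<close> by (simp add: pos_le_divide_eq)
  then have "real N \<le> C4 / X" using X by (simp add: pos_le_divide_eq mult.commute)
  then show False using N by simp
qed

end

theorem theoremC:
  fixes n :: nat and e :: "nat \<Rightarrow> 'n::finite" and \<alpha> \<beta> :: "nat \<Rightarrow> real" and Q :: real
  assumes "n \<ge> 3"
    and "bij_betw e {1..n} (UNIV :: 'n set)"
    and "\<And>m. m \<in> {3..n} \<Longrightarrow> \<alpha> m \<le> 0"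
    and "\<beta> 3 = - (\<alpha> 3)\<^sup>2 + 1 / 4"
    and "\<And>m. m \<in> {4..n} \<Longrightarrow> \<beta> m = - (\<alpha> m)\<^sup>2 + (\<alpha> (m - 1) - 1 / 2)\<^sup>2"
    and "2 * (real n - 1) / (real n - 2) < Q"
    and "Q \<le> 2 * real n / (real n - 2)"
  shows "(\<alpha> n < 0 \<longrightarrow> (\<exists>C>0. \<forall>u :: real ^ 'n \<Rightarrow> real. test_function u \<longrightarrow> hardy_sobolev_ineq e n \<beta> Q C u))
    \<and> (\<alpha> n = 0 \<longrightarrow> \<not> (\<exists>C>0. \<forall>u :: real ^ 'n \<Rightarrow> real. test_function u \<longrightarrow> hardy_sobolev_ineq e n \<beta> Q C u))"
proof -
  interpret ordered_coords e n by standard (use assms in auto)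
  \<comment> \<open>Setting A = 0 outside {3..n} gives A 2 = 0, so that the formula for \<beta> 3
    becomes the general one with m = 3.\<close>
  define A where "A m = (if m \<in> {3..n} then - \<alpha> m else 0)" for m
  have A: "A 2 = 0" "0 \<le> A m" for m using assms(3)[of m] by (auto simp: A_def)
  have An: "A n = - \<alpha> n" using assms(1) by (simp add: A_def)
  have b: "\<beta> m = (A (m - 1) + 1 / 2)\<^sup>2 - (A m)\<^sup>2" if m: "m \<in> {3..n}" for m
  proof (cases "m = 3")
    case True
    then show ?thesis using assms(1,4) by (simp add: A_def power2_eq_square)
  next
    case False
    then have "m \<in> {4..n}" "m - 1 \<in> {3..n}" using m by auto
    then show ?thesis using assms(5)[of m] m by (simp add: A_def power2_eq_square algebra_simps)
  qed
  show ?thesis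
  proof (intro conjI impI)
    assume "\<alpha> n < 0"
    then have "0 < A n" using An by simp
    show "\<exists>C>0. \<forall>u :: real ^ 'n \<Rightarrow> real. test_function u \<longrightarrow> hardy_sobolev_ineq e n \<beta> Q C u"
      by (rule hardy_sobolev_noncritical[of A \<beta> Q, OF A(1) A(2) \<open>0 < A n\<close> b assms(6,7)])
  next
    assume "\<alpha> n = 0"
    then have An0: "A n = 0" using An by simp
    show "\<not> (\<exists>C>0. \<forall>u :: real ^ 'n \<Rightarrow> real. test_function u \<longrightarrow> hardy_sobolev_ineq e n \<beta> Q C u)"
    proof (rule notI, elim exE conjE)
      fix C :: real
      assume C: "C > 0" and H: "\<forall>u :: real ^ 'n \<Rightarrow> real. test_function u \<longrightarrow> hardy_sobolev_ineq e n \<beta> Q C u"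
      show False
        by (rule hardy_sobolev_critical[of A \<beta> Q C, OF A(1) A(2) An0 b assms(6,7) C])
          (assumption, rule H[rule_format])
    qed
  qed
qed

end
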